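(* Let $F=(f_1,\dots,f_m):\mathbb A^n_{\mathbb C}\to\mathbb A^m_{\mathbb C}$ be a polynomial mapping, and let $\overline\Gamma_F$, $D_X$, $D_Y$, $\mathscr I_X$, $\mathscr I_Y$ be as defined in the context. For every $\xi\in D_X$, consider the families of ideals $\mathfrak a_{\bullet,\xi}:=\{\mathscr I_{X,\xi}^p\}_{p\ge1}$ and $\mathfrak b_{\bullet,\xi}:=\{\mathscr I_{Y,\xi}^q\}_{q\ge1}$ in $\mathcal O_{\overline\Gamma_F,\xi}$. Then $$\mathcal L^{an}_{\infty,\xi}(F)=\frac1{\mathcal L_{\mathfrak b_{\bullet,\xi}}(\mathfrak a_{\bullet,\xi})}=\frac{1}{\mathcal L_{\mathscr I_{Y,\xi}}(\mathscr I_{X,\xi})}.$$ Equivalently, $$\mathcal L^{an}_{\infty,\xi}(F)=\frac{1}{\inf\left\{\frac qp\in\mathbb Q_{>0}\ \middle|\ \mathscr I_{Y,\xi}^{\,qt}\subseteq\overline{\mathscr I_{X,\xi}^{\,pt}}\ \text{for all } t\gg1\right\}}.$$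
   Context: Conventions: $\inf\varnothing=\infty$, $1/\infty=0$, $1/0=\infty$; $\overline I$ is the integral closure of an ideal $I$. Geometry at infinity: embed $\mathbb A^n_{\mathbb C}\subset\mathbb P^n_{\mathbb C}$ and $\mathbb A^m_{\mathbb C}\subset\mathbb P^m_{\mathbb C}$ in the standard way, with homogeneous coordinates $Z_0,\dots,Z_n$ and $W_0,\dots,W_m$ and hyperplanes at infinity $H_X=\{Z_0=0\}$ and $H_Y=\{W_0=0\}$. Let $\Gamma_F\subseteq\mathbb A^n\times\mathbb A^m$ be the graph of $F$, and let $\overline\Gamma_F$ be the normalization of the Zariski closure of $\Gamma_F$ in $\mathbb P^n\times\mathbb P^m$ ($\Gamma_F$ is regarded as an open subset of $\overline\Gamma_F$). Let $\pi:\overline\Gamma_F\to\mathbb P^n$, $\rho:\overline\Gamma_F\to\mathbb P^m$ be the projections, $D_X:=\pi^{-1}(H_X)$, $D_Y:=\rho^{-1}(H_Y)$ (Cartier divisors), with ideal sheaves $\mathscr I_X,\mathscr I_Y$ on $\overline\Gamma_F$ and stalks $\mathscr I_{X,\xi},\mathscr I_{Y,\xi}$ at $\xi$. Local analytic exponent at infinity: for $\xi\in D_X$ choose $i\in\{1,\dots,n\}$ with $\pi(\xi)\in\{Z_i\ne0\}$ and $\ell\in\{0,\dots,m\}$ with $\rho(\xi)\in\{W_\ell\neq0\}$ (taking $\ell\ge1$ if $\xi\in D_Y$ and $\ell=0$ if $\xi\notin D_Y$), and set $u_X:=(Z_0/Z_i)\circ\pi$, $u_Y:=(W_0/W_\ell)\circ\rho$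 near $\xi$. Then $$\mathcal L^{an}_{\infty,\xi}(F):=\sup\{\theta\ge0\mid\exists\,C>0:\ |u_Y|\le C|u_X|^\theta\text{ on }(U_\xi\cap\Gamma_F)\setminus D_X\},$$ where $U_\xi$ is a sufficiently small analytic neighborhood of $\xi$ in $\overline\Gamma_F$. Algebraic exponent: for families $\mathfrak a_\bullet=\{\mathfrak a_p\}_{p\ge1}$, $\mathfrak b_\bullet=\{\mathfrak b_q\}_{q\ge1}$ of ideals in a Noetherian ring, $\mathcal L_{\mathfrak b_\bullet}(\mathfrak a_\bullet):=\inf\{\frac qp\in\mathbb Q_{>0}:\mathfrak b_{qt}\subseteq\overline{\mathfrak a_{pt}}\text{ for all integers }t\gg1\}$; for ideals, $\mathcal L_{\mathfrak b}(\mathfrak a)$ is this invariant for the families of powers $\{\mathfrak a^p\}$, $\{\mathfrak b^q\}$. (When $\xi\notin D_Y$ one has $\mathscr I_{Y,\xi}=\mathcal O_{\overline\Gamma_F,\xi}$ and the same formula is used.) *)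

theory Defs
  imports
    "HOL-Analysis.Analysis"
    "HOL-Algebra.Ideal_Product"
    "HOL-Library.Poly_Mapping"
    "HOL-Library.Extended_Real"
    "HOL-Computational_Algebra.Polynomial"
    "HOL-Computational_Algebra.Fraction_Field"
begin

section \<open>Polynomials\<close>

type_synonym 'v cpoly = "('v \<Rightarrow>\<^sub>0 nat) \<Rightarrow>\<^sub>0 complex"

type_synonym ratfun = "nat cpoly fract"

definition cconst :: "complex \<Rightarrow> 'v cpoly" where
  "cconst c = Poly_Mapping.single 0 c"

definition cvar :: "'v \<Rightarrow> 'v cpoly" where
  "cvar v = Poly_Mapping.single (Poly_Mapping.single v 1) 1"

text \<open>Substitution \<open>a\<close> of the variables; \<open>\<kappa>\<close> embeds the coefficients into the target ring.\<close>

definition cpoly_subst :: "(complex \<Rightarrow> 'b::comm_ring_1) \<Rightarrow> ('v \<Rightarrow> 'b) \<Rightarrow> 'v cpoly \<Rightarrow> 'b" where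
  "cpoly_subst \<kappa> a p =
     (\<Sum>\<mu>\<in>Poly_Mapping.keys p. \<kappa> (Poly_Mapping.lookup p \<mu>) *
        (\<Prod>v\<in>Poly_Mapping.keys \<mu>. a v ^ Poly_Mapping.lookup \<mu> v))"

abbreviation cpoly_eval :: "('v \<Rightarrow> complex) \<Rightarrow> 'v cpoly \<Rightarrow> complex" where
  "cpoly_eval \<equiv> cpoly_subst (\<lambda>c. c)"

text \<open>The affine coordinates on \<open>\<bbbA>\<^sup>n\<close> are \<open>x\<^sub>1, \<dots>, x\<^sub>n\<close>; index \<open>0\<close> is kept for
  the homogenizing coordinate.\<close>

definition cpoly_ring :: "nat \<Rightarrow> nat cpoly set" where
  "cpoly_ring n = {p. \<forall>\<mu>\<in>Poly_Mapping.keys p. Poly_Mapping.keys \<mu> \<subseteq> {1..n}}"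

definition ratfun_field :: "nat \<Rightarrow> ratfun set" where
  "ratfun_field n = {Fract p q | p q. p \<in> cpoly_ring n \<and> q \<in> cpoly_ring n \<and> q \<noteq> 0}"

text \<open>Polynomials in \<open>Z\<^sub>0, \<dots>, Z\<^sub>n\<close> (tagged \<open>Inl\<close>) and \<open>W\<^sub>0, \<dots>, W\<^sub>m\<close> (tagged \<open>Inr\<close>)
  that are bihomogeneous of bidegree \<open>(d, e)\<close>.\<close>

definition bihomogeneous :: "nat \<Rightarrow> nat \<Rightarrow> nat \<Rightarrow> nat \<Rightarrow> (nat + nat) cpoly \<Rightarrow> bool" where
  "bihomogeneous n m d e G \<longleftrightarrow>
     (\<forall>\<mu>\<in>Poly_Mapping.keys G.
        Poly_Mapping.keys \<mu> \<subseteq> Inl ` {0..n} \<union> Inr ` {0..m} \<and>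
        (\<Sum>j=0..n. Poly_Mapping.lookup \<mu> (Inl j)) = d \<and>
        (\<Sum>l=0..m. Poly_Mapping.lookup \<mu> (Inr l)) = e)"


section \<open>Ideals, integral closure and asymptotic exponents\<close>

definition subring_of :: "'a::comm_ring_1 set \<Rightarrow> 'a ring" where
  "subring_of S = \<lparr>carrier = S, mult = (*), one = 1, zero = 0, add = (+)\<rparr>"

definition integral_closure_in :: "'a::field set \<Rightarrow> 'a set \<Rightarrow> 'a set" where
  "integral_closure_in K A =
     {h \<in> K. \<exists>p. lead_coeff p = 1 \<and> (\<forall>j. coeff p j \<in> A) \<and> poly p h = 0}"

abbreviation ideal_power :: "('a, 'b) ring_scheme \<Rightarrow> 'a set \<Rightarrow> nat \<Rightarrow> 'a set" where
  "ideal_power R I p \<equiv> I [^]\<^bsub>ideals_set R\<^esub> p"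

text \<open>The integral closure of the ideal \<open>I\<close>: solutions of
  \<open>x\<^sup>d + a\<^sub>1 x\<^bsup>d-1\<^esup> + \<dots> + a\<^sub>d = 0\<close> with \<open>a\<^sub>j \<in> I\<^sup>j\<close>.\<close>

definition ideal_integral_closure :: "('a, 'b) ring_scheme \<Rightarrow> 'a set \<Rightarrow> 'a set" where
  "ideal_integral_closure R I =
     {x \<in> carrier R. \<exists>(d::nat) a. d > 0 \<and> (\<forall>j\<in>{1..d}. a j \<in> ideal_power R I j) \<and>
        x [^]\<^bsub>R\<^esub> d \<oplus>\<^bsub>R\<^esub> (\<Oplus>\<^bsub>R\<^esub>j\<in>{1..d}. a j \<otimes>\<^bsub>R\<^esub> x [^]\<^bsub>R\<^esub> (d - j)) = \<zero>\<^bsub>R\<^esub>}"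

text \<open>\<open>loj_families R \<bb> \<aa>\<close> is \<open>\<L>\<^bsub>\<bb>\<^esub>(\<aa>)\<close>. The conventions \<open>inf \<emptyset> = \<infinity>\<close>, \<open>1/\<infinity> = 0\<close> and \<open>1/0 = \<infinity>\<close> are those of
  \<^typ>\<open>ereal\<close>.\<close>

definition loj_families ::
    "('a, 'b) ring_scheme \<Rightarrow> (nat \<Rightarrow> 'a set) \<Rightarrow> (nat \<Rightarrow> 'a set) \<Rightarrow> ereal" where
  "loj_families R \<bb> \<aa> =
     Inf {ereal (real q / real p) | p q :: nat. p > 0 \<and> q > 0 \<and>
            (\<forall>\<^sub>F t in sequentially. \<bb> (q * t) \<subseteq> ideal_integral_closure R (\<aa> (p * t)))}"

definition loj_ideals :: "('a, 'b) ring_scheme \<Rightarrow> 'a set \<Rightarrow> 'a set \<Rightarrow> ereal" where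
  "loj_ideals R J I = loj_families R (ideal_power R J) (ideal_power R I)"


section \<open>Projective spaces and the closure of the graph\<close>

text \<open>A point of \<open>\<bbbP>\<^sup>N\<close> is the class of a nonzero vector \<open>(z\<^sub>0, \<dots>, z\<^sub>N)\<close>, padded with
  zeros, modulo nonzero scalars.\<close>

type_synonym ppoint = "(nat \<Rightarrow> complex) set"

definition proj_class :: "(nat \<Rightarrow> complex) \<Rightarrow> ppoint" where
  "proj_class z = {\<lambda>j. c * z j | c. c \<noteq> 0}"

definition proj_space :: "nat \<Rightarrow> ppoint set" where
  "proj_space N = proj_class ` {z. (\<exists>j. z j \<noteq> 0) \<and> (\<forall>j>N. z j = 0)}"

definition coord_open :: "nat \<Rightarrow> ppoint set" where
  "coord_open j = {P. \<forall>z\<in>P. z j \<noteq> 0}"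

definition hyperplane_infinity :: "nat \<Rightarrow> ppoint set" where
  "hyperplane_infinity N = {P \<in> proj_space N. \<forall>z\<in>P. z 0 = 0}"

text \<open>The value at \<open>P \<in> {Z\<^sub>i \<noteq> 0}\<close> of the function \<open>Z\<^sub>j / Z\<^sub>i\<close>.\<close>

definition coord_ratio :: "nat \<Rightarrow> nat \<Rightarrow> ppoint \<Rightarrow> complex" where
  "coord_ratio j i P = (THE c. \<forall>z\<in>P. z j / z i = c)"

definition affine_point :: "nat \<Rightarrow> (nat \<Rightarrow> complex) \<Rightarrow> ppoint" where
  "affine_point N x = proj_class (\<lambda>j. if j = 0 then 1 else if j \<le> N then x j else 0)"

definition graph_points :: "nat \<Rightarrow> nat \<Rightarrow> (nat \<Rightarrow> nat cpoly) \<Rightarrow> (ppoint \<times> ppoint) set" where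
  "graph_points n m f =
     range (\<lambda>x. (affine_point n x, affine_point m (\<lambda>k. cpoly_eval x (f k))))"

definition vanishes_at :: "(nat + nat) cpoly \<Rightarrow> ppoint \<times> ppoint \<Rightarrow> bool" where
  "vanishes_at G v \<longleftrightarrow> (\<forall>z\<in>fst v. \<forall>w\<in>snd v. cpoly_eval (case_sum z w) G = 0)"

definition graph_closure :: "nat \<Rightarrow> nat \<Rightarrow> (nat \<Rightarrow> nat cpoly) \<Rightarrow> (ppoint \<times> ppoint) set" where
  "graph_closure n m f =
     {v \<in> proj_space n \<times> proj_space m.
        \<forall>d e G. bihomogeneous n m d e G \<and> (\<forall>g\<in>graph_points n m f. vanishes_at G g)
                 \<longrightarrow> vanishes_at G v}"


section \<open>The normalization\<close>

text \<open>The first projection identifies the graph, which is dense in its closure, with \<open>\<bbbA>\<^sup>n\<close>. So the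
  function field of the closure is \<open>\<complex>(x\<^sub>1, \<dots>, x\<^sub>n)\<close>, and restricting to it amounts to the
  substitution \<open>Z = (1, x\<^sub>1, \<dots>, x\<^sub>n)\<close>, \<open>W = (1, f\<^sub>1, \<dots>, f\<^sub>m)\<close>.\<close>

definition graph_coord :: "(nat \<Rightarrow> nat cpoly) \<Rightarrow> nat + nat \<Rightarrow> nat cpoly" where
  "graph_coord f = case_sum (\<lambda>j. if j = 0 then 1 else cvar j) (\<lambda>l. if l = 0 then 1 else f l)"

definition graph_restrict :: "(nat \<Rightarrow> nat cpoly) \<Rightarrow> (nat + nat) cpoly \<Rightarrow> nat cpoly" where
  "graph_restrict f G = cpoly_subst cconst (graph_coord f) G"

text \<open>The local ring of the (non-normalized) closure at \<open>v\<close>.\<close>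

definition closure_local_ring ::
    "nat \<Rightarrow> nat \<Rightarrow> (nat \<Rightarrow> nat cpoly) \<Rightarrow> ppoint \<times> ppoint \<Rightarrow> ratfun set" where
  "closure_local_ring n m f v =
     {Fract (graph_restrict f G) (graph_restrict f H) | G H d e.
        bihomogeneous n m d e G \<and> bihomogeneous n m d e H \<and> \<not> vanishes_at H v}"

text \<open>The stalk at \<open>v\<close> of the direct image of the structure sheaf of the normalization.\<close>

definition normalized_stalk ::
    "nat \<Rightarrow> nat \<Rightarrow> (nat \<Rightarrow> nat cpoly) \<Rightarrow> ppoint \<times> ppoint \<Rightarrow> ratfun set" where
  "normalized_stalk n m f v = integral_closure_in (ratfun_field n) (closure_local_ring n m f v)"

text \<open>The normalization is finite over the closure, so its (closed) points over \<open>v\<close> are the maximal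
  ideals of \<^const>\<open>normalized_stalk\<close>, and its local rings are the localizations there. A point is
  encoded as the pair of \<open>v\<close> and the maximal ideal.\<close>

type_synonym npoint = "(ppoint \<times> ppoint) \<times> ratfun set"

definition norm_graph :: "nat \<Rightarrow> nat \<Rightarrow> (nat \<Rightarrow> nat cpoly) \<Rightarrow> npoint set" where
  "norm_graph n m f =
     {(v, M). v \<in> graph_closure n m f \<and> maximalideal M (subring_of (normalized_stalk n m f v))}"

definition norm_local_ring :: "nat \<Rightarrow> nat \<Rightarrow> (nat \<Rightarrow> nat cpoly) \<Rightarrow> npoint \<Rightarrow> ratfun set" where
  "norm_local_ring n m f \<xi> =
     {a / b | a b. a \<in> normalized_stalk n m f (fst \<xi>) \<and> b \<in> normalized_stalk n m f (fst \<xi>) - snd \<xi>}"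

definition norm_local_maximal_ideal ::
    "nat \<Rightarrow> nat \<Rightarrow> (nat \<Rightarrow> nat cpoly) \<Rightarrow> npoint \<Rightarrow> ratfun set" where
  "norm_local_maximal_ideal n m f \<xi> =
     {a / b | a b. a \<in> snd \<xi> \<and> b \<in> normalized_stalk n m f (fst \<xi>) - snd \<xi>}"

abbreviation local_ring_at :: "nat \<Rightarrow> nat \<Rightarrow> (nat \<Rightarrow> nat cpoly) \<Rightarrow> npoint \<Rightarrow> ratfun ring" where
  "local_ring_at n m f \<xi> \<equiv> subring_of (norm_local_ring n m f \<xi>)"

text \<open>The value at \<open>\<xi>\<close> of a function \<open>h\<close> regular at \<open>\<xi>\<close>: its class in the residue field \<open>\<complex>\<close>.\<close>

definition value_at :: "nat \<Rightarrow> nat \<Rightarrow> (nat \<Rightarrow> nat cpoly) \<Rightarrow> npoint \<Rightarrow> ratfun \<Rightarrow> complex" where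
  "value_at n m f \<xi> h = (THE c. h - Fract (cconst c) 1 \<in> norm_local_maximal_ideal n m f \<xi>)"

text \<open>The analytic topology: the coarsest one for which the domain of every rational function is open
  and the function is continuous on it. Every affine open set is an intersection of finitely many
  such domains (of generators of its coordinate ring), so all Zariski open sets are open.\<close>

definition analytic_topology :: "nat \<Rightarrow> nat \<Rightarrow> (nat \<Rightarrow> nat cpoly) \<Rightarrow> npoint topology" where
  "analytic_topology n m f =
     topology_generated_by
       {{\<eta> \<in> norm_graph n m f. h \<in> norm_local_ring n m f \<eta> \<and> value_at n m f \<eta> h \<in> V} | h V. open V}"

definition proj_X :: "npoint \<Rightarrow> ppoint" where
  "proj_X \<xi> = fst (fst \<xi>)"

definition proj_Y :: "npoint \<Rightarrow> ppoint" where
  "proj_Y \<xi> = snd (fst \<xi>)"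

definition div_X :: "nat \<Rightarrow> nat \<Rightarrow> (nat \<Rightarrow> nat cpoly) \<Rightarrow> npoint set" where
  "div_X n m f = {\<xi> \<in> norm_graph n m f. proj_X \<xi> \<in> hyperplane_infinity n}"

definition div_Y :: "nat \<Rightarrow> nat \<Rightarrow> (nat \<Rightarrow> nat cpoly) \<Rightarrow> npoint set" where
  "div_Y n m f = {\<xi> \<in> norm_graph n m f. proj_Y \<xi> \<in> hyperplane_infinity m}"

text \<open>The graph, which is normal, as a subset of the normalization.\<close>

definition graph_in_norm :: "nat \<Rightarrow> nat \<Rightarrow> (nat \<Rightarrow> nat cpoly) \<Rightarrow> npoint set" where
  "graph_in_norm n m f = {\<xi> \<in> norm_graph n m f. fst \<xi> \<in> graph_points n m f}"

text \<open>Stalks of the ideal sheaves of the two divisors: they are generated by the pullbacks of the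
  local equations \<open>Z\<^sub>0 / Z\<^sub>i\<close> and \<open>W\<^sub>0 / W\<^sub>l\<close> of the hyperplanes at infinity. The equations for
  different admissible \<open>i\<close> (or \<open>l\<close>) differ by units.\<close>

definition ideal_X :: "nat \<Rightarrow> nat \<Rightarrow> (nat \<Rightarrow> nat cpoly) \<Rightarrow> npoint \<Rightarrow> ratfun set" where
  "ideal_X n m f \<xi> =
     Idl\<^bsub>local_ring_at n m f \<xi>\<^esub>
       {Fract (graph_coord f (Inl 0)) (graph_coord f (Inl i)) | i. i \<le> n \<and> proj_X \<xi> \<in> coord_open i}"

definition ideal_Y :: "nat \<Rightarrow> nat \<Rightarrow> (nat \<Rightarrow> nat cpoly) \<Rightarrow> npoint \<Rightarrow> ratfun set" where
  "ideal_Y n m f \<xi> =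
     Idl\<^bsub>local_ring_at n m f \<xi>\<^esub>
       {Fract (graph_coord f (Inr 0)) (graph_coord f (Inr l)) | l. l \<le> m \<and> proj_Y \<xi> \<in> coord_open l}"


section \<open>The local analytic exponent at infinity\<close>

text \<open>The choices of \<open>i\<close> and \<open>l\<close> in the definition of \<open>u\<^sub>X\<close> and \<open>u\<^sub>Y\<close>.\<close>

definition admissible_charts ::
    "nat \<Rightarrow> nat \<Rightarrow> (nat \<Rightarrow> nat cpoly) \<Rightarrow> npoint \<Rightarrow> nat \<Rightarrow> nat \<Rightarrow> bool" where
  "admissible_charts n m f \<xi> i l \<longleftrightarrow>
     i \<in> {1..n} \<and> proj_X \<xi> \<in> coord_open i \<and>
     l \<in> {0..m} \<and> proj_Y \<xi> \<in> coord_open l \<and>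
     (if \<xi> \<in> div_Y n m f then l \<ge> 1 else l = 0)"

text \<open>The neighbourhood \<open>U\<close> is small enough for \<open>u\<^sub>X = Z\<^sub>0 / Z\<^sub>i\<close> and \<open>u\<^sub>Y = W\<^sub>0 / W\<^sub>l\<close> to be
  defined on it, and may be shrunk further depending on \<open>\<theta>\<close>.\<close>

definition loj_analytic ::
    "nat \<Rightarrow> nat \<Rightarrow> (nat \<Rightarrow> nat cpoly) \<Rightarrow> npoint \<Rightarrow> nat \<Rightarrow> nat \<Rightarrow> ereal" where
  "loj_analytic n m f \<xi> i l =
     Sup {ereal \<theta> | \<theta>. \<theta> \<ge> 0 \<and>
       (\<exists>C>0. \<exists>U. openin (analytic_topology n m f) U \<and> \<xi> \<in> U \<and>
          (\<forall>\<eta>\<in>U. proj_X \<eta> \<in> coord_open i \<and> proj_Y \<eta> \<in> coord_open l) \<and>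
          (\<forall>\<eta>\<in>(U \<inter> graph_in_norm n m f) - div_X n m f.
             norm (coord_ratio 0 l (proj_Y \<eta>))
               \<le> C * norm (coord_ratio 0 i (proj_X \<eta>)) powr \<theta>))}"

end

theory Submission
  imports Defs "Jordan_Normal_Form.Char_Poly" "HOL-Algebra.Algebraic_Closure_Type"
begin

text \<open>Near \<open>\<xi>\<close> the two divisors have local equations \<open>u\<close> and \<open>y\<close>, and the local ring is integrally
  closed, so the ideal inclusions defining the algebraic exponent for \<open>q/p\<close> all say that \<open>h = y\<^sup>q / u\<^sup>p\<close> is
  regular at \<open>\<xi>\<close>. If \<open>h\<close> is regular, it is bounded near \<open>\<xi>\<close>, which gives the analytic inequality with
  exponent \<open>p/q\<close>. If \<open>h\<close> is not regular, it is not integral over the local ring, so there is a complex point of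
  the ring obtained by adjoining \<open>1/h\<close> which lies over \<open>\<xi>\<close> and at which \<open>1/h\<close> vanishes. Since a Zariski dense open set
  is dense in the Euclidean topology, this point is a limit of points of the graph; along
  them \<open>h\<close> is unbounded, which contradicts the analytic inequality with any exponent at least \<open>p/q\<close>.

  Density is obtained from Noether normalization, the normality of polynomial rings and the continuity
  of roots, with places in the role of points so that homomorphisms extend to integral elements.\<close>

hide_const (open) up_ring.coeff up_ring.monom Poly_Mapping.degree Module.smult
  Polynomials.lead_coeff Polynomials.degree

section \<open>Subrings and integral elements\<close>

text \<open>The local ring at \<open>\<xi>\<close> is not finitely generated. Yet the analytic
  topology is generated by conditions on one rational function each, so a neighbourhood of
  \<open>\<xi>\<close> constrains finitely many functions, and it suffices to approximate a point on
  a finite set of functions.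

  What remains is of going-down type over a normal base: a point has to be moved off a proper closed
  set, and some point above the moved base point has to stay close to it. Integral closedness of the
  polynomial ring gives minimal polynomials with coefficients in that ring, so every root of a
  specialized minimal polynomial is the value of the element at some point. Continuity of roots
  treats one element at a time; making it simultaneous for all generators is the main obstacle.

  A place contains every element integral over it, so one application of Zorn's lemma serves all the
  integral extensions in play, and the algebraic closedness of \<complex> supplies the values. In
  the final estimate only the sign of \<open>p - \<theta> q\<close> matters, which covers the
  boundary exponent \<open>\<theta> = p/q\<close> as well.\<close>

locale subring_set =
  fixes A :: "'a::comm_ring_1 set"
  assumes one_mem: "1 \<in> A"
    and diff_mem: "x \<in> A \<Longrightarrow> y \<in> A \<Longrightarrow> x - y \<in> A"
    and mult_mem: "x \<in> A \<Longrightarrow> y \<in> A \<Longrightarrow> x * y \<in> A"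
begin

lemma zero_mem: "0 \<in> A"
  using diff_mem[OF one_mem one_mem] by simp

lemma uminus_mem: "x \<in> A \<Longrightarrow> - x \<in> A"
  using diff_mem[OF zero_mem] by fastforce

lemma add_mem: "x \<in> A \<Longrightarrow> y \<in> A \<Longrightarrow> x + y \<in> A"
  using diff_mem[of x "- y"] uminus_mem by fastforce

lemma sum_mem: "(\<And>i. i \<in> I \<Longrightarrow> f i \<in> A) \<Longrightarrow> sum f I \<in> A"
  by (induction I rule: infinite_finite_induct) (auto intro: zero_mem add_mem)

lemma prod_mem: "(\<And>i. i \<in> I \<Longrightarrow> f i \<in> A) \<Longrightarrow> prod f I \<in> A"
  by (induction I rule: infinite_finite_induct) (auto intro: one_mem mult_mem)

lemma power_mem: "x \<in> A \<Longrightarrow> x ^ n \<in> A"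
  by (induction n) (auto intro: one_mem mult_mem)

lemmas mem_intros = one_mem zero_mem diff_mem mult_mem uminus_mem add_mem sum_mem prod_mem power_mem

end

definition polys_over :: "'a::zero set \<Rightarrow> 'a poly set" where
  "polys_over A = {p. \<forall>i. coeff p i \<in> A}"

lemma polys_overD: "p \<in> polys_over A \<Longrightarrow> coeff p i \<in> A"
  by (simp add: polys_over_def)

lemma polys_over_mono: "A \<subseteq> B \<Longrightarrow> polys_over A \<subseteq> polys_over B"
  by (auto simp: polys_over_def)

context subring_set
begin

lemma subring_set_polys_over: "subring_set (polys_over A)"
  by unfold_locales
    (auto simp: polys_over_def coeff_mult one_pCons coeff_pCons intro!: mem_intros split: nat.split)

lemma monom_mem_polys_over: "a \<in> A \<Longrightarrow> monom a n \<in> polys_over A"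
  by (auto simp: polys_over_def intro: zero_mem)

lemma const_mem_polys_over: "a \<in> A \<Longrightarrow> [:a:] \<in> polys_over A"
  using monom_mem_polys_over[of a 0] by (simp add: monom_0)

lemma pCons_mem_polys_over: "a \<in> A \<Longrightarrow> p \<in> polys_over A \<Longrightarrow> pCons a p \<in> polys_over A"
  by (auto simp: polys_over_def coeff_pCons split: nat.split)

lemma smult_mem_polys_over: "a \<in> A \<Longrightarrow> p \<in> polys_over A \<Longrightarrow> smult a p \<in> polys_over A"
  by (auto simp: polys_over_def intro: mult_mem)

lemma poly_mem: "p \<in> polys_over A \<Longrightarrow> x \<in> A \<Longrightarrow> poly p x \<in> A"
  by (auto simp: poly_altdef polys_over_def intro!: mem_intros)

text \<open>Cancelling the leading term of \<open>p\<close> against a monic \<open>q\<close> takes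
  no inverses, so quotient and remainder keep their coefficients in \<open>A\<close>.\<close>

lemma monic_division:
  assumes "p \<in> polys_over A" "q \<in> polys_over A" "lead_coeff q = 1"
  obtains d r where "d \<in> polys_over A" "r \<in> polys_over A" "p = q * d + r" "r = 0 \<or> degree r < degree q"
proof -
  interpret P: subring_set "polys_over A" by (rule subring_set_polys_over)
  have "\<exists>d\<in>polys_over A. \<exists>r\<in>polys_over A. p = q * d + r \<and> (r = 0 \<or> degree r < degree q)"
    using assms(1)
  proof (induction "degree p" arbitrary: p rule: less_induct)
    case less
    show ?case
    proof (cases "p = 0 \<or> degree p < degree q")
      case True
      then show ?thesis using less.prems P.zero_mem by (intro bexI[of _ 0] bexI[of _ p]) auto
    next
      case False
      define m where "m = monom (lead_coeff p) (degree p - degree q)"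
      have m: "m \<in> polys_over A"
        using less.prems by (auto simp: m_def intro: monom_mem_polys_over polys_overD)
      define p' where "p' = p - q * m"
      have p': "p' \<in> polys_over A" using less.prems m assms by (auto simp: p'_def intro: P.mem_intros)
      have qm: "degree (q * m) \<le> degree p" "coeff (q * m) (degree p) = lead_coeff p"
      proof -
        have "degree (q * m) \<le> degree q + degree m" by (rule degree_mult_le)
        also have "\<dots> \<le> degree p"
          unfolding m_def using False degree_monom_le[of "lead_coeff p" "degree p - degree q"] by linarith
        finally show "degree (q * m) \<le> degree p" .
        have "coeff (monom (lead_coeff p) (degree p - degree q) * q) (degree p) = lead_coeff p"
          using False assms(3) by (auto simp: coeff_monom_mult)
        then show "coeff (q * m) (degree p) = lead_coeff p" by (simp add: m_def mult.commute)
      qed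
      have le: "degree p' \<le> degree p" unfolding p'_def by (rule degree_diff_le) (use qm in auto)
      have c0: "coeff p' (degree p) = 0" using qm by (simp add: p'_def)
      show ?thesis
      proof (cases "p' = 0")
        case True
        then have "p = q * m + 0" by (simp add: p'_def)
        then show ?thesis using m P.zero_mem by blast
      next
        case False
        then have "degree p' \<noteq> degree p" using c0 by (metis leading_coeff_0_iff)
        then have "degree p' < degree p" using le by simp
        from less.hyps[OF this p'] obtain d r where dr: "d \<in> polys_over A" "r \<in> polys_over A"
          "p' = q * d + r" "r = 0 \<or> degree r < degree q" by blast
        have "p = q * (d + m) + r" using dr(3) by (simp add: p'_def algebra_simps)
        then show ?thesis using dr m by (intro bexI[of _ "d + m"] bexI[of _ r]) (auto intro: P.add_mem)
      qed
    qed
  qed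
  then show ?thesis using that by blast
qed

end

definition adjoin :: "'a::comm_ring_1 set \<Rightarrow> 'a \<Rightarrow> 'a set" where
  "adjoin A x = (\<lambda>p. poly p x) ` polys_over A"

definition integral_over :: "'a::comm_ring_1 set \<Rightarrow> 'a \<Rightarrow> bool" where
  "integral_over A x \<longleftrightarrow> (\<exists>p\<in>polys_over A. lead_coeff p = 1 \<and> poly p x = 0)"

lemma integral_over_mono: "A \<subseteq> B \<Longrightarrow> integral_over A x \<Longrightarrow> integral_over B x"
  unfolding integral_over_def using polys_over_mono by blast

context subring_set
begin

lemma subring_set_adjoin: "subring_set (adjoin A x)"
proof -
  interpret P: subring_set "polys_over A" by (rule subring_set_polys_over)
  show ?thesis
  proof
    show "1 \<in> adjoin A x" unfolding adjoin_def using P.one_mem by (force simp: image_iff)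
  next
    fix a b assume "a \<in> adjoin A x" "b \<in> adjoin A x"
    then obtain p q where pq: "p \<in> polys_over A" "q \<in> polys_over A" "a = poly p x" "b = poly q x"
      by (auto simp: adjoin_def)
    then show "a - b \<in> adjoin A x" "a * b \<in> adjoin A x"
      unfolding adjoin_def using P.diff_mem[OF pq(1,2)] P.mult_mem[OF pq(1,2)]
      by (auto simp: image_iff intro: bexI[of _ "p - q"] bexI[of _ "p * q"])
  qed
qed

lemma base_subset_adjoin: "A \<subseteq> adjoin A x"
  unfolding adjoin_def using const_mem_polys_over by (force simp: image_iff)

lemma gen_mem_adjoin: "x \<in> adjoin A x"
  unfolding adjoin_def using pCons_mem_polys_over[OF zero_mem const_mem_polys_over[OF one_mem]]
  by (force simp: image_iff)

lemma adjoin_subset: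
  assumes "subring_set B" "A \<subseteq> B" "x \<in> B"
  shows "adjoin A x \<subseteq> B"
  using subring_set.poly_mem[OF assms(1) _ assms(3)] polys_over_mono[OF assms(2)]
  by (auto simp: adjoin_def)

lemma integral_over_mem: "x \<in> A \<Longrightarrow> integral_over A x"
  unfolding integral_over_def
  by (rule bexI[of _ "[:-x, 1:]"])
    (auto intro!: pCons_mem_polys_over const_mem_polys_over mem_intros)

end

section \<open>Module-finite extensions and transitivity of integrality\<close>

inductive_set span_over :: "'a::comm_ring_1 set \<Rightarrow> 'a set \<Rightarrow> 'a set" for A W where
  zero: "0 \<in> span_over A W"
| step: "a \<in> A \<Longrightarrow> w \<in> W \<Longrightarrow> x \<in> span_over A W \<Longrightarrow> a * w + x \<in> span_over A W"

definition finite_over :: "'a::comm_ring_1 set \<Rightarrow> 'a set \<Rightarrow> bool" where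
  "finite_over A S \<longleftrightarrow> (\<exists>W. finite W \<and> W \<subseteq> S \<and> S \<subseteq> span_over A W)"

lemma span_over_add: "x \<in> span_over A W \<Longrightarrow> y \<in> span_over A W \<Longrightarrow> x + y \<in> span_over A W"
  by (induction x rule: span_over.induct) (auto simp: add.assoc intro: span_over.step)

lemma span_over_sum: "(\<And>i. i \<in> I \<Longrightarrow> f i \<in> span_over A W) \<Longrightarrow> sum f I \<in> span_over A W"
  by (induction I rule: infinite_finite_induct) (auto intro: span_over_add span_over.zero)

lemma span_over_base: "a \<in> A \<Longrightarrow> w \<in> W \<Longrightarrow> a * w \<in> span_over A W"
  using span_over.step[OF _ _ span_over.zero] by fastforce

lemma (in subring_set) span_over_repr:
  assumes "x \<in> span_over A W" "finite W"
  obtains c where "\<And>w. c w \<in> A" "x = (\<Sum>w\<in>W. c w * w)"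
proof -
  from assms have "\<exists>c. (\<forall>w. c w \<in> A) \<and> x = (\<Sum>w\<in>W. c w * w)"
  proof (induction x rule: span_over.induct)
    case zero
    then show ?case by (intro exI[of _ "\<lambda>_. 0"]) (auto intro: zero_mem)
  next
    case (step a w x)
    then obtain c where c: "\<And>w. c w \<in> A" "x = (\<Sum>w\<in>W. c w * w)" by auto
    let ?c = "c(w := c w + a)"
    have "(\<Sum>v\<in>W. ?c v * v) = (\<Sum>v\<in>W. c v * v + (if v = w then a * w else 0))"
      by (rule sum.cong) (auto simp: algebra_simps)
    also have "\<dots> = a * w + x" using step by (simp add: sum.distrib c(2) sum.delta)
    finally show ?case using c step by (intro exI[of _ ?c]) (auto intro: add_mem)
  qed
  then show ?thesis using that by blast
qed

text \<open>The Leibniz expansion of the determinant of \<open>X I - M\<close> uses ring operations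
  only.\<close>

lemma (in subring_set) char_poly_mem_polys_over:
  assumes "M \<in> carrier_mat n n" "\<And>i j. i < n \<Longrightarrow> j < n \<Longrightarrow> M $$ (i, j) \<in> A"
  shows "char_poly M \<in> polys_over A"
proof -
  interpret P: subring_set "polys_over A" by (rule subring_set_polys_over)
  have ent: "char_poly_matrix M $$ (i, j) \<in> polys_over A" if "i < n" "j < n" for i j
    using assms that
    by (auto simp: char_poly_matrix_def intro!: pCons_mem_polys_over const_mem_polys_over mem_intros P.mem_intros)
  have "signof p \<in> polys_over A" for p :: "nat \<Rightarrow> nat"
    by (auto simp: sign_def intro: P.mem_intros)
  moreover have "char_poly_matrix M \<in> carrier_mat n n" using assms by simp
  moreover have "(\<Prod>i = 0..<n. char_poly_matrix M $$ (i, p i)) \<in> polys_over A" if "p permutes {0..<n}" for p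
    using permutes_in_image[OF that] by (intro P.prod_mem ent) auto
  ultimately show ?thesis
    unfolding char_poly_def det_def by (simp, intro P.sum_mem P.mult_mem) auto
qed

text \<open>The determinant trick: an element acting on a finitely generated faithful module is a root of
  the characteristic polynomial of a matrix of its action.\<close>

lemma integral_over_if_stable_span:
  fixes z :: "'a::field"
  assumes "subring_set A" "finite W" "w0 \<in> W" "w0 \<noteq> 0"
    and stable: "\<And>w. w \<in> W \<Longrightarrow> z * w \<in> span_over A W"
  shows "integral_over A z"
proof -
  interpret subring_set A by fact
  obtain w :: "nat \<Rightarrow> 'a" and n where w: "bij_betw w {..<n} W"
    using ex_bij_betw_nat_finite[OF assms(2)] by (auto simp: atLeast0LessThan)
  have "\<exists>c. (\<forall>j. c j \<in> A) \<and> z * w i = (\<Sum>j<n. c j * w j)" if "i < n" for i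
  proof -
    have "w i \<in> W" using w that by (auto simp: bij_betw_def)
    then obtain c where c: "\<And>w. c w \<in> A" "z * w i = (\<Sum>w\<in>W. c w * w)"
      using span_over_repr[OF stable assms(2)] by blast
    have "(\<Sum>w\<in>W. c w * w) = (\<Sum>j<n. c (w j) * w j)"
      using sum.reindex_bij_betw[OF w, of "\<lambda>w. c w * w"] by simp
    then show ?thesis using c by (intro exI[of _ "c \<circ> w"]) auto
  qed
  then obtain c where c: "\<And>i j. i < n \<Longrightarrow> c i j \<in> A" "\<And>i. i < n \<Longrightarrow> z * w i = (\<Sum>j<n. c i j * w j)"
    by metis
  define M where "M = Matrix.mat n n (\<lambda>(i, j). c i j)"
  \<comment> \<open>The generators themselves form an eigenvector of \<open>M\<close> for
    \<open>z\<close>; \<open>w0\<close> makes it nonzero.\<close>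
  define v where "v = Matrix.vec n w"
  have M: "M \<in> carrier_mat n n" by (simp add: M_def)
  obtain i0 where "i0 < n" "w i0 = w0" using w assms(3) by (force simp: bij_betw_def)
  then have "v \<noteq> 0\<^sub>v n" using assms(4) unfolding v_def by (metis index_vec index_zero_vec(1))
  moreover have "M *\<^sub>v v = z \<cdot>\<^sub>v v"
    by (rule eq_vecI) (auto simp: M_def v_def scalar_prod_def c(2) atLeast0LessThan)
  ultimately have "eigenvalue M z"
    unfolding eigenvalue_def eigenvector_def by (intro exI[of _ v]) (auto simp: M_def v_def)
  then have "poly (char_poly M) z = 0" using eigenvalue_root_char_poly[OF M] by simp
  moreover have "char_poly M \<in> polys_over A"
    by (rule char_poly_mem_polys_over[OF M]) (auto simp: M_def c)
  ultimately show ?thesis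
    unfolding integral_over_def using degree_monic_char_poly[OF M] by auto
qed

text \<open>Multiplication by \<open>z\<close> maps the generators into \<open>S\<close>, hence into
  their own span. They are not all zero because 1 lies in that span.\<close>

lemma finite_over_integral:
  fixes S :: "'a::field set"
  assumes "subring_set A" "subring_set S" "finite_over A S" "z \<in> S"
  shows "integral_over A z"
proof -
  interpret S: subring_set S by fact
  obtain W where W: "finite W" "W \<subseteq> S" "S \<subseteq> span_over A W" using assms(3) by (auto simp: finite_over_def)
  have "\<exists>w\<in>W. w \<noteq> 0"
  proof (rule ccontr)
    assume *: "\<not> ?thesis"
    have "x = 0" if "x \<in> span_over A W" for x
      using that by induction (use * in auto)
    moreover have "1 \<in> span_over A W" using W S.one_mem by blast
    ultimately show False by (metis zero_neq_one)
  qed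
  then obtain w0 where "w0 \<in> W" "w0 \<noteq> 0" by blast
  moreover have "z * w \<in> span_over A W" if "w \<in> W" for w
    using W(2,3) S.mult_mem[OF assms(4), of w] that by auto
  ultimately show ?thesis by (rule integral_over_if_stable_span[OF assms(1) W(1)])
qed

text \<open>Modulo the monic relation every polynomial in \<open>x\<close> has bounded degree, so
  finitely many powers of \<open>x\<close> span.\<close>

lemma finite_over_adjoin:
  assumes "subring_set A" "integral_over A x"
  shows "finite_over A (adjoin A x)"
proof -
  interpret subring_set A by fact
  interpret S: subring_set "adjoin A x" by (rule subring_set_adjoin)
  obtain p where p: "p \<in> polys_over A" "lead_coeff p = 1" "poly p x = 0"
    using assms(2) by (auto simp: integral_over_def)
  let ?W = "(\<lambda>i. x ^ i) ` {..degree p}"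
  have "poly q x \<in> span_over A ?W" if q: "q \<in> polys_over A" for q
  proof -
    obtain d r where dr: "r \<in> polys_over A" "q = p * d + r" "r = 0 \<or> degree r < degree p"
      using monic_division[OF q p(1,2)] by blast
    have "poly q x = (\<Sum>i\<le>degree r. coeff r i * x ^ i)" using p(3) dr(2) by (simp add: poly_altdef[of r])
    also have "\<dots> \<in> span_over A ?W"
      using dr by (intro span_over_sum span_over_base) (auto simp: polys_over_def)
    finally show ?thesis .
  qed
  then show ?thesis
    unfolding finite_over_def
    by (intro exI[of _ ?W]) (auto simp: adjoin_def[of A x] intro: S.power_mem[unfolded adjoin_def] gen_mem_adjoin[unfolded adjoin_def])
qed

lemma finite_over_trans:
  assumes "subring_set A" "subring_set T" "S \<subseteq> T" "finite_over A S" "finite_over S T"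
  shows "finite_over A T"
proof -
  interpret subring_set A by fact
  interpret T: subring_set T by fact
  obtain W where W: "finite W" "W \<subseteq> S" "S \<subseteq> span_over A W" using assms(4) by (auto simp: finite_over_def)
  obtain U where U: "finite U" "U \<subseteq> T" "T \<subseteq> span_over S U" using assms(5) by (auto simp: finite_over_def)
  let ?X = "(\<lambda>(w, u). w * u) ` (W \<times> U)"
  have 1: "s * u \<in> span_over A ?X" if "s \<in> span_over A W" "u \<in> U" for s u
    using that
  proof induction
    case zero
    then show ?case by (simp add: span_over.zero)
  next
    case (step a w x)
    then have "a * (w * u) + x * u \<in> span_over A ?X" by (intro span_over.step) auto
    then show ?case by (simp add: algebra_simps)
  qed
  have "t \<in> span_over A ?X" if "t \<in> span_over S U" for t
    using that
  proof induction
    case (step a u x)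
    then show ?case using W(3) by (intro span_over_add 1) auto
  qed (rule span_over.zero)
  then show ?thesis
    unfolding finite_over_def using W U assms(3) by (intro exI[of _ ?X]) (auto intro!: T.mult_mem)
qed

lemma finite_over_finite_integral:
  fixes F :: "'a::field set"
  assumes "subring_set A" "finite F" "\<And>b. b \<in> F \<Longrightarrow> integral_over A b"
  shows "\<exists>S. subring_set S \<and> A \<subseteq> S \<and> F \<subseteq> S \<and> finite_over A S"
  using assms(2,3)
proof (induction F)
  case empty
  interpret subring_set A by fact
  have "a \<in> span_over A {1}" if "a \<in> A" for a using span_over_base[OF that, of 1 "{1}"] by simp
  then have "finite_over A A" unfolding finite_over_def using one_mem by (intro exI[of _ "{1}"]) auto
  then show ?case using assms(1) by blast
next
  case (insert b F)
  then obtain S where S: "subring_set S" "A \<subseteq> S" "F \<subseteq> S" "finite_over A S" by blast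
  have b: "integral_over S b" using insert.prems integral_over_mono[OF S(2)] by blast
  note S' = subring_set.subring_set_adjoin[OF S(1), of b] subring_set.base_subset_adjoin[OF S(1), of b]
    subring_set.gen_mem_adjoin[OF S(1), of b]
  have "finite_over A (adjoin S b)"
    using finite_over_trans[OF assms(1) S'(1,2) S(4) finite_over_adjoin[OF S(1) b]] .
  then show ?case using S S' by (intro exI[of _ "adjoin S b"]) auto
qed

text \<open>The relation of \<open>z\<close> has finitely many coefficients. They lie in a common
  module-finite extension of \<open>A\<close>, over which adjoining \<open>z\<close> is again
  module-finite.\<close>

lemma integral_over_trans:
  fixes z :: "'a::field"
  assumes "subring_set A" "\<And>b. b \<in> B \<Longrightarrow> integral_over A b" "integral_over B z"
  shows "integral_over A z"
proof -
  obtain p where p: "p \<in> polys_over B" "lead_coeff p = 1" "poly p z = 0"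
    using assms(3) by (auto simp: integral_over_def)
  let ?F = "coeff p ` {..degree p}"
  have "\<And>b. b \<in> ?F \<Longrightarrow> integral_over A b" using p(1) assms(2) by (auto simp: polys_over_def)
  then obtain S where S: "subring_set S" "A \<subseteq> S" "?F \<subseteq> S" "finite_over A S"
    using finite_over_finite_integral[OF assms(1), of ?F] by auto
  have "coeff p i \<in> S" for i
    using S(3) subring_set.zero_mem[OF S(1)] by (cases "i \<le> degree p") (auto simp: coeff_eq_0)
  then have z: "integral_over S z" unfolding integral_over_def using p by (auto simp: polys_over_def)
  note S' = subring_set.subring_set_adjoin[OF S(1), of z] subring_set.base_subset_adjoin[OF S(1), of z]
    subring_set.gen_mem_adjoin[OF S(1), of z]
  show ?thesis
    using finite_over_integral[OF assms(1) S'(1) finite_over_trans[OF assms(1) S'(1,2) S(4)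
      finite_over_adjoin[OF S(1) z]] S'(3)] .
qed

text \<open>Differences and products stay in a module-finite ring that contains both
  elements.\<close>

lemma subring_set_integral:
  fixes A :: "'a::field set"
  assumes "subring_set A"
  shows "subring_set {x. integral_over A x}"
proof
  show "1 \<in> {x. integral_over A x}"
    using subring_set.integral_over_mem[OF assms] subring_set.one_mem[OF assms] by auto
next
  fix x y assume xy: "x \<in> {x. integral_over A x}" "y \<in> {x. integral_over A x}"
  obtain S where S: "subring_set S" "{x, y} \<subseteq> S" "finite_over A S"
    using finite_over_finite_integral[OF assms, of "{x, y}"] xy by auto
  then interpret S: subring_set S by simp
  show "x - y \<in> {x. integral_over A x}" "x * y \<in> {x. integral_over A x}"
    using S finite_over_integral[OF assms S(1,3)] by (auto intro: S.mem_intros)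
qed

section \<open>Completely integrally closed domains\<close>

definition fracs :: "'a::field set \<Rightarrow> 'a set" where
  "fracs A = {a / b | a b. a \<in> A \<and> b \<in> A \<and> b \<noteq> 0}"

text \<open>A fraction is almost integral if all its powers share a denominator \<open>w\<close>.
  This notion replaces integral closedness because it passes to polynomial rings by comparing
  leading coefficients.\<close>

definition completely_integrally_closed :: "'a::field set \<Rightarrow> bool" where
  "completely_integrally_closed A \<longleftrightarrow>
     (\<forall>s\<in>fracs A. (\<exists>w\<in>A. w \<noteq> 0 \<and> (\<forall>k. w * s ^ k \<in> A)) \<longrightarrow> s \<in> A)"

definition transcendental_over :: "'a::comm_ring_1 set \<Rightarrow> 'a \<Rightarrow> bool" where
  "transcendental_over A y \<longleftrightarrow> (\<forall>p\<in>polys_over A. poly p y = 0 \<longrightarrow> p = 0)"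

lemma subset_fracs: "subring_set A \<Longrightarrow> A \<subseteq> fracs A"
  unfolding fracs_def using subring_set.one_mem by force

lemma inverse_mem_fracs: "subring_set A \<Longrightarrow> x \<in> fracs A \<Longrightarrow> inverse x \<in> fracs A"
  unfolding fracs_def
  by (cases "x = 0") (force intro: subring_set.one_mem subring_set.zero_mem)+

lemma subring_set_fracs:
  assumes "subring_set A"
  shows "subring_set (fracs A)"
proof
  interpret subring_set A by fact
  show "1 \<in> fracs A" using subset_fracs[OF assms] one_mem by blast
  fix x y assume "x \<in> fracs A" "y \<in> fracs A"
  then obtain a b c d where *: "a \<in> A" "b \<in> A" "b \<noteq> 0" "c \<in> A" "d \<in> A" "d \<noteq> 0" "x = a / b" "y = c / d"
    by (auto simp: fracs_def)
  have "x - y = (a * d - c * b) / (b * d)" "x * y = (a * c) / (b * d)"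
    using * by (auto simp: field_simps)
  moreover have "a * d - c * b \<in> A" "a * c \<in> A" "b * d \<in> A" "b * d \<noteq> 0"
    using * by (auto intro: mem_intros)
  ultimately show "x - y \<in> fracs A" "x * y \<in> fracs A"
    unfolding fracs_def by blast+
qed

lemma fracs_subset_field:
  assumes "subring_set K" "A \<subseteq> K" "\<And>x. x \<in> K \<Longrightarrow> inverse x \<in> K"
  shows "fracs A \<subseteq> K"
  using assms by (auto simp: fracs_def divide_inverse intro!: subring_set.mult_mem[OF assms(1)])

lemma common_denominator:
  assumes "subring_set A" "finite W" "W \<subseteq> fracs A"
  obtains d where "d \<in> A" "d \<noteq> 0" "\<And>w. w \<in> W \<Longrightarrow> d * w \<in> A"
proof -
  interpret subring_set A by fact
  from assms(2,3) have "\<exists>d\<in>A. d \<noteq> 0 \<and> (\<forall>w\<in>W. d * w \<in> A)"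
  proof (induction W)
    case empty
    then show ?case using one_mem by (intro bexI[of _ 1]) auto
  next
    case (insert w W)
    then obtain d a b where *: "d \<in> A" "d \<noteq> 0" "\<forall>w\<in>W. d * w \<in> A" "a \<in> A" "b \<in> A" "b \<noteq> 0" "w = a / b"
      by (auto simp: fracs_def)
    have "d * b * v \<in> A" if "v \<in> insert w W" for v
    proof (cases "v = w")
      case True
      then have eq: "d * b * v = d * a" using *(6,7) by simp
      show ?thesis unfolding eq by (rule mult_mem[OF *(1,4)])
    next
      case False
      then have "b * (d * v) \<in> A" using * that by (intro mult_mem[of b]) auto
      then show ?thesis by (simp add: mult_ac)
    qed
    then show ?case using * by (intro bexI[of _ "d * b"]) (auto intro: mult_mem)
  qed
  then show ?thesis using that by blast
qed

lemma poly_common_denominator: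
  assumes "subring_set A" "p \<in> polys_over (fracs A)"
  obtains d where "d \<in> A" "d \<noteq> 0" "smult d p \<in> polys_over A"
proof -
  interpret subring_set A by fact
  obtain d where d: "d \<in> A" "d \<noteq> 0" "\<And>w. w \<in> coeff p ` {..degree p} \<Longrightarrow> d * w \<in> A"
    using common_denominator[OF assms(1), of "coeff p ` {..degree p}"] assms(2)
    by (auto simp: polys_over_def)
  have "d * coeff p i \<in> A" for i
    using d(3) zero_mem by (cases "i \<le> degree p") (auto simp: coeff_eq_0)
  then show ?thesis using d that by (auto simp: polys_over_def)
qed

lemma transcendental_over_fracs:
  assumes "subring_set A" "transcendental_over A y"
  shows "transcendental_over (fracs A) y"
  unfolding transcendental_over_def
proof (intro ballI impI)
  fix p assume p: "p \<in> polys_over (fracs A)" "poly p y = 0"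
  obtain d where "d \<in> A" "d \<noteq> 0" "smult d p \<in> polys_over A"
    using poly_common_denominator[OF assms(1) p(1)] .
  then show "p = 0" using assms(2) p(2) by (force simp: transcendental_over_def)
qed

text \<open>\<open>A[x]\<close> is a finitely generated module of fractions; a common denominator of
  its generators clears all powers of \<open>x\<close> at once.\<close>

lemma completely_integrally_closedD:
  assumes "subring_set A" "completely_integrally_closed A" "x \<in> fracs A" "integral_over A x"
  shows "x \<in> A"
proof -
  interpret subring_set A by fact
  interpret F: subring_set "fracs A" by (rule subring_set_fracs) fact
  interpret S: subring_set "adjoin A x" by (rule subring_set_adjoin)
  obtain W where W: "finite W" "W \<subseteq> adjoin A x" "adjoin A x \<subseteq> span_over A W"
    using finite_over_adjoin[OF assms(1,4)] by (auto simp: finite_over_def)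
  have sub: "adjoin A x \<subseteq> fracs A" using assms subset_fracs by (intro adjoin_subset F.subring_set_axioms) auto
  obtain d where d: "d \<in> A" "d \<noteq> 0" "\<And>w. w \<in> W \<Longrightarrow> d * w \<in> A"
    using common_denominator[OF assms(1) W(1) subset_trans[OF W(2) sub]] by metis
  have "d * z \<in> A" if "z \<in> span_over A W" for z
    using that
  proof induction
    case (step a w z)
    have "d * (a * w + z) = a * (d * w) + d * z" by (simp add: algebra_simps)
    then show ?case using step d by (auto intro: mem_intros)
  qed (auto intro: zero_mem)
  moreover have "x ^ k \<in> span_over A W" for k using W(3) S.power_mem[OF gen_mem_adjoin] by blast
  ultimately have "\<forall>k. d * x ^ k \<in> A" by blast
  then show ?thesis using assms(2,3) d by (auto simp: completely_integrally_closed_def)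
qed

text \<open>The leading coefficient of \<open>w e^k\<close> is that of \<open>w\<close> times the
  \<open>k\<close>-th power of that of \<open>e\<close>, so the latter is almost integral and lies
  in \<open>A\<close>. The leading term is then split off and the degree drops.\<close>

lemma coeffs_almost_integral:
  assumes A: "subring_set A" and cic: "completely_integrally_closed A"
    and e: "e \<in> polys_over (fracs A)" and w: "w \<in> polys_over A" "w \<noteq> 0"
    and we: "\<And>k. w * e ^ k \<in> polys_over A"
  shows "e \<in> polys_over A"
  using e we
proof (induction "degree e" arbitrary: e rule: less_induct)
  case less
  interpret subring_set A by fact
  interpret P: subring_set "polys_over A" by (rule subring_set_polys_over)
  interpret F: subring_set "fracs A" by (rule subring_set_fracs) fact
  interpret PF: subring_set "polys_over (fracs A)" by (rule F.subring_set_polys_over)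
  have "lead_coeff w * lead_coeff e ^ k \<in> A" for k
    using polys_overD[OF less.prems(2)[of k], of "degree (w * e ^ k)"]
    by (simp add: lead_coeff_mult lead_coeff_power)
  moreover have "lead_coeff e \<in> fracs A" using less.prems(1) by (rule polys_overD)
  moreover have "lead_coeff w \<in> A" "lead_coeff w \<noteq> 0" using w by (auto intro: polys_overD)
  ultimately have "lead_coeff e \<in> A"
    using cic unfolding completely_integrally_closed_def by blast
  then have m: "monom (lead_coeff e) (degree e) \<in> polys_over A" (is "?m \<in> _") by (rule monom_mem_polys_over)
  show ?case
  proof (cases "e = ?m")
    case True
    then show ?thesis using m by simp
  next
    case False
    let ?e = "e - ?m"
    have "?e \<noteq> 0" using False by simp
    moreover have "coeff ?e (degree e) = 0" by simp
    moreover have "degree ?e \<le> degree e" by (intro degree_diff_le) (auto simp: degree_monom_le)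
    ultimately have deg: "degree ?e < degree e" by (metis leading_coeff_0_iff order_le_less)
    have "w * ?e ^ k \<in> polys_over A" for k
    proof -
      \<comment> \<open>The binomial expansion shows that \<open>w\<close> still clears all powers
        after the leading term \<open>?m\<close> has been removed.\<close>
      have "w * (- ?m + e) ^ k = (\<Sum>j\<le>k. of_nat (k choose j) * (- ?m) ^ j * (w * e ^ (k - j)))"
        unfolding binomial_ring sum_distrib_left by (rule sum.cong) (simp_all add: mult_ac)
      also have "of_nat n \<in> polys_over A" for n
        by (induction n) (auto intro: P.mem_intros)
      then have "(\<Sum>j\<le>k. of_nat (k choose j) * (- ?m) ^ j * (w * e ^ (k - j))) \<in> polys_over A"
        using less.prems(2) m
        by (intro P.sum_mem P.mult_mem[OF P.mult_mem[OF _ P.power_mem[OF P.uminus_mem]]]) auto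
      finally show ?thesis by simp
    qed
    moreover have "?e \<in> polys_over (fracs A)"
      using less.prems(1) m polys_over_mono[OF subset_fracs[OF A]] by (intro PF.diff_mem) auto
    ultimately have "?e \<in> polys_over A" using less.hyps[OF deg] by blast
    from P.add_mem[OF this m] show ?thesis by simp
  qed
qed

text \<open>Over the fraction field the polynomials \<open>g\<close> with \<open>g(y) s\<^sup>k\<close> polynomial for all \<open>k\<close> form an
  ideal of a principal ideal domain which is stable under multiplication by \<open>s\<close>.\<close>

lemma almost_integral_mem_adjoin_fracs:
  assumes A: "subring_set A" and y: "transcendental_over A y"
    and w: "w \<in> polys_over A" "w \<noteq> 0" "\<And>k. poly w y * s ^ k \<in> adjoin A y"
  shows "s \<in> adjoin (fracs A) y"
proof -
  interpret E: subring_set "fracs A" by (rule subring_set_fracs) fact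
  interpret PE: subring_set "polys_over (fracs A)" by (rule E.subring_set_polys_over)
  interpret S: subring_set "adjoin (fracs A) y" by (rule E.subring_set_adjoin)
  note AE = polys_over_mono[OF subset_fracs[OF A]]
  have sub: "adjoin A y \<subseteq> adjoin (fracs A) y" using AE by (auto simp: adjoin_def)
  define G where "G = {g \<in> polys_over (fracs A). g \<noteq> 0 \<and> (\<forall>k. poly g y * s ^ k \<in> adjoin (fracs A) y)}"
  have "w \<in> G" using w AE sub by (auto simp: G_def)
  then obtain g0 where g0: "g0 \<in> G" "\<And>g. g \<in> G \<Longrightarrow> degree g0 \<le> degree g"
    using ex_has_least_nat[of "\<lambda>g. g \<in> G" w degree] by blast
  define g where "g = smult (inverse (lead_coeff g0)) g0"
  have l0: "lead_coeff g0 \<noteq> 0" "inverse (lead_coeff g0) \<in> fracs A"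
    using g0(1) by (auto simp: G_def intro!: inverse_mem_fracs A polys_overD)
  have g: "g \<in> polys_over (fracs A)" "lead_coeff g = 1" "degree g = degree g0"
    using g0(1) l0 by (auto simp: g_def G_def intro: E.smult_mem_polys_over)
  have gk: "poly g y * s ^ k \<in> adjoin (fracs A) y" for k
  proof -
    have "inverse (lead_coeff g0) * (poly g0 y * s ^ k) \<in> adjoin (fracs A) y"
      using g0(1) l0(2) E.base_subset_adjoin by (intro S.mult_mem[of "inverse _"]) (auto simp: G_def)
    then show ?thesis by (simp add: g_def mult_ac)
  qed
  obtain h where h: "h \<in> polys_over (fracs A)" "poly g y * s = poly h y"
    using gk[of 1] by (auto simp: adjoin_def)
  obtain e r where er: "e \<in> polys_over (fracs A)" "r \<in> polys_over (fracs A)" "h = g * e + r"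
    "r = 0 \<or> degree r < degree g"
    using E.monic_division[OF h(1) g(1,2)] by blast
  have e: "poly e y \<in> adjoin (fracs A) y" using er by (auto simp: adjoin_def)
  have r: "poly r y = poly g y * s - poly g y * poly e y" using h(2) er(3) by simp
  \<comment> \<open>\<open>r(y) = g(y) (s - e(y))\<close>, and the extra factor \<open>s\<close> is
    absorbed by passing from \<open>k\<close> to \<open>Suc k\<close>. So the remainder lies in the
    ideal, has smaller degree than its generator, and must be 0.\<close>
  have "poly r y * s ^ k \<in> adjoin (fracs A) y" for k
  proof -
    have "poly r y * s ^ k = poly g y * s ^ Suc k - poly e y * (poly g y * s ^ k)"
      by (simp add: r algebra_simps)
    then show ?thesis using gk[of "Suc k"] gk[of k] e by (auto intro: S.mem_intros)
  qed
  then have "r \<noteq> 0 \<Longrightarrow> r \<in> G" using er(2) by (simp add: G_def)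
  then have "r = 0" using er(4) g0(2)[of r] g(3) by fastforce
  moreover have "poly g y \<noteq> 0"
    using transcendental_over_fracs[OF A y] g by (auto simp: transcendental_over_def)
  ultimately have "s = poly e y" using r by (simp flip: right_diff_distrib)
  then show ?thesis using e by simp
qed

text \<open>An almost integral \<open>s\<close> is first a polynomial in \<open>y\<close> over the
  fraction field. Transcendence of \<open>y\<close> turns equations between values at
  \<open>y\<close> into equations between polynomials, so its coefficients can then be
  compared.\<close>

lemma completely_integrally_closed_adjoin:
  assumes A: "subring_set A" and cic: "completely_integrally_closed A" and y: "transcendental_over A y"
  shows "completely_integrally_closed (adjoin A y)"
  unfolding completely_integrally_closed_def
proof (intro ballI impI)
  fix s assume "\<exists>w\<in>adjoin A y. w \<noteq> 0 \<and> (\<forall>k. w * s ^ k \<in> adjoin A y)"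
  then obtain w0 where w0: "w0 \<in> adjoin A y" "w0 \<noteq> 0" "\<And>k. w0 * s ^ k \<in> adjoin A y" by blast
  then obtain w where "w \<in> polys_over A" "w0 = poly w y" by (auto simp: adjoin_def)
  with w0 have w: "w \<in> polys_over A" "w \<noteq> 0" "\<And>k. poly w y * s ^ k \<in> adjoin A y" by auto
  interpret subring_set A by fact
  interpret E: subring_set "fracs A" by (rule subring_set_fracs) fact
  interpret PE: subring_set "polys_over (fracs A)" by (rule E.subring_set_polys_over)
  note AE = polys_over_mono[OF subset_fracs[OF A]]
  obtain e where e: "e \<in> polys_over (fracs A)" "s = poly e y"
    using almost_integral_mem_adjoin_fracs[OF A y w] by (auto simp: adjoin_def)
  have "w * e ^ k \<in> polys_over A" for k
  proof -
    obtain q where q: "q \<in> polys_over A" "poly w y * s ^ k = poly q y" using w(3) by (auto simp: adjoin_def)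
    have "w * e ^ k - q \<in> polys_over (fracs A)"
      using w e q AE by (intro PE.mem_intros) auto
    moreover have "poly (w * e ^ k - q) y = 0" using q(2) e(2) by (simp add: poly_power)
    ultimately have "w * e ^ k - q = 0"
      using transcendental_over_fracs[OF A y] unfolding transcendental_over_def by blast
    then show ?thesis using q by simp
  qed
  then have "e \<in> polys_over A" by (rule coeffs_almost_integral[OF A cic e(1) w(1,2)])
  then show "s \<in> adjoin A y" using e(2) by (auto simp: adjoin_def)
qed

section \<open>Minimal polynomials\<close>

lemma subring_set_image:
  assumes "subring_set A" "\<And>x y. f (x - y) = f x - f y" "\<And>x y. f (x * y) = f x * f y" "f 1 = 1"
  shows "subring_set (f ` A)"
proof
  interpret subring_set A by fact
  show "1 \<in> f ` A" using assms(4) one_mem by (metis imageI)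
  fix x y assume "x \<in> f ` A" "y \<in> f ` A"
  then obtain a b where ab: "a \<in> A" "b \<in> A" "x = f a" "y = f b" by auto
  then show "x - y \<in> f ` A" "x * y \<in> f ` A"
    using diff_mem[OF ab(1,2)] mult_mem[OF ab(1,2)] by (auto simp flip: assms(2,3))
qed

text \<open>The minimal polynomial over the fraction field divides a monic relation
  \<open>Q0\<close> over \<open>T\<close>, so its roots in an algebraic closure are integral. Its
  coefficients are built from these roots by ring operations; they are integral fractions and so lie
  in \<open>T\<close>.\<close>

lemma monic_minimal_polynomial:
  fixes T :: "'a::field set"
  assumes T: "subring_set T" and cic: "completely_integrally_closed T" and s: "integral_over T s"
  obtains P where "P \<in> polys_over T" "lead_coeff P = 1" "poly P s = 0"
    "\<And>Q. Q \<in> polys_over T \<Longrightarrow> Q \<noteq> 0 \<Longrightarrow> poly Q s = 0 \<Longrightarrow> degree P \<le> degree Q"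
proof -
  interpret E: subring_set "fracs T" by (rule subring_set_fracs) fact
  interpret ac: field_hom "to_ac :: 'a \<Rightarrow> 'a alg_closure" by unfold_locales auto
  interpret acp: map_poly_comm_ring_hom "to_ac :: 'a \<Rightarrow> 'a alg_closure" ..
  note TE = polys_over_mono[OF subset_fracs[OF T]]
  obtain Q0 where Q0: "Q0 \<in> polys_over T" "lead_coeff Q0 = 1" "poly Q0 s = 0"
    using s by (auto simp: integral_over_def)
  define G where "G = {Q \<in> polys_over (fracs T). Q \<noteq> 0 \<and> poly Q s = 0}"
  have "Q0 \<in> G" using Q0 TE by (auto simp: G_def)
  then obtain P0 where P0: "P0 \<in> G" "\<And>g. g \<in> G \<Longrightarrow> degree P0 \<le> degree g"
    using ex_has_least_nat[of "\<lambda>g. g \<in> G" Q0 degree] by blast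
  define P where "P = smult (inverse (lead_coeff P0)) P0"
  have l0: "lead_coeff P0 \<noteq> 0" "inverse (lead_coeff P0) \<in> fracs T"
    using P0(1) by (auto simp: G_def intro!: inverse_mem_fracs T polys_overD)
  have P: "P \<in> polys_over (fracs T)" "lead_coeff P = 1" "degree P = degree P0" "poly P s = 0"
    using P0(1) l0 by (auto simp: P_def G_def intro: E.smult_mem_polys_over)
  obtain D r where Dr: "r \<in> polys_over (fracs T)" "Q0 = P * D + r" "r = 0 \<or> degree r < degree P"
    using E.monic_division[OF subsetD[OF TE Q0(1)] P(1,2)] by metis
  have "poly r s = 0" using Dr(2) Q0(3) P(4) by simp
  then have "r \<noteq> 0 \<Longrightarrow> r \<in> G" using Dr(1) by (simp add: G_def)
  then have "r = 0" using Dr(3) P0(2)[of r] P(3) by fastforce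
  then have Q0P: "Q0 = P * D" using Dr(2) by simp
  let ?T = "to_ac ` T"
  have T': "subring_set ?T" by (rule subring_set_image[OF T]) auto
  interpret O: subring_set "{x. integral_over ?T x}" by (rule subring_set_integral[OF T'])
  interpret PO: subring_set "polys_over {x. integral_over ?T x}" by (rule O.subring_set_polys_over)
  let ?P = "map_poly to_ac P" and ?Q0 = "map_poly to_ac Q0"
  have "?P \<noteq> 0" "lead_coeff ?P = 1" using P(2) by auto
  then obtain R where R: "?P = (\<Prod>x\<in>#R. [:-x, 1:])"
    using alg_closed_imp_factorization[of ?P] by auto
  have root: "integral_over ?T x" if "x \<in># R" for x
  proof -
    have "poly ?P x = 0" unfolding R using that by (auto simp: poly_prod_mset prod_mset_zero_iff)
    then have "poly ?Q0 x = 0" by (simp add: Q0P hom_distribs)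
    moreover have "?Q0 \<in> polys_over ?T" using Q0(1) by (auto simp: polys_over_def)
    ultimately show ?thesis using Q0(2) unfolding integral_over_def by (intro bexI[of _ ?Q0]) auto
  qed
  have "(\<Prod>x\<in>#R'. [:-x, 1:]) \<in> polys_over {x. integral_over ?T x}" if "R' \<subseteq># R" for R'
    using that
  proof (induction R')
    case (add x R')
    have "x \<in># R" using add.prems by (meson mset_subset_eqD union_single_eq_member)
    then have "[:-x, 1:] \<in> polys_over {x. integral_over ?T x}"
      by (intro O.pCons_mem_polys_over O.const_mem_polys_over O.one_mem O.uminus_mem) (simp add: root)
    moreover have "R' \<subseteq># R" using add.prems by (meson mset_subset_eq_insertD subset_mset.less_imp_le)
    ultimately show ?case
      unfolding image_mset_add_mset prod_mset.add_mset using add.IH by (intro PO.mult_mem)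
  qed (use PO.one_mem in auto)
  then have "?P \<in> polys_over {x. integral_over ?T x}" unfolding R by simp
  then have int: "integral_over ?T (to_ac (coeff P i))" for i
    using polys_overD[of ?P "{x. integral_over ?T x}" i] by simp
  have "coeff P i \<in> T" for i
  proof -
    obtain q where q: "q \<in> polys_over ?T" "lead_coeff q = 1" "poly q (to_ac (coeff P i)) = 0"
      using int[of i] by (auto simp: integral_over_def)
    \<comment> \<open>All coefficients of \<open>q\<close> lie in the image of \<open>T\<close>,
      where \<open>of_ac\<close> inverts \<open>to_ac\<close>; this pulls the relation back from the
      algebraic closure.\<close>
    define q' where "q' = map_poly of_ac q"
    have c: "coeff q j = to_ac (coeff q' j)" "coeff q' j \<in> T" for j
      using polys_overD[OF q(1), of j] by (auto simp: q'_def coeff_map_poly)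
    have qq': "q = map_poly to_ac q'" by (rule poly_eqI) (simp add: c)
    have "to_ac (lead_coeff q') = to_ac 1" using q(2) unfolding qq' by simp
    then have "lead_coeff q' = 1" unfolding to_ac_eq_iff .
    moreover have "poly q' (coeff P i) = 0" using q(3) unfolding qq' by simp
    ultimately have "integral_over T (coeff P i)"
      unfolding integral_over_def using c by (intro bexI[of _ q']) (auto simp: polys_over_def)
    then show ?thesis
      by (rule completely_integrally_closedD[OF T cic polys_overD[OF P(1)]])
  qed
  then have "P \<in> polys_over T" by (simp add: polys_over_def)
  moreover have "degree P \<le> degree Q" if "Q \<in> polys_over T" "Q \<noteq> 0" "poly Q s = 0" for Q
    using P0(2)[of Q] P(3) that subsetD[OF TE that(1)] by (simp add: G_def)
  ultimately show ?thesis by (rule that[OF _ P(2,4)])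
qed

section \<open>Complex points and places\<close>

locale complex_algebra =
  fixes \<kappa> :: "complex \<Rightarrow> 'a::comm_ring_1"
  assumes const_add: "\<kappa> (a + b) = \<kappa> a + \<kappa> b"
    and const_mult: "\<kappa> (a * b) = \<kappa> a * \<kappa> b"
    and const_1: "\<kappa> 1 = 1"
begin

lemma const_0: "\<kappa> 0 = 0"
  using const_add[of 0 0] by (metis add.right_neutral add_cancel_left_right)

lemma const_uminus: "\<kappa> (- a) = - \<kappa> a"
  using const_add[of a "- a"] by (simp add: const_0 eq_neg_iff_add_eq_0 add.commute)

lemma const_diff: "\<kappa> (a - b) = \<kappa> a - \<kappa> b"
  using const_add[of a "- b"] by (simp add: const_uminus)

end

text \<open>A point is a \<complex>-algebra homomorphism from \<open>A\<close> to \<complex>. As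
  \<open>h\<close> is a total function, its values outside \<open>A\<close> carry no
  meaning.\<close>

locale complex_point = complex_algebra \<kappa> + subring_set A
  for \<kappa> :: "complex \<Rightarrow> 'a::field" and A :: "'a set" +
  fixes h :: "'a \<Rightarrow> complex"
  assumes const_mem: "\<kappa> c \<in> A"
    and pt_const: "h (\<kappa> c) = c"
    and pt_diff: "x \<in> A \<Longrightarrow> y \<in> A \<Longrightarrow> h (x - y) = h x - h y"
    and pt_mult: "x \<in> A \<Longrightarrow> y \<in> A \<Longrightarrow> h (x * y) = h x * h y"
begin

lemma pt_0: "h 0 = 0"
  using pt_const[of 0] by (simp add: const_0)

lemma pt_1: "h 1 = 1"
  using pt_const[of 1] by (simp add: const_1)

lemma pt_uminus: "x \<in> A \<Longrightarrow> h (- x) = - h x"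
  using pt_diff[OF zero_mem] by (simp add: pt_0)

lemma pt_add: "x \<in> A \<Longrightarrow> y \<in> A \<Longrightarrow> h (x + y) = h x + h y"
  using pt_diff[of x "- y"] by (simp add: pt_uminus uminus_mem)

lemma pt_sum: "(\<And>i. i \<in> I \<Longrightarrow> f i \<in> A) \<Longrightarrow> h (sum f I) = (\<Sum>i\<in>I. h (f i))"
  by (induction I rule: infinite_finite_induct) (auto simp: pt_0 pt_add sum_mem)

lemma pt_prod: "(\<And>i. i \<in> I \<Longrightarrow> f i \<in> A) \<Longrightarrow> h (prod f I) = (\<Prod>i\<in>I. h (f i))"
  by (induction I rule: infinite_finite_induct) (auto simp: pt_1 pt_mult prod_mem)

lemma pt_power: "x \<in> A \<Longrightarrow> h (x ^ n) = h x ^ n"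
  by (induction n) (auto simp: pt_1 pt_mult power_mem)

lemma pt_inverse:
  assumes "x \<in> A" "inverse x \<in> A" "x \<noteq> 0"
  shows "h x \<noteq> 0" "h (inverse x) = inverse (h x)"
proof -
  have "h x * h (inverse x) = 1" using pt_mult[OF assms(1,2)] assms(3) by (simp add: pt_1)
  then show "h x \<noteq> 0" "h (inverse x) = inverse (h x)" by (auto simp: inverse_unique)
qed

abbreviation reduct :: "'a poly \<Rightarrow> complex poly" where "reduct \<equiv> map_poly h"

lemma coeff_reduct: "coeff (reduct p) i = h (coeff p i)"
  by (simp add: coeff_map_poly pt_0)

text \<open>Reduction may lower the degree, so the sum runs up to an arbitrary bound for the
  original degree.\<close>

lemma poly_reduct:
  assumes "degree p \<le> n"
  shows "poly (reduct p) z = (\<Sum>i\<le>n. h (coeff p i) * z ^ i)"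
proof -
  have "degree (reduct p) \<le> n" using degree_map_poly_le[of h p] assms by (rule order_trans)
  then have "poly (reduct p) z = (\<Sum>i\<le>n. coeff (reduct p) i * z ^ i)"
    by (rule poly_as_sum_of_monoms'[of "reduct p" n, symmetric, THEN arg_cong[where f = "\<lambda>q. poly q z"], unfolded poly_sum poly_monom])
  then show ?thesis by (simp add: coeff_reduct)
qed

lemma pt_poly: "p \<in> polys_over A \<Longrightarrow> x \<in> A \<Longrightarrow> h (poly p x) = poly (reduct p) (h x)"
  unfolding poly_reduct[OF order_refl]
  by (simp add: poly_altdef pt_sum pt_mult pt_power power_mem mult_mem polys_overD)

lemma reduct_diff: "p \<in> polys_over A \<Longrightarrow> q \<in> polys_over A \<Longrightarrow> reduct (p - q) = reduct p - reduct q"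
  by (rule poly_eqI) (simp add: coeff_reduct pt_diff polys_overD)

lemma reduct_mult: "p \<in> polys_over A \<Longrightarrow> q \<in> polys_over A \<Longrightarrow> reduct (p * q) = reduct p * reduct q"
  by (rule poly_eqI) (simp add: coeff_reduct coeff_mult pt_sum pt_mult mult_mem polys_overD)

lemma lift_poly: "map_poly \<kappa> q \<in> polys_over A" "reduct (map_poly \<kappa> q) = q"
proof -
  show "map_poly \<kappa> q \<in> polys_over A" by (simp add: polys_over_def coeff_map_poly const_0 const_mem)
  show "reduct (map_poly \<kappa> q) = q" by (rule poly_eqI) (simp add: coeff_reduct coeff_map_poly const_0 pt_const)
qed

text \<open>\<open>A[x]\<close> is \<open>A[X]\<close> modulo the relations of \<open>x\<close>;
  evaluation at \<open>\<rho>\<close> descends to it exactly because \<open>\<rho>\<close> kills the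
  reduction of every relation.\<close>

lemma extend_adjoin:
  assumes root: "\<And>p. p \<in> polys_over A \<Longrightarrow> poly p x = 0 \<Longrightarrow> poly (reduct p) \<rho> = 0"
  obtains h' where "complex_point \<kappa> (adjoin A x) h'" "\<And>a. a \<in> A \<Longrightarrow> h' a = h a" "h' x = \<rho>"
proof -
  interpret P: subring_set "polys_over A" by (rule subring_set_polys_over)
  interpret S: subring_set "adjoin A x" by (rule subring_set_adjoin)
  define h' where "h' z = poly (reduct (SOME p. p \<in> polys_over A \<and> poly p x = z)) \<rho>" for z
  have h': "h' (poly p x) = poly (reduct p) \<rho>" if p: "p \<in> polys_over A" for p
  proof -
    define q where "q = (SOME q. q \<in> polys_over A \<and> poly q x = poly p x)"
    have "q \<in> polys_over A \<and> poly q x = poly p x" unfolding q_def by (rule someI[of _ p]) (simp add: p)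
    then have "poly (reduct (q - p)) \<rho> = 0" "q \<in> polys_over A" using p by (auto intro!: root P.diff_mem)
    then show ?thesis using p by (simp add: h'_def reduct_diff flip: q_def)
  qed
  have ext: "h' a = h a" if "a \<in> A" for a
    using h'[OF const_mem_polys_over[OF that]] by (simp add: poly_reduct[of _ 0])
  have "complex_point \<kappa> (adjoin A x) h'"
  proof unfold_locales
    show "\<kappa> c \<in> adjoin A x" for c using base_subset_adjoin const_mem by blast
    show "h' (\<kappa> c) = c" for c by (simp add: ext const_mem pt_const)
    fix y z assume "y \<in> adjoin A x" "z \<in> adjoin A x"
    then obtain p q where pq: "p \<in> polys_over A" "q \<in> polys_over A" "y = poly p x" "z = poly q x"
      by (auto simp: adjoin_def)
    show "h' (y - z) = h' y - h' z"
      using h'[OF P.diff_mem[OF pq(1,2)]] pq by (simp add: h' reduct_diff)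
    show "h' (y * z) = h' y * h' z"
      using h'[OF P.mult_mem[OF pq(1,2)]] pq by (simp add: h' reduct_mult)
  qed
  moreover have "h' x = \<rho>"
    using h'[OF pCons_mem_polys_over[OF zero_mem const_mem_polys_over[OF one_mem]]]
    by (simp add: poly_reduct[of _ 1] pt_0 pt_1)
  ultimately show ?thesis using that ext by blast
qed

text \<open>A relation of \<open>inverse a\<close>, multiplied by a power of \<open>a\<close>,
  becomes an identity inside \<open>A\<close> to which \<open>h\<close> applies. Hence inverting an
  element of nonzero value is never an obstruction to extending a point.\<close>

lemma inverse_root:
  assumes "a \<in> A" "h a \<noteq> 0" "p \<in> polys_over A" "poly p (inverse a) = 0"
  shows "poly (reduct p) (inverse (h a)) = 0"
proof -
  have a: "a \<noteq> 0" using assms(2) by (auto simp: pt_0)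
  have pw: "x ^ degree p * inverse x ^ i = x ^ (degree p - i)" if "i \<le> degree p" "x \<noteq> 0" for x :: "'b::field" and i
    using that by (simp add: power_diff divide_inverse power_inverse)
  have "0 = a ^ degree p * poly p (inverse a)" using assms by simp
  also have "\<dots> = (\<Sum>i\<le>degree p. coeff p i * a ^ (degree p - i))"
    unfolding poly_altdef sum_distrib_left
    by (rule sum.cong) (auto simp: pw[OF _ a, symmetric] mult_ac)
  finally have "h 0 = h (\<Sum>i\<le>degree p. coeff p i * a ^ (degree p - i))" by simp
  also have "\<dots> = (\<Sum>i\<le>degree p. h (coeff p i) * h a ^ (degree p - i))"
    using assms by (simp add: pt_sum pt_mult pt_power power_mem mult_mem polys_overD)
  also have "\<dots> = h a ^ degree p * poly (reduct p) (inverse (h a))"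
    unfolding poly_reduct[OF order_refl] sum_distrib_left
    by (rule sum.cong) (auto simp: pw[OF _ assms(2), symmetric] mult_ac)
  finally show ?thesis using assms(2) by (simp add: pt_0)
qed

text \<open>The reductions of the relations of \<open>x\<close> form an ideal of the principal ideal domain \<open>\<complex>[X]\<close>.\<close>

lemma common_root_or_unit_relation:
  shows "(\<exists>\<rho>. \<forall>p\<in>polys_over A. poly p x = 0 \<longrightarrow> poly (reduct p) \<rho> = 0) \<or>
    (\<exists>p\<in>polys_over A. poly p x = 0 \<and> reduct p \<noteq> 0 \<and> degree (reduct p) = 0)"
proof (rule disjCI)
  assume no_unit: "\<not> (\<exists>p\<in>polys_over A. poly p x = 0 \<and> reduct p \<noteq> 0 \<and> degree (reduct p) = 0)"
  interpret P: subring_set "polys_over A" by (rule subring_set_polys_over)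
  define G where "G = {p \<in> polys_over A. poly p x = 0}"
  show "\<exists>\<rho>. \<forall>p\<in>polys_over A. poly p x = 0 \<longrightarrow> poly (reduct p) \<rho> = 0"
  proof (cases "\<exists>p\<in>G. reduct p \<noteq> 0")
    case False
    then show ?thesis by (auto simp: G_def)
  next
    case True
    then obtain p where "p \<in> G \<and> reduct p \<noteq> 0" by blast
    then obtain g where g: "g \<in> G" "reduct g \<noteq> 0" "\<And>q. q \<in> G \<Longrightarrow> reduct q \<noteq> 0 \<Longrightarrow> degree (reduct g) \<le> degree (reduct q)"
      using ex_has_least_nat[of "\<lambda>g. g \<in> G \<and> reduct g \<noteq> 0" p "\<lambda>g. degree (reduct g)"] by blast
    have "degree (reduct g) > 0" using no_unit g by (auto simp: G_def)
    then obtain \<rho> where \<rho>: "poly (reduct g) \<rho> = 0" using alg_closed_imp_poly_has_root by blast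
    have "poly (reduct q) \<rho> = 0" if q: "q \<in> G" for q
    proof -
      \<comment> \<open>The quotient in \<open>\<complex>[X]\<close> is lifted with constant
        coefficients, so the remainder is the reduction of a relation of \<open>x\<close> and
        vanishes by minimality.\<close>
      let ?d = "map_poly \<kappa> (reduct q div reduct g)"
      have "q - g * ?d \<in> G" using q g lift_poly(1) by (auto simp: G_def intro: P.mem_intros)
      moreover have r: "reduct (q - g * ?d) = reduct q mod reduct g"
        using q g lift_poly by (simp add: G_def reduct_diff reduct_mult P.mult_mem minus_mult_div_eq_mod)
      ultimately have "reduct q mod reduct g = 0"
        using g degree_mod_less[of "reduct g" "reduct q"] by fastforce
      then show ?thesis using \<rho> by (metis dvd_eq_mod_eq_0 dvd_trans poly_eq_0_iff_dvd)
    qed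
    then show ?thesis by (auto simp: G_def)
  qed
qed

text \<open>The classical exchange argument for valuation rings, with a unit relation of minimal degree.\<close>

lemma const_coeff_of_inverse_relation:
  assumes local: "\<And>a. a \<in> A \<Longrightarrow> h a \<noteq> 0 \<Longrightarrow> inverse a \<in> A" and x: "x \<noteq> 0"
    and unit: "\<exists>p\<in>polys_over A. poly p x = 0 \<and> reduct p \<noteq> 0 \<and> degree (reduct p) = 0"
    and r: "r \<in> polys_over A" "poly r (inverse x) = 0"
  shows "h (coeff r 0) = 0"
proof (rule ccontr)
  assume r0: "h (coeff r 0) \<noteq> 0"
  interpret P: subring_set "polys_over A" by (rule subring_set_polys_over)
  define G where "G = {p \<in> polys_over A. poly p x = 0 \<and> reduct p \<noteq> 0 \<and> degree (reduct p) = 0}"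
  obtain p0 where "p0 \<in> G" using unit by (auto simp: G_def)
  then obtain p where p: "p \<in> G" "\<And>q. q \<in> G \<Longrightarrow> degree p \<le> degree q"
    using ex_has_least_nat[of "\<lambda>g. g \<in> G" p0 degree] by blast
  have GI: "q \<in> G" if "q \<in> polys_over A" "poly q x = 0" "h (coeff q 0) \<noteq> 0" "\<And>i. i > 0 \<Longrightarrow> h (coeff q i) = 0" for q
  proof -
    have "reduct q = [:h (coeff q 0):]"
      by (rule poly_eqI) (use that(4) in \<open>auto simp: coeff_reduct coeff_pCons split: nat.split\<close>)
    then show ?thesis using that by (simp add: G_def)
  qed
  have p': "p \<in> polys_over A" "poly p x = 0" "h (coeff p 0) \<noteq> 0" "h (coeff p i) = 0" if "i > 0" for i
    using p(1) that unfolding G_def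
    by (auto simp flip: coeff_reduct simp: coeff_eq_0) (metis leading_coeff_0_iff coeff_reduct)
  then have pA: "p \<in> polys_over A" "poly p x = 0" "h (coeff p 0) \<noteq> 0" by (blast intro: zero_less_one)+
  define n where "n = degree p"
  have p0: "p \<noteq> 0" using pA(3) by (auto simp: pt_0)
  have n: "n > 0"
  proof (rule ccontr)
    assume "\<not> n > 0"
    then have "degree p = 0" unfolding n_def by simp
    then obtain c where "p = [:c:]" by (rule degree_eq_zeroE)
    then show False using pA(2) p0 by simp
  qed
  have c0: "coeff p 0 \<noteq> 0" using pA(3) by (auto simp: pt_0)
  \<comment> \<open>Reversed and divided by its unit constant coefficient, the minimal unit relation
    becomes a monic relation of \<open>inverse x\<close> whose lower coefficients all reduce to
    0.\<close>
  define M where "M = smult (inverse (coeff p 0)) (reflect_poly p)"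
  have inv0: "inverse (coeff p 0) \<in> A" using local pA by (auto simp: polys_over_def)
  have M: "M \<in> polys_over A" "lead_coeff M = 1" "poly M (inverse x) = 0" "degree M = n"
    "\<And>i. i < n \<Longrightarrow> h (coeff M i) = 0"
  proof -
    have "reflect_poly p \<in> polys_over A"
      using pA(1) zero_mem by (auto simp: polys_over_def coeff_reflect_poly)
    then show "M \<in> polys_over A" unfolding M_def using inv0 by (rule smult_mem_polys_over[rotated])
    show deg: "degree M = n" using c0 by (simp add: M_def n_def)
    show "lead_coeff M = 1" using c0 unfolding deg by (simp add: M_def coeff_reflect_poly n_def)
    show "poly M (inverse x) = 0"
      using x pA(2) by (simp add: M_def poly_reflect_poly_nz)
    show "h (coeff M i) = 0" if "i < n" for i
      using that inv0 pA(1) p'(4)[of "n - i"]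
      by (simp add: M_def coeff_reflect_poly pt_mult polys_overD flip: n_def)
  qed
  \<comment> \<open>The remainder is a relation of \<open>inverse x\<close> of degree below
    \<open>n\<close>. Its constant coefficient remains a unit, since that of \<open>M\<close>
    reduces to 0.\<close>
  obtain d r' where r': "d \<in> polys_over A" "r' \<in> polys_over A" "r = M * d + r'" "r' = 0 \<or> degree r' < degree M"
    using monic_division[OF r(1) M(1,2)] .
  have "poly r' (inverse x) = 0" using r(2) r'(3) M(3) by simp
  have r'0: "h (coeff r' 0) \<noteq> 0"
  proof -
    have "h (coeff r 0) = h (coeff M 0) * h (coeff d 0) + h (coeff r' 0)"
      using r' M(1) by (simp add: coeff_mult_0 pt_add pt_mult polys_overD mult_mem)
    then show ?thesis using r0 M(5)[OF n] by simp
  qed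
  then have r'nz: "coeff r' 0 \<noteq> 0" "r' \<noteq> 0" by (auto simp: pt_0)
  \<comment> \<open>The reversed remainder, shifted so that the unit \<open>coeff r' 0\<close>
    becomes the coefficient of \<open>X^n\<close> in a relation of \<open>x\<close>.\<close>
  define R where "R = monom 1 (n - degree r') * reflect_poly r'"
  have dr': "degree r' < n" using r'(4) r'nz M(4) by simp
  have R: "R \<in> polys_over A" "poly R x = 0" "coeff R n = coeff r' 0" "degree R \<le> n" "coeff R 0 = 0"
  proof -
    have "reflect_poly r' \<in> polys_over A"
      using r'(2) zero_mem by (auto simp: polys_over_def coeff_reflect_poly)
    then show "R \<in> polys_over A" by (auto simp: R_def intro: P.mult_mem monom_mem_polys_over one_mem)
    show "poly R x = 0"
      using x \<open>poly r' (inverse x) = 0\<close> by (simp add: R_def poly_reflect_poly_nz)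
    show "coeff R n = coeff r' 0" using dr' by (simp add: R_def coeff_monom_mult coeff_reflect_poly)
    have "degree R \<le> (n - degree r') + degree r'"
      unfolding R_def using degree_mult_le[of "monom 1 (n - degree r')" "reflect_poly r'"]
        degree_reflect_poly_le[of r'] degree_monom_le[of "1::'a" "n - degree r'"] by linarith
    then show "degree R \<le> n" using dr' by simp
    show "coeff R 0 = 0" using dr' by (simp add: R_def coeff_monom_mult)
  qed
  \<comment> \<open>Chosen to cancel the term of degree \<open>n\<close> in \<open>p\<close>. As
    \<open>n > 0\<close>, \<open>c\<close> reduces to 0, so subtracting \<open>c R\<close> leaves
    the reduction of \<open>p\<close> unchanged and contradicts the minimality of
    \<open>n\<close>.\<close>
  define c where "c = coeff p n * inverse (coeff r' 0)"
  have c: "c \<in> A" "h c = 0"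
    using pA(1) r' local[OF _ r'0] p'(4)[OF n] by (auto simp: c_def polys_overD pt_mult intro: mult_mem)
  define q where "q = p - smult c R"
  have cR: "smult c R \<in> polys_over A" using c R by (simp add: smult_mem_polys_over)
  have qc: "h (coeff q i) = h (coeff p i)" for i
    using c R(1) pA(1) by (simp add: q_def pt_diff pt_mult polys_overD mult_mem)
  have "q \<in> G"
    by (rule GI) (use pA cR R p' in \<open>auto simp: qc q_def[THEN arg_cong[where f = "\<lambda>q. poly q x"]] q_def[THEN arg_cong[where f = "\<lambda>q. q \<in> _"]] intro: P.diff_mem\<close>)
  then have "n \<le> degree q" using p(2) n_def by blast
  moreover have "degree q \<le> n"
    unfolding q_def by (intro degree_diff_le) (use R n_def degree_smult_le[of c R] in auto)
  moreover have "coeff q n = 0" using R(3) r'nz by (simp add: q_def c_def)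
  moreover have "q \<noteq> 0" using \<open>q \<in> G\<close> by (auto simp: G_def)
  ultimately show False by (metis leading_coeff_0_iff le_antisym)
qed

end

text \<open>A valuation ring with residue field \<complex>, given together with its residue map; an
  element outside \<open>V\<close> has a pole, its inverse having value 0.\<close>

locale complex_place = complex_point \<kappa> V \<psi>
  for \<kappa> :: "complex \<Rightarrow> 'a::field" and V :: "'a set" and \<psi> :: "'a \<Rightarrow> complex" +
  assumes valuation: "x \<noteq> 0 \<Longrightarrow> x \<in> V \<or> inverse x \<in> V \<and> \<psi> (inverse x) = 0"
begin

lemma inverse_mem: "x \<in> V \<Longrightarrow> \<psi> x \<noteq> 0 \<Longrightarrow> inverse x \<in> V"
  using valuation[of "inverse x"] by (cases "x = 0") (auto simp: pt_0)

text \<open>If \<open>x\<close> had a pole, the reversed monic relation would hold for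
  \<open>inverse x\<close>; evaluated at value 0 it reads \<open>1 = 0\<close>.\<close>

lemma integral_mem:
  assumes "integral_over V x"
  shows "x \<in> V"
proof (rule ccontr)
  assume "x \<notin> V"
  then have x: "x \<noteq> 0" "inverse x \<in> V" "\<psi> (inverse x) = 0" using valuation[of x] zero_mem by auto
  obtain p where p: "p \<in> polys_over V" "lead_coeff p = 1" "poly p x = 0"
    using assms by (auto simp: integral_over_def)
  have r: "reflect_poly p \<in> polys_over V"
    using p(1) zero_mem by (auto simp: polys_over_def coeff_reflect_poly)
  have "poly (reflect_poly p) (inverse x) = 0"
    using x p(3) by (simp add: poly_reflect_poly_nz)
  then have "poly (reduct (reflect_poly p)) 0 = 0" using pt_poly[OF r x(2)] x(3) by (simp add: pt_0)
  then show False using p(2) by (simp add: poly_0_coeff_0 coeff_reduct pt_1)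
qed

end

section \<open>Existence of a place above every point\<close>

context complex_point
begin

text \<open>Zorn's lemma is applied to the graphs \<open>gr B g\<close>, since functions matter only
  on their rings and inclusion of graphs is extension of points. A maximal point has a local ring,
  and for each \<open>x\<close> the point extends to \<open>x\<close> or to
  \<open>inverse x\<close>.\<close>

lemma extend_to_place:
  obtains V \<psi> where "complex_place \<kappa> V \<psi>" "A \<subseteq> V" "\<And>a. a \<in> A \<Longrightarrow> \<psi> a = h a"
proof -
  define gr where "gr B g = (\<lambda>x. (x, g x)) ` B" for B and g :: "'a \<Rightarrow> complex"
  have gr_mono: "B \<subseteq> C \<and> (\<forall>x\<in>B. g x = k x)" if "gr B g \<subseteq> gr C k" for B C g k
    using that by (auto simp: gr_def image_iff subset_iff)
  define Ext where "Ext = {gr B g | B g. complex_point \<kappa> B g \<and> gr A h \<subseteq> gr B g}"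
  have "\<exists>M\<in>Ext. \<forall>Y\<in>Ext. M \<subseteq> Y \<longrightarrow> Y = M"
  proof (rule subset_Zorn_nonempty)
    show "Ext \<noteq> {}" using complex_point_axioms by (auto simp: Ext_def)
  next
    fix C assume C: "C \<noteq> {}" "subset.chain Ext C"
    define B where "B = fst ` \<Union>C"
    define g where "g x = (THE c. (x, c) \<in> \<Union>C)" for x
    have pair: "\<exists>B' g'. complex_point \<kappa> B' g' \<and> gr A h \<subseteq> gr B' g' \<and> gr B' g' \<in> C \<and> p \<in> gr B' g' \<and> q \<in> gr B' g'"
      if pq: "p \<in> \<Union>C" "q \<in> \<Union>C" for p q
    proof -
      obtain P Q where "P \<in> C" "Q \<in> C" "p \<in> P" "q \<in> Q" using pq by blast
      moreover have "P \<subseteq> Q \<or> Q \<subseteq> P" using C(2) \<open>P \<in> C\<close> \<open>Q \<in> C\<close> by (auto simp: subset.chain_def subset_chain_def)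
      ultimately obtain Z where "Z \<in> C" "p \<in> Z" "q \<in> Z" by blast
      moreover have "Z \<in> Ext" using C(2) \<open>Z \<in> C\<close> by (auto simp: subset_chain_def)
      ultimately show ?thesis by (auto simp: Ext_def)
    qed
    have g: "(x, c) \<in> \<Union>C \<longleftrightarrow> x \<in> B \<and> c = g x" for x c
    proof -
      have uniq: "c' = c" if "(x, c) \<in> \<Union>C" "(x, c') \<in> \<Union>C" for c c'
        using pair[OF that] by (auto simp: gr_def)
      then have "g x = c" if "(x, c) \<in> \<Union>C" for c
        unfolding g_def using that by (intro the_equality) blast+
      then show ?thesis unfolding B_def by force
    qed
    have U: "\<Union>C = gr B g"
    proof (rule Set.set_eqI)
      fix p
      show "p \<in> \<Union>C \<longleftrightarrow> p \<in> gr B g"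
        using g[of "fst p" "snd p"] by (cases p) (auto simp: gr_def simp del: Union_iff)
    qed
    have pr: "\<exists>B' g'. complex_point \<kappa> B' g' \<and> gr A h \<subseteq> gr B' g' \<and> B' \<subseteq> B \<and> (\<forall>z\<in>B'. g z = g' z) \<and> x \<in> B' \<and> y \<in> B'"
      if xy: "x \<in> B" "y \<in> B" for x y
    proof -
      obtain B' g' where *: "complex_point \<kappa> B' g'" "gr A h \<subseteq> gr B' g'" "gr B' g' \<in> C" "(x, g x) \<in> gr B' g'" "(y, g y) \<in> gr B' g'"
        using pair[of "(x, g x)" "(y, g y)"] xy g[of x "g x"] g[of y "g y"] by auto
      have "gr B' g' \<subseteq> gr B g" using *(3) U by blast
      then have "B' \<subseteq> B \<and> (\<forall>z\<in>B'. g z = g' z)" using gr_mono[of B' g' B g] by auto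
      then show ?thesis using * by (auto simp: gr_def)
    qed
    obtain Z where Z0: "Z \<in> C" using C(1) by blast
    then have "Z \<in> Ext" using C(2) by (auto simp: subset_chain_def)
    then obtain B0 g0 where Z: "complex_point \<kappa> B0 g0" "gr A h \<subseteq> gr B0 g0" "gr B0 g0 \<in> C"
      using Z0 unfolding Ext_def by blast
    have "gr B0 g0 \<subseteq> gr B g" using Z(3) U by blast
    then have AB: "gr A h \<subseteq> gr B g" using Z(2) by blast
    then have AB': "A \<subseteq> B" "\<And>a. a \<in> A \<Longrightarrow> g a = h a" using gr_mono[of A h B g] by auto
    have "complex_point \<kappa> B g"
    proof unfold_locales
      show "1 \<in> B" using AB' one_mem by blast
      show "\<kappa> c \<in> B" for c using AB' const_mem by blast
      show "g (\<kappa> c) = c" for c using AB' const_mem pt_const by simp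
      fix x y assume "x \<in> B" "y \<in> B"
      then obtain B' g' where *: "complex_point \<kappa> B' g'" "B' \<subseteq> B" "\<forall>z\<in>B'. g z = g' z" "x \<in> B'" "y \<in> B'"
        using pr by blast
      interpret p: complex_point \<kappa> B' g' by fact
      show "x - y \<in> B" "x * y \<in> B" using * p.mem_intros by blast+
      show "g (x - y) = g x - g y" "g (x * y) = g x * g y"
        using * by (simp_all add: p.mem_intros p.pt_diff p.pt_mult)
    qed
    then show "\<Union>C \<in> Ext" using AB U unfolding Ext_def by blast
  qed
  then obtain M where M: "M \<in> Ext" "\<And>Y. Y \<in> Ext \<Longrightarrow> M \<subseteq> Y \<Longrightarrow> Y = M" by blast
  then obtain V \<psi> where MV: "M = gr V \<psi>" and V: "complex_point \<kappa> V \<psi>" "gr A h \<subseteq> gr V \<psi>"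
    by (auto simp: Ext_def)
  note max = M(2)[unfolded MV]
  interpret V: complex_point \<kappa> V \<psi> by fact
  \<comment> \<open>Maximality: a value compatible with all relations of \<open>x\<close> is already
    attained in \<open>V\<close>.\<close>
  have ext: "x \<in> V \<and> \<psi> x = \<rho>" if root: "\<And>p. p \<in> polys_over V \<Longrightarrow> poly p x = 0 \<Longrightarrow> poly (V.reduct p) \<rho> = 0" for x \<rho>
  proof -
    obtain h' where h': "complex_point \<kappa> (adjoin V x) h'" "\<And>a. a \<in> V \<Longrightarrow> h' a = \<psi> a" "h' x = \<rho>"
      using V.extend_adjoin[OF root] by blast
    have sub: "gr V \<psi> \<subseteq> gr (adjoin V x) h'" using h'(2) V.base_subset_adjoin
      by (force simp: gr_def image_iff)
    then have "gr (adjoin V x) h' \<in> Ext" using h'(1) V(2) unfolding Ext_def by blast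
    then have "gr (adjoin V x) h' = gr V \<psi>" using max sub by blast
    moreover have "(x, \<rho>) \<in> gr (adjoin V x) h'" using V.gen_mem_adjoin h'(3) by (force simp: gr_def)
    ultimately show ?thesis by (auto simp: gr_def)
  qed
  have loc: "inverse a \<in> V" if "a \<in> V" "\<psi> a \<noteq> 0" for a
    using ext V.inverse_root[OF that] by blast
  have "complex_place \<kappa> V \<psi>"
  proof unfold_locales
    fix x :: 'a assume x: "x \<noteq> 0"
    show "x \<in> V \<or> inverse x \<in> V \<and> \<psi> (inverse x) = 0"
    proof (cases "\<exists>\<rho>. \<forall>p\<in>polys_over V. poly p x = 0 \<longrightarrow> poly (V.reduct p) \<rho> = 0")
      case True
      then show ?thesis using ext by blast
    next
      case False
      \<comment> \<open>Without a common root \<open>x\<close> has a unit relation, and then the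
        value 0 is compatible with every relation of \<open>inverse x\<close>.\<close>
      then have "\<exists>p\<in>polys_over V. poly p x = 0 \<and> V.reduct p \<noteq> 0 \<and> degree (V.reduct p) = 0"
        using V.common_root_or_unit_relation by blast
      then have "\<psi> (coeff p 0) = 0" if "p \<in> polys_over V" "poly p (inverse x) = 0" for p
        using V.const_coeff_of_inverse_relation[OF loc x _ that] by blast
      then have "poly (V.reduct p) 0 = 0" if "p \<in> polys_over V" "poly p (inverse x) = 0" for p
        using that by (simp add: poly_0_coeff_0 V.coeff_reduct)
      then show ?thesis using ext by blast
    qed
  qed
  moreover have "A \<subseteq> V" "\<And>a. a \<in> A \<Longrightarrow> \<psi> a = h a" using gr_mono[OF V(2)] by auto
  ultimately show ?thesis using that by blast
qed

end

section \<open>Substitution into multivariate polynomials\<close>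

definition monomial_value :: "('v \<Rightarrow> 'b::comm_ring_1) \<Rightarrow> ('v \<Rightarrow>\<^sub>0 nat) \<Rightarrow> 'b" where
  "monomial_value a \<mu> = (\<Prod>v\<in>Poly_Mapping.keys \<mu>. a v ^ Poly_Mapping.lookup \<mu> v)"

lemma monomial_value_superset:
  assumes "finite S" "Poly_Mapping.keys \<mu> \<subseteq> S"
  shows "monomial_value a \<mu> = (\<Prod>v\<in>S. a v ^ Poly_Mapping.lookup \<mu> v)"
  unfolding monomial_value_def
  by (rule prod.mono_neutral_left) (use assms in \<open>auto simp: in_keys_iff\<close>)

lemma monomial_value_0 [simp]: "monomial_value a 0 = 1"
  by (simp add: monomial_value_def)

lemma monomial_value_add: "monomial_value a (\<mu> + \<nu>) = monomial_value a \<mu> * monomial_value a \<nu>"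
proof -
  let ?S = "Poly_Mapping.keys \<mu> \<union> Poly_Mapping.keys \<nu>"
  have "finite ?S" "Poly_Mapping.keys (\<mu> + \<nu>) \<subseteq> ?S" by (simp, rule keys_add)
  then show ?thesis
    by (simp add: monomial_value_superset[of ?S] lookup_add power_add prod.distrib)
qed

lemma monomial_value_single [simp]: "monomial_value a (Poly_Mapping.single v n) = a v ^ n"
  by (cases "n = 0") (simp_all add: monomial_value_def)

lemma cpoly_subst_altdef:
  "cpoly_subst \<kappa> a p = (\<Sum>\<mu>\<in>Poly_Mapping.keys p. \<kappa> (Poly_Mapping.lookup p \<mu>) * monomial_value a \<mu>)"
  by (simp add: cpoly_subst_def monomial_value_def)

lemma cpoly_sum_monomials:
  "(\<Sum>\<mu>\<in>Poly_Mapping.keys p. Poly_Mapping.single \<mu> (Poly_Mapping.lookup p \<mu>)) = (p :: 'v cpoly)"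
  by (rule poly_mapping_eqI)
    (auto simp: lookup_sum lookup_single when_def sum.delta' in_keys_iff)

context complex_algebra
begin

lemma subst_superset:
  assumes "finite S" "Poly_Mapping.keys p \<subseteq> S"
  shows "cpoly_subst \<kappa> a p = (\<Sum>\<mu>\<in>S. \<kappa> (Poly_Mapping.lookup p \<mu>) * monomial_value a \<mu>)"
  unfolding cpoly_subst_altdef
  by (rule sum.mono_neutral_left) (use assms in \<open>auto simp: in_keys_iff const_0\<close>)

lemma subst_add: "cpoly_subst \<kappa> a (p + q) = cpoly_subst \<kappa> a p + cpoly_subst \<kappa> a q"
proof -
  let ?S = "Poly_Mapping.keys p \<union> Poly_Mapping.keys q"
  have "finite ?S" "Poly_Mapping.keys (p + q) \<subseteq> ?S" by (simp, rule keys_add)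
  then show ?thesis
    by (simp add: subst_superset[of ?S] lookup_add const_add algebra_simps sum.distrib)
qed

lemma subst_0 [simp]: "cpoly_subst \<kappa> a 0 = 0"
  by (simp add: cpoly_subst_altdef)

lemma subst_sum: "cpoly_subst \<kappa> a (sum f I) = (\<Sum>i\<in>I. cpoly_subst \<kappa> a (f i))"
  by (induction I rule: infinite_finite_induct) (auto simp: subst_add)

lemma subst_single: "cpoly_subst \<kappa> a (Poly_Mapping.single \<mu> c) = \<kappa> c * monomial_value a \<mu>"
  using subst_superset[of "{\<mu>}" "Poly_Mapping.single \<mu> c" a] by (simp split: if_splits)

lemma subst_mult: "cpoly_subst \<kappa> a (p * q) = cpoly_subst \<kappa> a p * cpoly_subst \<kappa> a q"
proof -
  let ?s = "\<lambda>p \<mu>. Poly_Mapping.single \<mu> (Poly_Mapping.lookup p \<mu>)"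
  have "p * q = (\<Sum>\<mu>\<in>Poly_Mapping.keys p. ?s p \<mu>) * (\<Sum>\<mu>\<in>Poly_Mapping.keys q. ?s q \<mu>)"
    by (simp only: cpoly_sum_monomials)
  also have "\<dots> = (\<Sum>\<mu>\<in>Poly_Mapping.keys p. \<Sum>\<nu>\<in>Poly_Mapping.keys q.
      Poly_Mapping.single (\<mu> + \<nu>) (Poly_Mapping.lookup p \<mu> * Poly_Mapping.lookup q \<nu>))"
    by (simp only: sum_product mult_single)
  finally have "cpoly_subst \<kappa> a (p * q) = (\<Sum>\<mu>\<in>Poly_Mapping.keys p. \<Sum>\<nu>\<in>Poly_Mapping.keys q.
      \<kappa> (Poly_Mapping.lookup p \<mu> * Poly_Mapping.lookup q \<nu>) * monomial_value a (\<mu> + \<nu>))"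
    by (simp only: subst_sum subst_single)
  then show ?thesis
    by (simp add: cpoly_subst_altdef[of _ _ p] cpoly_subst_altdef[of _ _ q] sum_product
        monomial_value_add const_mult mult_ac)
qed

lemma subst_const: "cpoly_subst \<kappa> a (cconst c) = \<kappa> c"
  by (simp add: cconst_def subst_single)

lemma subst_1 [simp]: "cpoly_subst \<kappa> a 1 = 1"
  using subst_const[of a 1] by (simp add: cconst_def const_1 flip: single_one)

lemma subst_var: "cpoly_subst \<kappa> a (cvar v) = a v"
  by (simp add: cvar_def subst_single const_1)

lemma subst_uminus: "cpoly_subst \<kappa> a (- p) = - cpoly_subst \<kappa> a p"
  using subst_add[of a p "- p"] by (simp add: eq_neg_iff_add_eq_0 add.commute)

lemma subst_diff: "cpoly_subst \<kappa> a (p - q) = cpoly_subst \<kappa> a p - cpoly_subst \<kappa> a q"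
  using subst_add[of a p "- q"] by (simp add: subst_uminus)

lemma subst_power: "cpoly_subst \<kappa> a (p ^ n) = cpoly_subst \<kappa> a p ^ n"
  by (induction n) (auto simp: subst_mult)

end

lemma hom_subst:
  fixes g :: "'c::comm_ring_1 \<Rightarrow> 'd::comm_ring_1" and p :: "'v cpoly"
  assumes "\<And>x y. g (x + y) = g x + g y" "\<And>x y. g (x * y) = g x * g y" "g 1 = 1" "g 0 = 0"
  shows "g (cpoly_subst \<kappa> a p) = cpoly_subst (\<lambda>c. g (\<kappa> c)) (\<lambda>v. g (a v)) p"
proof -
  have s: "g (sum f I) = (\<Sum>i\<in>I. g (f i))" for f and I :: "('v \<Rightarrow>\<^sub>0 nat) set"
    by (induction I rule: infinite_finite_induct) (auto simp: assms)
  have p: "g (prod f I) = (\<Prod>i\<in>I. g (f i))" for f and I :: "'v set"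
    by (induction I rule: infinite_finite_induct) (auto simp: assms)
  have w: "g (x ^ n) = g x ^ n" for x n by (induction n) (auto simp: assms)
  show ?thesis by (simp add: cpoly_subst_def s p w assms(2))
qed

definition cpolys_in :: "'v set \<Rightarrow> 'v cpoly set" where
  "cpolys_in U = {p. \<forall>\<mu>\<in>Poly_Mapping.keys p. Poly_Mapping.keys \<mu> \<subseteq> U}"

lemma cpolys_in_mono: "U \<subseteq> W \<Longrightarrow> cpolys_in U \<subseteq> cpolys_in W"
  by (auto simp: cpolys_in_def)

lemma cconst_mem_cpolys_in: "cconst c \<in> cpolys_in U"
  by (auto simp: cpolys_in_def cconst_def split: if_splits)

lemma cvar_mem_cpolys_in: "v \<in> U \<Longrightarrow> cvar v \<in> cpolys_in U"
  by (auto simp: cpolys_in_def cvar_def split: if_splits)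

lemma subring_set_cpolys_in: "subring_set (cpolys_in U)"
proof
  show "1 \<in> cpolys_in U" by (auto simp: cpolys_in_def)
  fix p q :: "'a cpoly" assume pq: "p \<in> cpolys_in U" "q \<in> cpolys_in U"
  have "Poly_Mapping.keys (p - q) \<subseteq> Poly_Mapping.keys p \<union> Poly_Mapping.keys q"
    by (auto simp: in_keys_iff lookup_minus)
  then show "p - q \<in> cpolys_in U" using pq by (auto simp: cpolys_in_def)
  show "p * q \<in> cpolys_in U"
    unfolding cpolys_in_def
  proof (intro CollectI ballI)
    fix \<mu> assume "\<mu> \<in> Poly_Mapping.keys (p * q)"
    then obtain a b where ab: "a \<in> Poly_Mapping.keys p" "b \<in> Poly_Mapping.keys q" "\<mu> = a + b"
      using keys_mult[of p q] by blast
    then show "Poly_Mapping.keys \<mu> \<subseteq> U" using pq keys_add[of a b] by (fastforce simp: cpolys_in_def)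
  qed
qed

lemma cpoly_subst_cong:
  assumes "p \<in> cpolys_in U" "\<And>v. v \<in> U \<Longrightarrow> a v = b v"
  shows "cpoly_subst \<kappa> a p = cpoly_subst \<kappa> b p"
  unfolding cpoly_subst_def
  by (intro sum.cong prod.cong arg_cong2[where f = "(*)"] refl arg_cong2[where f = "(^)"])
    (use assms in \<open>auto simp: cpolys_in_def\<close>)

lemma (in subring_set) monomial_value_mem:
  "(\<And>v. v \<in> Poly_Mapping.keys \<mu> \<Longrightarrow> a v \<in> A) \<Longrightarrow> monomial_value a \<mu> \<in> A"
  unfolding monomial_value_def by (intro prod_mem power_mem) auto

lemma (in complex_algebra) subst_mem:
  assumes "subring_set B" "p \<in> cpolys_in U" "\<And>v. v \<in> U \<Longrightarrow> a v \<in> B" "\<And>c. \<kappa> c \<in> B"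
  shows "cpoly_subst \<kappa> a p \<in> B"
proof -
  interpret subring_set B by fact
  show ?thesis
    unfolding cpoly_subst_altdef
    using assms(2-4) by (intro sum_mem mult_mem monomial_value_mem) (auto simp: cpolys_in_def)
qed

lemma (in complex_point) pt_subst:
  assumes "p \<in> cpolys_in U" "\<And>v. v \<in> U \<Longrightarrow> a v \<in> A"
  shows "h (cpoly_subst \<kappa> a p) = cpoly_eval (\<lambda>v. h (a v)) p"
proof -
  have m: "monomial_value a \<mu> \<in> A" "h (monomial_value a \<mu>) = monomial_value (\<lambda>v. h (a v)) \<mu>"
    if "\<mu> \<in> Poly_Mapping.keys p" for \<mu>
  proof -
    have a: "a v \<in> A" if "v \<in> Poly_Mapping.keys \<mu>" for v
      using assms that \<open>\<mu> \<in> _\<close> by (auto simp: cpolys_in_def)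
    show "monomial_value a \<mu> \<in> A" by (rule monomial_value_mem) (rule a)
    show "h (monomial_value a \<mu>) = monomial_value (\<lambda>v. h (a v)) \<mu>"
      unfolding monomial_value_def using a by (simp add: pt_prod pt_power power_mem)
  qed
  then show ?thesis
    unfolding cpoly_subst_altdef by (simp add: pt_sum pt_mult pt_const mult_mem const_mem)
qed

global_interpretation ceval: complex_algebra "\<lambda>c. c"
  by unfold_locales auto

global_interpretation cconst: complex_algebra cconst
  by unfold_locales (auto simp: cconst_def single_add mult_single)

global_interpretation cpolyconst: complex_algebra "\<lambda>c. [:c:]"
  by unfold_locales auto

lemma cpoly_eval_subst:
  "cpoly_eval x (cpoly_subst cconst b p) = cpoly_eval (\<lambda>v. cpoly_eval x (b v)) p"
  by (subst hom_subst[of "cpoly_eval x"])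
    (auto simp: ceval.subst_add ceval.subst_mult ceval.subst_const)

section \<open>Separating weights and Noether normalization\<close>

text \<open>The weights are powers of a base \<open>e\<close> larger than all exponents, so a
  weighted degree displays the exponents as its digits. The last variable gets the weight
  \<open>e^0 = 1\<close>.\<close>

lemma separating_weights:
  fixes F :: "(nat \<Rightarrow>\<^sub>0 nat) set"
  assumes "finite F" "\<And>\<mu>. \<mu> \<in> F \<Longrightarrow> Poly_Mapping.keys \<mu> \<subseteq> {..k}"
  obtains w :: "nat \<Rightarrow> nat" where "w k = 1" "\<And>i. w i > 0"
    "inj_on (\<lambda>\<mu>. \<Sum>i\<le>k. Poly_Mapping.lookup \<mu> i * w i) F"
proof -
  define e where "e = Suc (\<Sum>\<mu>\<in>F. \<Sum>i\<le>k. Poly_Mapping.lookup \<mu> i)"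
  have e: "Poly_Mapping.lookup \<mu> i < e" if "\<mu> \<in> F" "i \<le> k" for \<mu> i
  proof -
    have "Poly_Mapping.lookup \<mu> i \<le> (\<Sum>i\<le>k. Poly_Mapping.lookup \<mu> i)"
      using that by (intro member_le_sum) auto
    also have "\<dots> \<le> (\<Sum>\<mu>\<in>F. \<Sum>i\<le>k. Poly_Mapping.lookup \<mu> i)"
      using that assms(1) by (intro member_le_sum[of \<mu> F "\<lambda>\<mu>. \<Sum>i\<le>k. Poly_Mapping.lookup \<mu> i"]) auto
    finally show ?thesis by (simp add: e_def)
  qed
  define val where "val \<mu> j = (\<Sum>i\<le>j. Poly_Mapping.lookup \<mu> i * e ^ (j - i))" for \<mu> :: "nat \<Rightarrow>\<^sub>0 nat" and j
  \<comment> \<open>Horner form: reducing modulo \<open>e\<close> reads off the last digit, and the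
    remaining number is treated by induction.\<close>
  have val_Suc: "val \<mu> (Suc j) = e * val \<mu> j + Poly_Mapping.lookup \<mu> (Suc j)" for \<mu> j
  proof -
    have "(\<Sum>i\<le>j. Poly_Mapping.lookup \<mu> i * e ^ (Suc j - i)) = e * val \<mu> j"
      unfolding val_def sum_distrib_left by (rule sum.cong) (auto simp: Suc_diff_le)
    then show ?thesis by (simp add: val_def)
  qed
  have eq: "\<forall>i\<le>j. Poly_Mapping.lookup \<mu> i = Poly_Mapping.lookup \<nu> i"
    if "\<mu> \<in> F" "\<nu> \<in> F" "j \<le> k" "val \<mu> j = val \<nu> j" for \<mu> \<nu> j
    using that(3,4)
  proof (induction j)
    case 0
    then show ?case by (simp add: val_def)
  next
    case (Suc j)
    note lt = e[OF that(1) Suc.prems(1)] e[OF that(2) Suc.prems(1)]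
    have *: "e * val \<mu> j + Poly_Mapping.lookup \<mu> (Suc j) = e * val \<nu> j + Poly_Mapping.lookup \<nu> (Suc j)"
      using Suc.prems(2) by (simp add: val_Suc)
    from arg_cong[OF *, of "\<lambda>x. x mod e"] have "Poly_Mapping.lookup \<mu> (Suc j) = Poly_Mapping.lookup \<nu> (Suc j)"
      using lt by simp
    moreover have "e * val \<mu> j = e * val \<nu> j" using * calculation by linarith
    then have "val \<mu> j = val \<nu> j" by (simp only: mult_cancel1) (simp add: e_def)
    ultimately show ?case using Suc by (auto simp: le_Suc_eq)
  qed
  have "inj_on (\<lambda>\<mu>. val \<mu> k) F"
  proof (rule inj_onI)
    fix \<mu> \<nu> assume *: "\<mu> \<in> F" "\<nu> \<in> F" "val \<mu> k = val \<nu> k"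
    show "\<mu> = \<nu>"
    proof (rule poly_mapping_eqI)
      fix i
      show "Poly_Mapping.lookup \<mu> i = Poly_Mapping.lookup \<nu> i"
      proof (cases "i \<le> k")
        case True
        then show ?thesis using eq[OF *(1,2) order_refl *(3)] by blast
      next
        case False
        then have "i \<notin> Poly_Mapping.keys \<mu>" "i \<notin> Poly_Mapping.keys \<nu>" using assms(2) * by force+
        then show ?thesis by (simp add: in_keys_iff)
      qed
    qed
  qed
  then show ?thesis using that[of "\<lambda>i. e ^ (k - i)"] by (simp add: val_def e_def)
qed

text \<open>On the curve with coordinates \<open>z ^ w i\<close> separating weights send distinct
  monomials to distinct powers of \<open>z\<close>, so the restriction of \<open>t\<close> is a
  nonzero polynomial in one variable.\<close>

lemma cpoly_nonzero_point:
  fixes t :: "nat cpoly"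
  assumes "t \<noteq> 0"
  obtains c where "cpoly_eval c t \<noteq> 0"
proof -
  let ?K = "Poly_Mapping.keys t"
  obtain k where k: "\<Union> (Poly_Mapping.keys ` ?K) \<subseteq> {..k}"
    using finite_nat_iff_bounded_le[of "\<Union> (Poly_Mapping.keys ` ?K)"] by auto
  obtain w :: "nat \<Rightarrow> nat" where w: "inj_on (\<lambda>\<mu>. \<Sum>i\<le>k. Poly_Mapping.lookup \<mu> i * w i) ?K"
    using separating_weights[of ?K k] k by (metis UN_subset_iff finite_keys)
  let ?w = "\<lambda>\<mu>. \<Sum>i\<le>k. Poly_Mapping.lookup \<mu> i * w i"
  define q where "q = (\<Sum>\<mu>\<in>?K. monom (Poly_Mapping.lookup t \<mu>) (?w \<mu>))"
  have ev: "cpoly_eval (\<lambda>i. z ^ w i) t = poly q z" for z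
  proof -
    have "monomial_value (\<lambda>i. z ^ w i) \<mu> = z ^ ?w \<mu>" if "\<mu> \<in> ?K" for \<mu>
      using k that
      by (subst monomial_value_superset[of "{..k}"]) (auto simp: power_sum power_mult[symmetric] mult.commute)
    then show ?thesis by (simp add: cpoly_subst_altdef q_def poly_sum poly_monom)
  qed
  obtain \<mu> where \<mu>: "\<mu> \<in> ?K" using assms by fastforce
  have "coeff q (?w \<mu>) = (\<Sum>\<nu>\<in>?K. if \<nu> = \<mu> then Poly_Mapping.lookup t \<nu> else 0)"
    unfolding q_def coeff_sum by (rule sum.cong) (use w \<mu> in \<open>auto simp: inj_on_def\<close>)
  also have "\<dots> = Poly_Mapping.lookup t \<mu>" using \<mu> by (simp add: sum.delta)
  finally have "q \<noteq> 0" using \<mu> by (auto simp: in_keys_iff)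
  then have "finite {z. poly q z = 0}" by (rule poly_roots_finite)
  then have "{z. poly q z = 0} \<noteq> UNIV" using infinite_UNIV_char_0[where ?'a = complex] by metis
  then obtain z where "poly q z \<noteq> 0" by blast
  then show ?thesis using that[of "\<lambda>i. z ^ w i"] ev[of z] by simp
qed

definition alg_indep :: "(complex \<Rightarrow> 'a::comm_ring_1) \<Rightarrow> nat \<Rightarrow> (nat \<Rightarrow> 'a) \<Rightarrow> bool" where
  "alg_indep \<kappa> d y \<longleftrightarrow> (\<forall>p\<in>cpolys_in {..<d}. cpoly_subst \<kappa> y p = 0 \<longrightarrow> p = 0)"

definition generated :: "(complex \<Rightarrow> 'a::comm_ring_1) \<Rightarrow> nat \<Rightarrow> (nat \<Rightarrow> 'a) \<Rightarrow> 'a set" where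
  "generated \<kappa> k r = cpoly_subst \<kappa> r ` cpolys_in {..<k}"

context complex_algebra
begin

lemma subring_set_generated: "subring_set (generated \<kappa> k r)"
  unfolding generated_def
proof (rule subring_set.intro)
  interpret P: subring_set "cpolys_in {..<k}" by (rule subring_set_cpolys_in)
  show "1 \<in> cpoly_subst \<kappa> r ` cpolys_in {..<k}" using P.one_mem by (force simp: image_iff)
  fix x y assume "x \<in> cpoly_subst \<kappa> r ` cpolys_in {..<k}" "y \<in> cpoly_subst \<kappa> r ` cpolys_in {..<k}"
  then obtain p q where pq: "p \<in> cpolys_in {..<k}" "q \<in> cpolys_in {..<k}" "x = cpoly_subst \<kappa> r p" "y = cpoly_subst \<kappa> r q"
    by blast
  show "x - y \<in> cpoly_subst \<kappa> r ` cpolys_in {..<k}" "x * y \<in> cpoly_subst \<kappa> r ` cpolys_in {..<k}"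
    unfolding pq subst_diff[symmetric] subst_mult[symmetric]
    using P.diff_mem[OF pq(1,2)] P.mult_mem[OF pq(1,2)] by blast+
qed

lemma const_mem_generated: "\<kappa> c \<in> generated \<kappa> k r"
  unfolding generated_def using cconst_mem_cpolys_in[of c] subst_const[of r c] by (metis imageI)

lemma gen_mem_generated: "i < k \<Longrightarrow> r i \<in> generated \<kappa> k r"
  unfolding generated_def using cvar_mem_cpolys_in[of i] subst_var[of r i] by (metis imageI lessThan_iff)

lemma generated_subset:
  "subring_set B \<Longrightarrow> (\<And>i. i < k \<Longrightarrow> r i \<in> B) \<Longrightarrow> (\<And>c. \<kappa> c \<in> B) \<Longrightarrow> generated \<kappa> k r \<subseteq> B"
  unfolding generated_def by (auto intro!: subst_mem)

lemma generated_Suc: "generated \<kappa> (Suc k) r = adjoin (generated \<kappa> k r) (r k)"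
proof -
  interpret S: subring_set "generated \<kappa> k r" by (rule subring_set_generated)
  show ?thesis
  proof (rule subset_antisym)
    show "generated \<kappa> (Suc k) r \<subseteq> adjoin (generated \<kappa> k r) (r k)"
    proof (rule generated_subset[OF S.subring_set_adjoin])
      show "r i \<in> adjoin (generated \<kappa> k r) (r k)" if "i < Suc k" for i
        using that S.gen_mem_adjoin S.base_subset_adjoin gen_mem_generated[of i k r]
        by (cases "i = k") auto
    qed (use const_mem_generated S.base_subset_adjoin in blast)
    show "adjoin (generated \<kappa> k r) (r k) \<subseteq> generated \<kappa> (Suc k) r"
      by (intro S.adjoin_subset subring_set_generated generated_subset gen_mem_generated const_mem_generated) auto
  qed
qed

end

locale complex_field = complex_algebra \<kappa> for \<kappa> :: "complex \<Rightarrow> 'a::field"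
begin

lemma const_nonzero: "c \<noteq> 0 \<Longrightarrow> \<kappa> c \<noteq> 0"
  using const_mult[of c "inverse c"] const_1 by auto

lemma const_inverse: "\<kappa> (inverse c) = inverse (\<kappa> c)"
  using const_mult[of c "inverse c"] const_1 const_0
  by (cases "c = 0") (auto simp: inverse_unique[symmetric])

text \<open>Nagata's change of variables: after \<open>r\<^sub>i \<mapsto> z\<^sub>i = r\<^sub>i - x\<^bsup>w i\<^esup>\<close> with separating weights a relation becomes
  monic in \<open>x\<close>, since each monomial contributes a monic polynomial in \<open>x\<close> of its own degree.\<close>

lemma nagata:
  assumes P: "P \<in> cpolys_in {..k}" "P \<noteq> 0" "cpoly_subst \<kappa> r P = 0"
  obtains w :: "nat \<Rightarrow> nat" where "integral_over (generated \<kappa> k (\<lambda>i. r i - r k ^ w i)) (r k)"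
proof -
  let ?K = "Poly_Mapping.keys P"
  obtain w :: "nat \<Rightarrow> nat" where w: "w k = 1" "\<And>i. w i > 0"
      "inj_on (\<lambda>\<mu>. \<Sum>i\<le>k. Poly_Mapping.lookup \<mu> i * w i) ?K"
    using separating_weights[of ?K k] P(1) by (force simp: cpolys_in_def)
  define z where "z i = r i - r k ^ w i" for i
  define A where "A = generated \<kappa> k z"
  let ?w = "\<lambda>\<mu>. \<Sum>i\<le>k. Poly_Mapping.lookup \<mu> i * w i"
  interpret A: subring_set A unfolding A_def by (rule subring_set_generated)
  interpret PA: subring_set "polys_over A" by (rule A.subring_set_polys_over)
  \<comment> \<open>\<open>l i\<close> stands for \<open>z i + X ^ w i\<close> when
    \<open>i < k\<close>, and for \<open>X\<close> when \<open>i = k\<close> because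
    \<open>w k = 1\<close>; its value at \<open>r k\<close> is \<open>r i\<close> for
    \<open>i \<le> k\<close>.\<close>
  define l where "l i = (if i < k then [:z i:] else 0) + monom 1 (w i)" for i
  have l_mem: "l i \<in> polys_over A" for i
    unfolding l_def A_def using gen_mem_generated[of i k z]
    by (intro PA.add_mem[unfolded A_def] A.monom_mem_polys_over[unfolded A_def] A.one_mem[unfolded A_def])
      (auto intro: A.const_mem_polys_over[unfolded A_def] PA.zero_mem[unfolded A_def])
  have l_poly: "poly (l i) (r k) = r i" if "i \<le> k" for i
    using that w(1) by (auto simp: l_def poly_monom z_def)
  have l_deg: "degree (l i) = w i \<and> lead_coeff (l i) = 1" for i
  proof -
    have "degree (if i < k then [:z i:] else 0) < degree (monom (1::'a) (w i))"
      using w(2)[of i] by (auto simp: degree_monom_eq)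
    moreover from this have "coeff (if i < k then [:z i:] else 0) (w i) = 0"
      by (intro coeff_eq_0) (simp add: degree_monom_eq)
    ultimately show ?thesis unfolding l_def by (simp add: degree_add_eq_right degree_monom_eq)
  qed
  define M where "M \<mu> = (\<Prod>i\<le>k. l i ^ Poly_Mapping.lookup \<mu> i)" for \<mu> :: "nat \<Rightarrow>\<^sub>0 nat"
  have M_mem: "M \<mu> \<in> polys_over A" for \<mu> unfolding M_def using l_mem by (intro PA.prod_mem PA.power_mem)
  have l_nz: "l i \<noteq> 0" for i using l_deg[of i] by auto
  have M_lead: "lead_coeff (M \<mu>) = 1" for \<mu>
    by (simp add: M_def lead_coeff_prod lead_coeff_power l_deg[THEN conjunct2])
  have M_deg: "degree (M \<mu>) = ?w \<mu>" for \<mu>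
    unfolding M_def using l_deg l_nz by (subst degree_prod_eq_sum_degree) (auto simp: degree_power_eq mult.commute)
  have M_poly: "poly (M \<mu>) (r k) = monomial_value r \<mu>" if "\<mu> \<in> ?K" for \<mu>
    using P(1) that l_poly
    by (subst monomial_value_superset[of "{..k}"]) (auto simp: M_def poly_prod poly_power cpolys_in_def)
  have fin: "finite (?w ` ?K)" "?w ` ?K \<noteq> {}" using P(2) by auto
  from Max_in[OF this] obtain \<mu>0 where \<mu>0': "\<mu>0 \<in> ?K" "Max (?w ` ?K) = ?w \<mu>0" by (rule imageE)
  have \<mu>0: "\<mu>0 \<in> ?K" "\<And>\<mu>. \<mu> \<in> ?K \<Longrightarrow> ?w \<mu> \<le> ?w \<mu>0"
    using \<mu>0'(1) Max_ge[OF fin(1)] unfolding \<mu>0'(2) by blast+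
  \<comment> \<open>The relation \<open>P\<close> with \<open>l i\<close> substituted for
    \<open>r i\<close>. Only \<open>M \<mu>0\<close> reaches the top degree, so the leading
    coefficient of \<open>Q\<close> is the nonzero constant \<open>c\<close>, which is invertible in
    \<open>A\<close>.\<close>
  define Q where "Q = (\<Sum>\<mu>\<in>?K. smult (\<kappa> (Poly_Mapping.lookup P \<mu>)) (M \<mu>))"
  define c where "c = \<kappa> (Poly_Mapping.lookup P \<mu>0)"
  have c: "c \<noteq> 0" using \<mu>0(1) by (simp add: c_def const_nonzero in_keys_iff)
  have cinv: "inverse c \<in> A" unfolding c_def A_def by (simp flip: const_inverse add: const_mem_generated)
  have Q_mem: "Q \<in> polys_over A"
    unfolding Q_def using M_mem const_mem_generated[of _ k z]
    by (intro PA.sum_mem A.smult_mem_polys_over) (auto simp: A_def)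
  have "coeff Q (?w \<mu>0) = (\<Sum>\<mu>\<in>?K. if \<mu> = \<mu>0 then c else 0)"
    unfolding Q_def coeff_sum
  proof (rule sum.cong)
    fix \<mu> assume \<mu>: "\<mu> \<in> ?K"
    show "coeff (smult (\<kappa> (Poly_Mapping.lookup P \<mu>)) (M \<mu>)) (?w \<mu>0) = (if \<mu> = \<mu>0 then c else 0)"
    proof (cases "\<mu> = \<mu>0")
      case True
      then show ?thesis using M_lead[of \<mu>0] by (simp add: M_deg c_def)
    next
      case False
      then have "?w \<mu> \<noteq> ?w \<mu>0" using inj_onD[OF w(3) _ \<mu> \<mu>0(1)] by blast
      then have "degree (M \<mu>) < ?w \<mu>0" using \<mu>0(2)[OF \<mu>] unfolding M_deg by (rule le_neq_implies_less[rotated])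
      then show ?thesis using False by (simp add: coeff_eq_0)
    qed
  qed simp
  also have "\<dots> = c" using \<mu>0(1) by simp
  finally have Qc: "coeff Q (?w \<mu>0) = c" .
  have "degree Q \<le> ?w \<mu>0"
    unfolding Q_def using \<mu>0(2) M_deg
    by (intro degree_sum_le) (auto intro: order_trans[OF degree_smult_le])
  then have Qd: "degree Q = ?w \<mu>0" using Qc c by (intro le_antisym le_degree) auto
  have "poly Q (r k) = cpoly_subst \<kappa> r P"
    by (simp add: Q_def cpoly_subst_altdef poly_sum M_poly)
  then have "integral_over A (r k)"
    unfolding integral_over_def using Qc Qd c cinv Q_mem P(3)
    by (intro bexI[of _ "smult (inverse c) Q"]) (auto intro: A.smult_mem_polys_over)
  then show ?thesis using that[of w] unfolding A_def z_def by simp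
qed

text \<open>Induction on the number of generators. If they are dependent, the change of variables
  leaves \<open>k\<close> elements \<open>?z i\<close> over which \<open>r k\<close> is integral,
  and the other generators \<open>?z i + r k ^ w i\<close> then are integral as well.\<close>

theorem noether_normalization:
  obtains d y where "alg_indep \<kappa> d y" "\<And>i. i < d \<Longrightarrow> y i \<in> generated \<kappa> k r"
    "\<And>i. i < k \<Longrightarrow> integral_over (generated \<kappa> d y) (r i)"
proof -
  have "\<exists>d y. alg_indep \<kappa> d y \<and> (\<forall>i<d. y i \<in> generated \<kappa> k r) \<and> (\<forall>i<k. integral_over (generated \<kappa> d y) (r i))"
  proof (induction k arbitrary: r)
    case 0
    have "alg_indep \<kappa> 0 r"
      unfolding alg_indep_def
    proof (intro ballI impI)
      fix p assume p: "p \<in> cpolys_in {..<0::nat}" "cpoly_subst \<kappa> r p = 0"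
      then have sub: "Poly_Mapping.keys p \<subseteq> {0}" by (auto simp: cpolys_in_def)
      have "\<kappa> (Poly_Mapping.lookup p 0) = 0" using p(2) subst_superset[OF _ sub, of r] by simp
      then have "Poly_Mapping.lookup p 0 = 0" using const_nonzero by blast
      then show "p = 0" using sub by (metis in_keys_iff keys_eq_empty subset_singletonD singletonI)
    qed
    then show ?case by blast
  next
    case (Suc k)
    show ?case
    proof (cases "alg_indep \<kappa> (Suc k) r")
      case True
      have "integral_over (generated \<kappa> (Suc k) r) (r i)" if "i < Suc k" for i
        using that by (intro subring_set.integral_over_mem subring_set_generated gen_mem_generated)
      then show ?thesis using True gen_mem_generated by blast
    next
      case False
      then obtain P where P: "P \<in> cpolys_in {..k}" "P \<noteq> 0" "cpoly_subst \<kappa> r P = 0"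
        by (auto simp: alg_indep_def lessThan_Suc_atMost)
      obtain w :: "nat \<Rightarrow> nat" where w: "integral_over (generated \<kappa> k (\<lambda>i. r i - r k ^ w i)) (r k)"
        using nagata[OF P] .
      let ?z = "\<lambda>i. r i - r k ^ w i"
      obtain d y where dy: "alg_indep \<kappa> d y" "\<forall>i<d. y i \<in> generated \<kappa> k ?z"
        "\<forall>i<k. integral_over (generated \<kappa> d y) (?z i)" using Suc.IH[of ?z] by blast
      let ?B = "{t. integral_over (generated \<kappa> d y) t}"
      note T = subring_set_generated[of d y]
      interpret B: subring_set ?B by (rule subring_set_integral[OF T])
      interpret S: subring_set "generated \<kappa> (Suc k) r" by (rule subring_set_generated)
      have "generated \<kappa> k ?z \<subseteq> ?B"
        using dy(3) const_mem_generated subring_set.integral_over_mem[OF T]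
        by (intro generated_subset B.subring_set_axioms) auto
      then have "integral_over ?B (r k)" using w by (rule integral_over_mono)
      then have rk: "r k \<in> ?B" using integral_over_trans[OF T, of ?B "r k"] by auto
      have "r i \<in> ?B" if "i < Suc k" for i
      proof (cases "i = k")
        case False
        then have "?z i \<in> ?B" using that dy(3) by auto
        from B.add_mem[OF this B.power_mem[OF rk, of "w i"]] show ?thesis by simp
      qed (use rk in simp)
      moreover have "generated \<kappa> k ?z \<subseteq> generated \<kappa> (Suc k) r"
        by (intro generated_subset S.subring_set_axioms const_mem_generated S.diff_mem S.power_mem gen_mem_generated) auto
      ultimately show ?thesis using dy(1,2) by blast
    qed
  qed
  then show ?thesis using that by blast
qed

text \<open>A polynomial in \<open>y d\<close> over the first \<open>d\<close> elements is one
  polynomial \<open>P\<close> in \<open>d + 1\<close> variables, which vanishes by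
  independence.\<close>

lemma alg_indep_transcendental:
  assumes "alg_indep \<kappa> (Suc d) y"
  shows "transcendental_over (generated \<kappa> d y) (y d)"
  unfolding transcendental_over_def
proof (intro ballI impI)
  fix p assume p: "p \<in> polys_over (generated \<kappa> d y)" "poly p (y d) = 0"
  then have "\<exists>q. q \<in> cpolys_in {..<d} \<and> coeff p i = cpoly_subst \<kappa> y q" for i
    by (auto simp: polys_over_def generated_def)
  then obtain q where q: "\<And>i. q i \<in> cpolys_in {..<d}" "\<And>i. coeff p i = cpoly_subst \<kappa> y (q i)" by metis
  interpret C: subring_set "cpolys_in {..<Suc d}" by (rule subring_set_cpolys_in)
  define P where "P = (\<Sum>i\<le>degree p. q i * cvar d ^ i)"
  have "q i \<in> cpolys_in {..<Suc d}" for i using q(1)[of i] cpolys_in_mono[of "{..<d}" "{..<Suc d}"] by auto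
  then have "P \<in> cpolys_in {..<Suc d}"
    unfolding P_def by (intro C.sum_mem C.mult_mem C.power_mem cvar_mem_cpolys_in) auto
  moreover have "cpoly_subst \<kappa> y P = poly p (y d)"
    by (simp add: P_def subst_sum subst_mult subst_power subst_var q(2) poly_altdef)
  ultimately have P0: "P = 0" using assms p(2) by (auto simp: alg_indep_def)
  have "q i = 0" if i: "i \<le> degree p" for i
  proof (rule ccontr)
    assume "q i \<noteq> 0"
    then obtain c where c: "cpoly_eval c (q i) \<noteq> 0" by (rule cpoly_nonzero_point)
    \<comment> \<open>Fixing the first coordinates at \<open>c\<close> and letting the last one vary
      recovers the values of all coefficients \<open>q i\<close> at \<open>c\<close> from
      \<open>P = 0\<close>.\<close>
    define u where "u = (\<Sum>i\<le>degree p. monom (cpoly_eval c (q i)) i)"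
    have "poly u z = cpoly_eval (c(d := z)) P" for z
    proof -
      have "cpoly_eval (c(d := z)) (q i) = cpoly_eval c (q i)" for i
        by (rule cpoly_subst_cong[OF q(1)]) auto
      then show ?thesis
        by (simp add: u_def P_def poly_sum poly_monom ceval.subst_sum ceval.subst_mult ceval.subst_power ceval.subst_var)
    qed
    then have "u = 0" using poly_all_0_iff_0[of u] by (simp add: P0)
    moreover have "coeff u i = cpoly_eval c (q i)"
      using i by (simp add: u_def coeff_sum sum.delta')
    ultimately show False using c by simp
  qed
  then have "coeff p i = 0" if "i \<le> degree p" for i using q(2)[of i] that by simp
  then show "p = 0" by (metis leading_coeff_0_iff order_refl)
qed

lemma alg_indep_Suc: "alg_indep \<kappa> (Suc d) y \<Longrightarrow> alg_indep \<kappa> d y"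
  unfolding alg_indep_def using cpolys_in_mono[of "{..<d}" "{..<Suc d}"] by auto

text \<open>The elements are adjoined one at a time to the constants, which form a field.\<close>

lemma completely_integrally_closed_generated:
  "alg_indep \<kappa> d y \<Longrightarrow> completely_integrally_closed (generated \<kappa> d y)"
proof (induction d)
  case 0
  have g: "generated \<kappa> 0 y = range \<kappa>"
  proof
    show "generated \<kappa> 0 y \<subseteq> range \<kappa>"
    proof (rule generated_subset)
      show "subring_set (range \<kappa>)"
        using const_1 by unfold_locales (auto simp flip: const_diff const_mult simp: image_iff intro: exI[of _ 1])
    qed auto
  qed (use const_mem_generated in auto)
  have "fracs (range \<kappa>) \<subseteq> range \<kappa>"
    by (auto simp: fracs_def divide_inverse simp flip: const_inverse const_mult)
  then show ?case unfolding g completely_integrally_closed_def by blast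
next
  case (Suc d)
  show ?case
    unfolding generated_Suc
    by (rule completely_integrally_closed_adjoin[OF subring_set_generated
          Suc.IH[OF alg_indep_Suc[OF Suc.prems]] alg_indep_transcendental[OF Suc.prems]])
qed

text \<open>By independence an element determines its polynomial, so evaluation at any prescribed
  \<open>b\<close> is well defined: the ring is that of affine \<open>d\<close>-space.\<close>

lemma alg_indep_point:
  assumes "alg_indep \<kappa> d y"
  obtains h where "complex_point \<kappa> (generated \<kappa> d y) h"
    "\<And>p. p \<in> cpolys_in {..<d} \<Longrightarrow> h (cpoly_subst \<kappa> y p) = cpoly_eval b p"
proof -
  interpret P: subring_set "cpolys_in {..<d}" by (rule subring_set_cpolys_in)
  interpret S: subring_set "generated \<kappa> d y" by (rule subring_set_generated)
  define h where "h z = cpoly_eval b (SOME p. p \<in> cpolys_in {..<d} \<and> cpoly_subst \<kappa> y p = z)" for z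
  have h: "h (cpoly_subst \<kappa> y p) = cpoly_eval b p" if p: "p \<in> cpolys_in {..<d}" for p
  proof -
    define q where "q = (SOME q. q \<in> cpolys_in {..<d} \<and> cpoly_subst \<kappa> y q = cpoly_subst \<kappa> y p)"
    have q: "q \<in> cpolys_in {..<d} \<and> cpoly_subst \<kappa> y q = cpoly_subst \<kappa> y p"
      unfolding q_def by (rule someI[of _ p]) (simp add: p)
    then have "q - p \<in> cpolys_in {..<d}" "cpoly_subst \<kappa> y (q - p) = 0"
      using P.diff_mem[of q p] p by (simp_all add: subst_diff)
    then have "q - p = 0" using assms unfolding alg_indep_def by blast
    then show ?thesis by (simp add: h_def flip: q_def)
  qed
  have "complex_point \<kappa> (generated \<kappa> d y) h"
  proof unfold_locales
    show "\<kappa> c \<in> generated \<kappa> d y" for c by (rule const_mem_generated)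
    show "h (\<kappa> c) = c" for c using h[OF cconst_mem_cpolys_in, of c] by (simp add: subst_const ceval.subst_const)
    fix u v assume "u \<in> generated \<kappa> d y" "v \<in> generated \<kappa> d y"
    then obtain p q where pq: "p \<in> cpolys_in {..<d}" "q \<in> cpolys_in {..<d}" "u = cpoly_subst \<kappa> y p" "v = cpoly_subst \<kappa> y q"
      by (auto simp: generated_def)
    show "h (u - v) = h u - h v"
      using h[OF P.diff_mem[OF pq(1,2)]] pq by (simp add: h subst_diff ceval.subst_diff)
    show "h (u * v) = h u * h v"
      using h[OF P.mult_mem[OF pq(1,2)]] pq by (simp add: h subst_mult ceval.subst_mult)
  qed
  then show ?thesis using that h by blast
qed

end

section \<open>Density of the image of a rational map\<close>

lemma pigeonhole_fiber:
  assumes "finite B" "f ` A \<subseteq> B" "card A > card B * k" "finite A"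
  obtains b where "card {a \<in> A. f a = b} > k"
proof (rule ccontr)
  assume "\<not> thesis"
  then have le: "card {a \<in> A. f a = b} \<le> k" for b using that not_le by blast
  have "card A \<le> card (\<Union>b\<in>B. {a \<in> A. f a = b})"
    using assms by (intro card_mono) auto
  also have "\<dots> \<le> (\<Sum>b\<in>B. card {a \<in> A. f a = b})" by (rule card_UN_le) fact
  also have "\<dots> \<le> card B * k" using sum_bounded_above[of B _ k] le by simp
  finally show False using assms(3) by simp
qed

text \<open>The modulus of a monic polynomial at \<open>z\<close> is the product of the distances
  from \<open>z\<close> to its roots; if all were at least \<open>\<eta>\<close>, so large would be
  the product.\<close>

lemma root_near_small_value:
  fixes p :: "complex poly"
  assumes "lead_coeff p = 1" "cmod (poly p z) < \<eta> ^ degree p" "\<eta> > 0"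
  obtains \<rho> where "poly p \<rho> = 0" "cmod (z - \<rho>) < \<eta>"
proof (rule ccontr)
  assume none: "\<not> thesis"
  note outer = that
  obtain R where R: "size R = degree p" "p = (\<Prod>x\<in>#R. [:-x, 1:])"
    using alg_closed_imp_factorization[of p] assms(1) by (metis leading_coeff_0_iff smult_1_left zero_neq_one)
  have far: "cmod (z - x) \<ge> \<eta>" if "x \<in># R" for x
  proof -
    have "poly p x = 0" unfolding R(2) using that by (auto simp: poly_prod_mset prod_mset_zero_iff)
    then show ?thesis using outer[of x] none by (meson not_le)
  qed
  have "cmod (poly (\<Prod>x\<in>#R'. [:-x, 1:]) z) \<ge> \<eta> ^ size R'" if "\<And>x. x \<in># R' \<Longrightarrow> cmod (z - x) \<ge> \<eta>" for R'
    using that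
  proof (induction R')
    case (add x R')
    have "\<eta> * \<eta> ^ size R' \<le> cmod (z - x) * cmod (poly (\<Prod>x\<in>#R'. [:-x, 1:]) z)"
      using add assms(3) by (intro mult_mono) auto
    also have "\<dots> = cmod (poly ([:-x, 1:] * (\<Prod>x\<in>#R'. [:-x, 1:])) z)"
      by (simp only: poly_mult norm_mult) simp
    finally show ?case by simp
  qed simp
  then have "cmod (poly p z) \<ge> \<eta> ^ degree p" using far R by metis
  then show False using assms(2) by simp
qed

text \<open>The \<open>\<delta> j\<close> are the coefficients of a polynomial in \<open>a\<close>
  of degree below \<open>k\<close>. Lagrange interpolation expresses them linearly through its
  values on \<open>Z\<close>, and one constant works because \<open>{..<K}\<close> has finitely many
  subsets.\<close>

lemma coeffs_small_if_values_small:
  fixes K k :: nat and \<epsilon> :: real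
  assumes "\<epsilon> > 0"
  obtains \<eta> where "\<eta> > 0" "\<And>Z \<delta>. Z \<subseteq> {..<K} \<Longrightarrow> card Z > k \<Longrightarrow>
    (\<And>a. a \<in> Z \<Longrightarrow> cmod (\<Sum>j<k. of_nat a ^ j * \<delta> j) < \<eta>) \<Longrightarrow> (\<And>j. j < k \<Longrightarrow> cmod (\<delta> j) < \<epsilon>)"
proof -
  define L :: "nat set \<Rightarrow> nat \<Rightarrow> complex poly" where
    "L Z a = smult (inverse (\<Prod>b\<in>Z-{a}. of_nat a - of_nat b)) (\<Prod>b\<in>Z-{a}. [:- of_nat b, 1:])" for Z a
  have L: "poly (L Z a) (of_nat b) = (if a = b then 1 else 0)" if "finite Z" "a \<in> Z" "b \<in> Z" for Z a b
    using that by (auto simp: L_def poly_prod prod_zero_iff)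
  have L_deg: "degree (L Z a) < card Z" if "finite Z" "a \<in> Z" for Z a
  proof -
    have "degree (\<Prod>b\<in>Z-{a}. [:- of_nat b, 1::complex:]) \<le> card (Z - {a})"
      using degree_prod_sum_le[of "Z - {a}" "\<lambda>b. [:- of_nat b, 1::complex:]"] that by simp
    also have "\<dots> < card Z" using that by (intro psubset_card_mono) auto
    finally show ?thesis unfolding L_def using degree_smult_le by (rule le_less_trans[rotated])
  qed
  define S where "S Z = (\<Sum>a\<in>Z. \<Sum>j<k. cmod (coeff (L Z a) j))" for Z
  \<comment> \<open>Dominates the interpolation coefficients for every admissible \<open>Z\<close>;
    the summand 1 makes \<open>C\<close> positive and the final inequality strict.\<close>
  define C where "C = 1 + (\<Sum>Z\<in>Pow {..<K}. S Z)"
  have S_nonneg: "S Z \<ge> 0" for Z by (auto simp: S_def intro!: sum_nonneg)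
  then have C: "C > 0" unfolding C_def by (intro add_pos_nonneg sum_nonneg) auto
  have "cmod (\<delta> j) < \<epsilon>"
    if Z: "Z \<subseteq> {..<K}" "card Z > k" and small: "\<And>a. a \<in> Z \<Longrightarrow> cmod (\<Sum>j<k. of_nat a ^ j * \<delta> j) < \<epsilon> / C" and j: "j < k"
    for Z \<delta> j
  proof -
    have fin: "finite Z" using Z(1) finite_subset by blast
    define p where "p = (\<Sum>j<k. monom (\<delta> j) j)"
    have val: "poly p (of_nat a) = (\<Sum>j<k. of_nat a ^ j * \<delta> j)" for a
      by (simp add: p_def poly_sum poly_monom mult.commute)
    have cz: "card Z > 0" using Z(2) by simp
    have "p = (\<Sum>a\<in>Z. smult (poly p (of_nat a)) (L Z a))" (is "_ = ?q")
    proof (rule poly_eqI_degree[of "of_nat ` Z"])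
      fix x :: complex assume "x \<in> of_nat ` Z"
      then obtain b where b: "b \<in> Z" "x = of_nat b" by blast
      have "poly ?q x = (\<Sum>a\<in>Z. if a = b then poly p (of_nat b) else 0)"
        unfolding poly_sum using L[OF fin _ b(1)] b by (intro sum.cong) auto
      then show "poly p x = poly ?q x" using b fin by simp
    next
      have c: "card (of_nat ` Z :: complex set) = card Z" by (rule card_image) (auto simp: inj_on_def)
      have "degree p \<le> k" unfolding p_def by (intro degree_sum_le) (auto intro: order_trans[OF degree_monom_le])
      then show "degree p < card (of_nat ` Z :: complex set)" using Z(2) c by simp
      have "degree ?q \<le> card Z - 1"
      proof (rule degree_sum_le[OF fin])
        fix a assume "a \<in> Z"
        then have "degree (L Z a) \<le> card Z - 1" using L_deg[OF fin] by fastforce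
        then show "degree (smult (poly p (of_nat a)) (L Z a)) \<le> card Z - 1"
          using degree_smult_le order_trans by blast
      qed
      then show "degree ?q < card (of_nat ` Z :: complex set)" using c cz by simp
    qed
    moreover have "coeff p j = \<delta> j" using j by (simp add: p_def coeff_sum sum.delta')
    ultimately have "\<delta> j = (\<Sum>a\<in>Z. poly p (of_nat a) * coeff (L Z a) j)"
      by (metis (no_types, lifting) coeff_smult coeff_sum sum.cong)
    then have "cmod (\<delta> j) \<le> (\<Sum>a\<in>Z. cmod (poly p (of_nat a)) * cmod (coeff (L Z a) j))"
      by (metis (no_types, lifting) norm_mult norm_sum sum.cong)
    also have "\<dots> \<le> (\<Sum>a\<in>Z. (\<epsilon> / C) * (\<Sum>j<k. cmod (coeff (L Z a) j)))"
      using small j assms C by (intro sum_mono mult_mono member_le_sum) (auto simp: val intro: less_imp_le)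
    also have "\<dots> = \<epsilon> / C * S Z" by (simp add: S_def sum_distrib_left)
    also have "\<dots> < \<epsilon> / C * C"
    proof -
      have "S Z \<le> (\<Sum>Z\<in>Pow {..<K}. S Z)" using S_nonneg Z(1) by (intro member_le_sum) auto
      then show ?thesis using assms C by (intro mult_strict_left_mono) (auto simp: C_def)
    qed
    finally show ?thesis using C by simp
  qed
  then show ?thesis using that[of "\<epsilon> / C"] C assms by auto
qed

section \<open>Simultaneous approximation of values by places\<close>

context complex_point
begin

lemma complex_field: "complex_field \<kappa>"
  by unfold_locales

text \<open>Division by \<open>P\<close> shows that every relation of \<open>s\<close> is a multiple
  of \<open>P\<close>, so each root of the reduction of \<open>P\<close> is an admissible value of
  \<open>s\<close>.\<close>

lemma extend_at_root:
  assumes P: "P \<in> polys_over A" "lead_coeff P = 1"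
      "\<forall>Q\<in>polys_over A. Q \<noteq> 0 \<longrightarrow> poly Q s = 0 \<longrightarrow> degree P \<le> degree Q" "poly P s = 0"
    and \<rho>: "poly (reduct P) \<rho> = 0"
  obtains V \<psi> where "complex_place \<kappa> V \<psi>" "A \<subseteq> V" "\<And>a. a \<in> A \<Longrightarrow> \<psi> a = h a" "s \<in> V" "\<psi> s = \<rho>"
proof -
  have "poly (reduct p) \<rho> = 0" if p: "p \<in> polys_over A" "poly p s = 0" for p
  proof -
    interpret PA: subring_set "polys_over A" by (rule subring_set_polys_over)
    obtain d r where dr: "d \<in> polys_over A" "r \<in> polys_over A" "p = P * d + r" "r = 0 \<or> degree r < degree P"
      using monic_division[OF p(1) P(1,2)] .
    have "poly r s = 0" using dr(3) p(2) P(4) by simp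
    then have "r = 0" using dr(2,4) P(3) by fastforce
    then have "reduct p = reduct P * reduct d" using dr P(1) by (simp add: reduct_mult)
    then show ?thesis using \<rho> by simp
  qed
  then obtain h' where h': "complex_point \<kappa> (adjoin A s) h'" "\<And>a. a \<in> A \<Longrightarrow> h' a = h a" "h' s = \<rho>"
    using extend_adjoin[of s \<rho>] by blast
  obtain V \<psi> where V: "complex_place \<kappa> V \<psi>" "adjoin A s \<subseteq> V" "\<And>a. a \<in> adjoin A s \<Longrightarrow> \<psi> a = h' a"
    using complex_point.extend_to_place[OF h'(1)] by metis
  show ?thesis
    by (rule that[OF V(1)]) (use V(2,3) h'(2,3) base_subset_adjoin gen_mem_adjoin in \<open>auto simp: subset_iff\<close>)
qed

text \<open>The image of a rational map is dense, in the Euclidean topology, in its Zariski closure. After a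
  Noether normalization the base point is moved along a line; the roots of the minimal polynomials of
  sufficiently many combinations \<open>\<Sum>\<^sub>j a\<^sup>j r\<^sub>j\<close> move continuously, and since only finitely many
  points lie over the new base point, one of them serves enough values of \<open>a\<close> to recover all
  the \<open>r\<^sub>j\<close>.\<close>

theorem place_near_point:
  assumes r: "\<And>j. j < k \<Longrightarrow> r j \<in> A" and \<epsilon>: "\<epsilon> > 0"
    and D: "D \<in> fracs (generated \<kappa> k r)" "D \<noteq> 0"
  obtains V \<psi> where "complex_place \<kappa> V \<psi>" "\<And>j. j < k \<Longrightarrow> r j \<in> V"
    "\<And>j. j < k \<Longrightarrow> cmod (\<psi> (r j) - h (r j)) < \<epsilon>" "D \<in> V" "\<psi> D \<noteq> 0"
proof -
  interpret CF: complex_field \<kappa> by (rule complex_field)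
  define S where "S = generated \<kappa> k r"
  obtain d y where dy: "alg_indep \<kappa> d y" "\<And>i. i < d \<Longrightarrow> y i \<in> S"
    "\<And>i. i < k \<Longrightarrow> integral_over (generated \<kappa> d y) (r i)"
    unfolding S_def using CF.noether_normalization[of k r] by metis
  define T where "T = generated \<kappa> d y"
  interpret S: subring_set S unfolding S_def by (rule subring_set_generated)
  interpret T: subring_set T unfolding T_def by (rule subring_set_generated)
  have cT: "\<kappa> c \<in> T" for c unfolding T_def by (rule const_mem_generated)
  have SA: "S \<subseteq> A" unfolding S_def using r const_mem by (intro generated_subset subring_set_axioms)
  have TS: "T \<subseteq> S" unfolding T_def
    using dy(2) const_mem_generated by (intro generated_subset S.subring_set_axioms) (auto simp: S_def)
  have cic: "completely_integrally_closed T"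
    unfolding T_def by (rule CF.completely_integrally_closed_generated) fact
  have intT: "integral_over T x" if "x \<in> S" for x
  proof -
    interpret I: subring_set "{x. integral_over T x}" by (rule subring_set_integral) (rule T.subring_set_axioms)
    have "S \<subseteq> {x. integral_over T x}"
      unfolding S_def using dy(3) cT T.integral_over_mem
      by (intro generated_subset I.subring_set_axioms) (auto simp: T_def)
    then show ?thesis using that by blast
  qed
  define b where "b i = h (y i)" for i
  obtain D1 D2 where D12: "D1 \<in> S" "D2 \<in> S" "D2 \<noteq> 0" "D = D1 / D2"
    using D(1) unfolding S_def fracs_def by blast
  have D': "D1 * D2 \<in> S" "D1 * D2 \<noteq> 0" using D12 D(2) by (auto intro: S.mult_mem)
  obtain PD where PD: "PD \<in> polys_over T" "lead_coeff PD = 1" "poly PD (D1 * D2) = 0"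
    "\<And>Q. Q \<in> polys_over T \<Longrightarrow> Q \<noteq> 0 \<Longrightarrow> poly Q (D1 * D2) = 0 \<Longrightarrow> degree PD \<le> degree Q"
    using monic_minimal_polynomial[OF T.subring_set_axioms cic intT[OF D'(1)]] by metis
  \<comment> \<open>This coefficient acts as a norm of \<open>D1 * D2\<close>: a place where it does
    not vanish cannot kill \<open>D1 * D2\<close>. Were it zero, dividing \<open>PD\<close> by
    \<open>X\<close> would give a relation of smaller degree.\<close>
  have t0: "coeff PD 0 \<noteq> 0"
  proof
    assume 0: "coeff PD 0 = 0"
    obtain c P' where P': "PD = pCons c P'" by (cases PD)
    then have "c = 0" "P' \<noteq> 0" using 0 PD(2) by auto
    moreover have "P' \<in> polys_over T"
      unfolding polys_over_def using P' PD(1) by (auto simp: polys_over_def) (metis coeff_pCons_Suc)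
    moreover have "poly P' (D1 * D2) = 0" using PD(3) P' \<open>c = 0\<close> D'(2) by simp
    ultimately have "degree PD \<le> degree P'" using PD(4) by blast
    then show False using P' \<open>P' \<noteq> 0\<close> by simp
  qed
  obtain \<tau> where \<tau>: "\<tau> \<in> cpolys_in {..<d}" "coeff PD 0 = cpoly_subst \<kappa> y \<tau>"
    using polys_overD[OF PD(1), of 0] unfolding T_def generated_def by blast
  then have "\<tau> \<noteq> 0" using t0 by auto
  then obtain c where c: "cpoly_eval c \<tau> \<noteq> 0" by (rule cpoly_nonzero_point)
  \<comment> \<open>From the old base point \<open>b\<close> towards a point \<open>c\<close> with
    nonzero norm. Along this line \<open>\<tau>\<close> is a nonzero polynomial in one variable, so
    it is nonzero at all parameters close to 0, apart from 0 itself.\<close>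
  define line where "line s i = b i + s * (c i - b i)" for s :: complex and i
  define along where "along p = cpoly_subst (\<lambda>c. [:c:]) (\<lambda>i. [:b i, c i - b i:]) p" for p :: "nat cpoly"
  have along: "poly (along p) s = cpoly_eval (line s) p" for p s
    unfolding along_def line_def
    by (subst hom_subst[of "\<lambda>q. poly q s"]) auto
  define minimal where "minimal x p \<longleftrightarrow> p \<in> polys_over T \<and> lead_coeff p = 1 \<and> poly p x = 0 \<and>
    (\<forall>Q\<in>polys_over T. Q \<noteq> 0 \<longrightarrow> poly Q x = 0 \<longrightarrow> degree p \<le> degree Q)" for x p
  define P where "P x = (SOME p. minimal x p)" for x
  have ex: "\<exists>p. minimal x p" if x: "x \<in> S" for x
  proof -
    obtain p where "p \<in> polys_over T" "lead_coeff p = 1" "poly p x = 0"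
      "\<And>Q. Q \<in> polys_over T \<Longrightarrow> Q \<noteq> 0 \<Longrightarrow> poly Q x = 0 \<Longrightarrow> degree p \<le> degree Q"
      using monic_minimal_polynomial[OF T.subring_set_axioms cic intT[OF x]] by metis
    then show ?thesis unfolding minimal_def by blast
  qed
  have Pm: "minimal x (P x)" if "x \<in> S" for x
    using someI_ex[OF ex[OF that]] by (simp only: P_def)
  have P1: "P x \<in> polys_over T" and P2: "lead_coeff (P x) = 1" and P3: "poly (P x) x = 0" if "x \<in> S" for x
    using Pm[OF that] by (simp_all add: minimal_def)
  have P4: "\<forall>Q\<in>polys_over T. Q \<noteq> 0 \<longrightarrow> poly Q x = 0 \<longrightarrow> degree (P x) \<le> degree Q" if "x \<in> S" for x
    using Pm[OF that] by (simp add: minimal_def)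
  note P = P1 P2 P3 P4
  have rS: "r j \<in> S" if "j < k" for j using that gen_mem_generated by (auto simp: S_def)
  \<comment> \<open>\<open>N\<close> bounds the number of value tuples of the \<open>r j\<close>
    above one base point. With \<open>K = N k + 1\<close> combinations, some tuple is shared by more
    than \<open>k\<close> of them.\<close>
  define N where "N = (\<Prod>j<k. degree (P (r j)))"
  define K where "K = Suc (N * k)"
  obtain \<eta> where \<eta>: "\<eta> > 0" "\<And>Z \<delta> j. Z \<subseteq> {..<K} \<Longrightarrow> card Z > k \<Longrightarrow>
    (\<And>a. a \<in> Z \<Longrightarrow> cmod (\<Sum>j<k. of_nat a ^ j * \<delta> j) < \<eta>) \<Longrightarrow> j < k \<Longrightarrow> cmod (\<delta> j) < \<epsilon>"
    using coeffs_small_if_values_small[OF \<epsilon>, where K = K and k = k] by blast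
  define s where "s a = (\<Sum>j<k. \<kappa> (of_nat a ^ j) * r j)" for a :: nat
  have sS: "s a \<in> S" for a
    unfolding s_def using rS cT TS by (intro S.sum_mem S.mult_mem) auto
  define \<sigma> where "\<sigma> a = (\<Sum>j<k. of_nat a ^ j * h (r j))" for a :: nat
  have \<sigma>: "h (s a) = \<sigma> a" for a
    unfolding s_def \<sigma>_def using r const_mem
    by (subst pt_sum) (auto simp: pt_mult pt_const intro!: mult_mem)
  have "\<exists>q. q \<in> cpolys_in {..<d} \<and> coeff (P (s a)) i = cpoly_subst \<kappa> y q" for a i
    using polys_overD[OF P(1)[OF sS[of a]], of i] unfolding T_def generated_def by blast
  then obtain q where q: "\<And>a i. q a i \<in> cpolys_in {..<d}" "\<And>a i. coeff (P (s a)) i = cpoly_subst \<kappa> y (q a i)"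
    by metis
  \<comment> \<open>The minimal polynomial of \<open>s a\<close>, specialized to the base point
    \<open>line z\<close> and evaluated at the old value \<open>\<sigma> a\<close>. It vanishes at
    \<open>z = 0\<close>, so small \<open>z\<close> force a root near
    \<open>\<sigma> a\<close>.\<close>
  define E where "E a z = (\<Sum>i\<le>degree (P (s a)). poly (along (q a i)) z * \<sigma> a ^ i)" for a z
  have E0: "E a 0 = 0" for a
  proof -
    have "h (coeff (P (s a)) i) = cpoly_eval b (q a i)" for i
      unfolding q(2) b_def by (rule pt_subst[OF q(1)]) (use dy(2) SA in auto)
    moreover have "line 0 = b" by (simp add: line_def fun_eq_iff)
    ultimately have "E a 0 = poly (reduct (P (s a))) (\<sigma> a)"
      by (simp add: E_def along poly_reduct[OF order_refl])
    also have "\<dots> = h (poly (P (s a)) (s a))"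
      using P(1)[OF sS[of a]] TS SA sS[of a] polys_over_mono[of T A] by (subst pt_poly) (auto simp: \<sigma>)
    finally show ?thesis using P(3)[OF sS] by (simp add: pt_0)
  qed
  have "\<forall>\<^sub>F z in at 0. cmod (E a z) < \<eta> ^ degree (P (s a))" for a
  proof -
    have "isCont (\<lambda>z. cmod (E a z)) 0" unfolding E_def by (intro continuous_intros)
    then have "((\<lambda>z. cmod (E a z)) \<longlongrightarrow> 0) (at 0)" using E0[of a] by (simp add: isCont_def)
    then show ?thesis using \<eta>(1) by (intro order_tendstoD) auto
  qed
  then have ev1: "\<forall>\<^sub>F z in at 0. \<forall>a\<in>{..<K}. cmod (E a z) < \<eta> ^ degree (P (s a))"
    by (intro eventually_ball_finite) auto
  have "along \<tau> \<noteq> 0"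
  proof
    assume "along \<tau> = 0"
    then have "cpoly_eval (line 1) \<tau> = 0" using along[of \<tau> 1] by simp
    moreover have "line 1 = c" by (simp add: line_def fun_eq_iff)
    ultimately show False using c by simp
  qed
  then have "finite {z. poly (along \<tau>) z = 0}" by (rule poly_roots_finite)
  then have "\<forall>\<^sub>F z in at 0. z \<notin> {z. poly (along \<tau>) z = 0}" using islimpt_finite islimpt_iff_eventually by blast
  then have "\<forall>\<^sub>F z in at 0. (\<forall>a\<in>{..<K}. cmod (E a z) < \<eta> ^ degree (P (s a))) \<and> poly (along \<tau>) z \<noteq> 0"
    using ev1 by eventually_elim auto
  then obtain z where z: "\<And>a. a < K \<Longrightarrow> cmod (E a z) < \<eta> ^ degree (P (s a))" "poly (along \<tau>) z \<noteq> 0"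
    using eventually_happens'[OF at_neq_bot] by fastforce
  obtain g where g: "complex_point \<kappa> T g" "\<And>p. p \<in> cpolys_in {..<d} \<Longrightarrow> g (cpoly_subst \<kappa> y p) = cpoly_eval (line z) p"
    unfolding T_def using CF.alg_indep_point[OF dy(1), of "line z"] by metis
  interpret g: complex_point \<kappa> T g by fact
  have Eg: "poly (g.reduct (P (s a))) (\<sigma> a) = E a z" for a
    unfolding g.poly_reduct[OF order_refl] E_def along by (simp add: q g(2))
  have reduct_monic: "lead_coeff (g.reduct (P x)) = 1 \<and> degree (g.reduct (P x)) = degree (P x)" if "x \<in> S" for x
  proof -
    have *: "coeff (g.reduct (P x)) (degree (P x)) = 1"
      using P(2)[OF that] by (simp add: g.coeff_reduct g.pt_1)
    have "degree (g.reduct (P x)) \<le> degree (P x)" by (rule degree_map_poly_le)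
    then have "degree (g.reduct (P x)) = degree (P x)" using le_degree[of "g.reduct (P x)" "degree (P x)"] * by simp
    then show ?thesis using * by simp
  qed
  \<comment> \<open>A place above the new base point where the single combination \<open>s a\<close>
    is close to its old value; different \<open>a\<close> may yield different places.\<close>
  define near where "near a x \<longleftrightarrow> complex_place \<kappa> (fst x) (snd x) \<and> T \<subseteq> fst x \<and>
    (\<forall>u\<in>T. snd x u = g u) \<and> cmod (\<sigma> a - snd x (s a)) < \<eta>" for a and x :: "'a set \<times> ('a \<Rightarrow> complex)"
  have ex_near: "\<exists>x. near a x" if a: "a < K" for a
  proof -
    have "cmod (poly (g.reduct (P (s a))) (\<sigma> a)) < \<eta> ^ degree (g.reduct (P (s a)))"
      using z(1)[OF a] reduct_monic[OF sS] by (simp add: Eg)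
    then obtain \<rho> where \<rho>: "poly (g.reduct (P (s a))) \<rho> = 0" "cmod (\<sigma> a - \<rho>) < \<eta>"
      using root_near_small_value[OF conjunct1[OF reduct_monic[OF sS]] _ \<eta>(1)] by metis
    obtain V \<psi> where "complex_place \<kappa> V \<psi>" "T \<subseteq> V" "\<And>x. x \<in> T \<Longrightarrow> \<psi> x = g x" "\<psi> (s a) = \<rho>"
      using g.extend_at_root[OF P(1)[OF sS] P(2)[OF sS] P(4)[OF sS] P(3)[OF sS] \<rho>(1)] by metis
    then have "near a (V, \<psi>)" using \<rho>(2) by (simp add: near_def)
    then show ?thesis by blast
  qed
  define V where "V a = fst (SOME x. near a x)" for a
  define \<psi> where "\<psi> a = snd (SOME x. near a x)" for a
  have V: "complex_place \<kappa> (V a) (\<psi> a)" "T \<subseteq> V a" "cmod (\<sigma> a - \<psi> a (s a)) < \<eta>"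
    and \<psi>: "\<And>x. x \<in> T \<Longrightarrow> \<psi> a x = g x" if "a < K" for a
    using someI_ex[OF ex_near[OF that]] by (simp_all add: near_def V_def \<psi>_def)
  have SV: "S \<subseteq> V a" if "a < K" for a
    using intT integral_over_mono[OF V(2)[OF that]] complex_place.integral_mem[OF V(1)[OF that]] by blast
  have root: "poly (g.reduct (P x)) (\<psi> a x) = 0" if a: "a < K" and x: "x \<in> S" for a x
  proof -
    interpret pl: complex_place \<kappa> "V a" "\<psi> a" by (rule V(1)[OF a])
    have "P x \<in> polys_over (V a)" using P(1)[OF x] polys_over_mono[OF V(2)[OF a]] by blast
    then have "poly (pl.reduct (P x)) (\<psi> a x) = \<psi> a 0" using pl.pt_poly[of "P x" x] SV[OF a] x P(3)[OF x] by auto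
    moreover have "pl.reduct (P x) = g.reduct (P x)"
      by (rule poly_eqI) (simp add: pl.coeff_reduct g.coeff_reduct \<psi>[OF a] polys_overD[OF P(1)[OF x]])
    ultimately show ?thesis by (simp add: pl.pt_0)
  qed
  \<comment> \<open>Above the new base point each \<open>r j\<close> has one of finitely many
    values, the roots of its specialized minimal polynomial; \<open>f a\<close> records the tuple at
    the place chosen for \<open>a\<close>.\<close>
  define B where "B = PiE {..<k} (\<lambda>j. {w. poly (g.reduct (P (r j))) w = 0})"
  define f where "f a = restrict (\<lambda>j. \<psi> a (r j)) {..<k}" for a
  have rt: "finite {w. poly (g.reduct (P (r j))) w = 0}"
    "card {w. poly (g.reduct (P (r j))) w = 0} \<le> degree (P (r j))" if "j < k" for j
  proof -
    have nz: "g.reduct (P (r j)) \<noteq> 0" using reduct_monic[OF rS[OF that]] by auto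
    show "finite {w. poly (g.reduct (P (r j))) w = 0}" using nz by (rule poly_roots_finite)
    show "card {w. poly (g.reduct (P (r j))) w = 0} \<le> degree (P (r j))"
      using card_poly_roots_bound[OF nz] reduct_monic[OF rS[OF that]] by simp
  qed
  have finB: "finite B" unfolding B_def using rt(1) by (intro finite_PiE) auto
  have "card B \<le> N"
    unfolding B_def N_def using rt(2) by (subst card_PiE) (auto intro: prod_mono)
  then have "card {..<K} > card B * k" unfolding K_def by (simp add: less_Suc_eq_le mult_le_mono1)
  moreover have "f ` {..<K} \<subseteq> B" unfolding f_def B_def using root rS
    by (simp add: image_subset_iff restrict_PiE_iff)
  ultimately obtain w where w: "card {a \<in> {..<K}. f a = w} > k"
    using pigeonhole_fiber[OF finB, of f "{..<K}" k] by auto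
  define Z where "Z = {a \<in> {..<K}. f a = w}"
  have "Z \<noteq> {}" using w unfolding Z_def by (metis card.empty not_less0)
  then obtain a0 where a0: "a0 < K" "f a0 = w" unfolding Z_def by blast
  interpret pl: complex_place \<kappa> "V a0" "\<psi> a0" by (rule V(1)[OF a0(1)])
  have near: "cmod (\<psi> a0 (r j) - h (r j)) < \<epsilon>" if j: "j < k" for j
  proof -
    \<comment> \<open>For \<open>a\<close> in the fibre \<open>Z\<close> the places of
      \<open>a\<close> and \<open>a0\<close> agree on all \<open>r j\<close>, so the estimate for
      \<open>s a\<close> transfers to the one place \<open>\<psi> a0\<close>.\<close>
    have "cmod (\<Sum>j<k. of_nat a ^ j * (\<psi> a0 (r j) - h (r j))) < \<eta>" if a: "a \<in> Z" for a
    proof -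
      have aK: "a < K" "f a = f a0" using a a0 by (auto simp: Z_def)
      interpret pa: complex_place \<kappa> "V a" "\<psi> a" by (rule V(1)[OF aK(1)])
      have rV: "r j \<in> V a" if "j < k" for j using SV[OF aK(1)] rS[OF that] by blast
      have same: "\<psi> a (r j) = \<psi> a0 (r j)" if "j < k" for j
        using fun_cong[OF aK(2), of j] that by (simp add: f_def)
      have "\<psi> a (s a) = (\<Sum>j<k. of_nat a ^ j * \<psi> a (r j))"
        unfolding s_def using rV
        by (subst pa.pt_sum) (auto simp: pa.pt_mult pa.pt_const pa.const_mem intro!: pa.mult_mem)
      also have "\<dots> = (\<Sum>j<k. of_nat a ^ j * \<psi> a0 (r j))"
        using same by simp
      finally have "(\<Sum>j<k. of_nat a ^ j * (\<psi> a0 (r j) - h (r j))) = - (\<sigma> a - \<psi> a (s a))"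
        by (simp add: \<sigma>_def right_diff_distrib sum_subtractf)
      then show ?thesis using V(3)[OF aK(1)] by (simp only: norm_minus_cancel)
    qed
    moreover have "card Z > k" "Z \<subseteq> {..<K}" using w by (auto simp: Z_def)
    ultimately show ?thesis using \<eta>(2)[of Z "\<lambda>j. \<psi> a0 (r j) - h (r j)" j] j by blast
  qed
  have SV0: "S \<subseteq> V a0" by (rule SV[OF a0(1)])
  have PDV: "PD \<in> polys_over (V a0)" using PD(1) polys_over_mono[OF V(2)[OF a0(1)]] by blast
  \<comment> \<open>The value 0 would be a root of the specialized \<open>PD\<close> and would force
    \<open>\<tau>\<close> to vanish at \<open>line z\<close>.\<close>
  have "\<psi> a0 (D1 * D2) \<noteq> 0"
  proof
    assume 0: "\<psi> a0 (D1 * D2) = 0"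
    have "poly (pl.reduct PD) (\<psi> a0 (D1 * D2)) = 0"
      using pl.pt_poly[OF PDV, of "D1 * D2"] D'(1) SV0 PD(3) by (auto simp: pl.pt_0)
    then have "\<psi> a0 (coeff PD 0) = 0" using 0 by (simp add: poly_0_coeff_0 pl.coeff_reduct)
    moreover have "\<psi> a0 (coeff PD 0) = cpoly_eval (line z) \<tau>"
      using \<psi>[OF a0(1) polys_overD[OF PD(1), of 0]] g(2)[OF \<tau>(1)]
      unfolding \<tau>(2)[symmetric] by (rule trans)
    ultimately show False using z(2) along by simp
  qed
  moreover have "D1 \<in> V a0" "D2 \<in> V a0" using D12 SV0 by auto
  ultimately have nz: "\<psi> a0 D1 \<noteq> 0" "\<psi> a0 D2 \<noteq> 0" by (auto simp: pl.pt_mult)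
  then have inv: "inverse D2 \<in> V a0" using \<open>D2 \<in> V a0\<close> by (intro pl.inverse_mem)
  then have "D \<in> V a0" "\<psi> a0 D \<noteq> 0"
    using \<open>D1 \<in> V a0\<close> \<open>D2 \<in> V a0\<close> nz D12(3) pl.pt_inverse[OF \<open>D2 \<in> V a0\<close> inv]
    by (auto simp: D12(4) divide_inverse pl.pt_mult intro: pl.mult_mem)
  then show ?thesis using that[OF pl.complex_place_axioms] near SV0 rS by blast
qed

end

section \<open>Ideals and localizations of subrings\<close>

text \<open>\<open>inv_mod\<close> says elementwise that the quotient is a field, the form of
  maximality that the calculations use.\<close>

locale maximal_ideal_set = subring_set B for B :: "'a::comm_ring_1 set" +
  fixes M :: "'a set"
  assumes sub: "M \<subseteq> B"
    and ideal_diff: "x \<in> M \<Longrightarrow> y \<in> M \<Longrightarrow> x - y \<in> M"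
    and ideal_mult: "x \<in> M \<Longrightarrow> b \<in> B \<Longrightarrow> b * x \<in> M"
    and ideal_0: "0 \<in> M"
    and proper: "1 \<notin> M"
    and inv_mod: "b \<in> B \<Longrightarrow> b \<notin> M \<Longrightarrow> \<exists>c\<in>B. 1 - b * c \<in> M"
begin

lemma ideal_add: "x \<in> M \<Longrightarrow> y \<in> M \<Longrightarrow> x + y \<in> M"
  using ideal_diff[of x "0 - y"] ideal_diff[OF ideal_0, of y] by simp

lemma ideal_sum: "(\<And>i. i \<in> I \<Longrightarrow> f i \<in> M) \<Longrightarrow> sum f I \<in> M"
  by (induction I rule: infinite_finite_induct) (auto intro: ideal_0 ideal_add)

lemma prime:
  assumes "a \<in> B" "b \<in> B" "a * b \<in> M" "a \<notin> M"
  shows "b \<in> M"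
proof -
  obtain c where c: "c \<in> B" "1 - a * c \<in> M" using inv_mod assms by blast
  have "b * (1 - a * c) + c * (a * b) \<in> M" 
    by (rule ideal_add[OF ideal_mult[OF c(2) assms(2)] ideal_mult[OF assms(3) c(1)]])
  then show ?thesis by (simp add: algebra_simps)
qed

lemma mult_notin: "a \<in> B - M \<Longrightarrow> b \<in> B - M \<Longrightarrow> a * b \<in> B - M"
  using prime mult_mem by blast

lemma prod_notin: "(\<And>i. i \<in> I \<Longrightarrow> f i \<in> B - M) \<Longrightarrow> prod f I \<in> B - M"
  by (induction I rule: infinite_finite_induct) (use one_mem proper mult_notin in auto)

end

lemma cring_subring_of:
  assumes "subring_set S"
  shows "cring (subring_of S)"
proof -
  interpret subring_set S by fact
  show ?thesis
  proof (rule cringI)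
    show "abelian_group (subring_of S)"
    proof (rule abelian_groupI)
      fix x assume "x \<in> carrier (subring_of S)"
      then show "\<exists>y\<in>carrier (subring_of S). y \<oplus>\<^bsub>subring_of S\<^esub> x = \<zero>\<^bsub>subring_of S\<^esub>"
        by (intro bexI[of _ "- x"]) (auto simp: subring_of_def uminus_mem)
    qed (auto simp: subring_of_def add_mem zero_mem add_ac)
    show "comm_monoid (subring_of S)"
      by (rule comm_monoidI) (auto simp: subring_of_def mult_mem one_mem mult_ac)
  qed (auto simp: subring_of_def algebra_simps)
qed

lemma subring_of_simps [simp]:
  "carrier (subring_of S) = S" "x \<otimes>\<^bsub>subring_of S\<^esub> y = x * y" "x \<oplus>\<^bsub>subring_of S\<^esub> y = x + y"
  "\<one>\<^bsub>subring_of S\<^esub> = 1" "\<zero>\<^bsub>subring_of S\<^esub> = 0"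
  by (simp_all add: subring_of_def)

lemma a_inv_subring_of:
  assumes "subring_set S" "x \<in> S"
  shows "\<ominus>\<^bsub>subring_of S\<^esub> x = - x"
proof -
  interpret subring_set S by fact
  interpret R: cring "subring_of S" by (rule cring_subring_of) fact
  show ?thesis by (rule R.minus_equality) (use assms in \<open>auto simp: uminus_mem\<close>)
qed

lemma ideal_subring_of_iff:
  assumes "subring_set S"
  shows "ideal J (subring_of S) \<longleftrightarrow>
    J \<subseteq> S \<and> 0 \<in> J \<and> (\<forall>x\<in>J. \<forall>y\<in>J. x - y \<in> J) \<and> (\<forall>x\<in>J. \<forall>s\<in>S. s * x \<in> J)"
    (is "_ \<longleftrightarrow> ?rhs")
proof
  interpret subring_set S by fact
  interpret R: cring "subring_of S" by (rule cring_subring_of) fact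
  assume "ideal J (subring_of S)"
  then interpret J: ideal J "subring_of S" .
  have JS: "J \<subseteq> S" using J.a_subset by simp
  have "x - y \<in> J" if "x \<in> J" "y \<in> J" for x y
  proof -
    have "\<ominus>\<^bsub>subring_of S\<^esub> y \<in> J" using that(2) by (rule J.a_inv_closed)
    moreover have "y \<in> S" using that(2) JS by blast
    ultimately have "- y \<in> J" by (simp add: a_inv_subring_of[OF assms])
    from J.a_closed[OF that(1) this] show ?thesis by simp
  qed
  then show ?rhs using JS J.zero_closed J.I_l_closed by auto
next
  interpret subring_set S by fact
  interpret R: cring "subring_of S" by (rule cring_subring_of) fact
  assume r: ?rhs
  have neg: "- x \<in> J" if "x \<in> J" for x
  proof -
    have "0 - x \<in> J" using r that by blast
    then show ?thesis by simp
  qed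
  show "ideal J (subring_of S)"
  proof (rule idealI)
    show "ring (subring_of S)" by (rule R.ring_axioms)
    show "subgroup J (add_monoid (subring_of S))"
    proof (rule group.subgroupI)
      show "group (add_monoid (subring_of S))" by (rule R.a_group)
      show "J \<subseteq> carrier (add_monoid (subring_of S))" "J \<noteq> {}" using r by auto
      show "inv\<^bsub>add_monoid (subring_of S)\<^esub> a \<in> J" if "a \<in> J" for a
        using a_inv_subring_of[OF assms, of a] r neg that by (auto simp: a_inv_def)
      show "a \<otimes>\<^bsub>add_monoid (subring_of S)\<^esub> b \<in> J" if "a \<in> J" "b \<in> J" for a b
      proof -
        have "a - (- b) \<in> J" using r neg that by blast
        then show ?thesis by simp
      qed
    qed
  qed (use r in \<open>auto simp: mult.commute\<close>)
qed

lemma maximalideal_subring_of_iff: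
  assumes "subring_set B"
  shows "maximalideal M (subring_of B) \<longleftrightarrow> maximal_ideal_set B M"
proof
  interpret subring_set B by fact
  assume "maximalideal M (subring_of B)"
  then interpret M: maximalideal M "subring_of B" .
  have I: "M \<subseteq> B" "0 \<in> M" "\<And>x y. x \<in> M \<Longrightarrow> y \<in> M \<Longrightarrow> x - y \<in> M" "\<And>x s. x \<in> M \<Longrightarrow> s \<in> B \<Longrightarrow> s * x \<in> M"
    using M.is_ideal unfolding ideal_subring_of_iff[OF assms] by blast+
  show "maximal_ideal_set B M"
  proof unfold_locales
    show "1 \<notin> M" using M.one_imp_carrier M.I_notcarr by auto
    fix b assume b: "b \<in> B" "b \<notin> M"
    \<comment> \<open>The ideal generated by \<open>M\<close> and \<open>b\<close>; by maximality it
      is all of \<open>B\<close> and so contains 1.\<close>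
    define J where "J = {x + b * c | x c. x \<in> M \<and> c \<in> B}"
    have "ideal J (subring_of B)"
      unfolding ideal_subring_of_iff[OF assms]
    proof (intro conjI ballI)
      show "J \<subseteq> B" unfolding J_def using I b by (auto intro!: add_mem mult_mem)
      have "0 + b * 0 \<in> J" unfolding J_def using I zero_mem by blast
      then show "0 \<in> J" by simp
    next
      fix x y assume "x \<in> J" "y \<in> J"
      then obtain x1 c1 x2 c2 where *: "x = x1 + b * c1" "y = x2 + b * c2" "x1 \<in> M" "x2 \<in> M" "c1 \<in> B" "c2 \<in> B"
        unfolding J_def by blast
      have "x - y = (x1 - x2) + b * (c1 - c2)" by (simp add: * algebra_simps)
      moreover have "x1 - x2 \<in> M" "c1 - c2 \<in> B" using I(3) * diff_mem by auto
      ultimately show "x - y \<in> J" unfolding J_def by blast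
    next
      fix x s assume "x \<in> J" "s \<in> B"
      then obtain x1 c1 where *: "x = x1 + b * c1" "x1 \<in> M" "c1 \<in> B" unfolding J_def by blast
      have "s * x = s * x1 + b * (s * c1)" by (simp add: * algebra_simps)
      moreover have "s * x1 \<in> M" "s * c1 \<in> B" using I(4) * \<open>s \<in> B\<close> mult_mem by auto
      ultimately show "s * x \<in> J" unfolding J_def by blast
    qed
    moreover have "M \<subseteq> J"
    proof
      fix x assume "x \<in> M"
      then have "x + b * 0 \<in> J" unfolding J_def using zero_mem by blast
      then show "x \<in> J" by simp
    qed
    moreover have "J \<subseteq> B" unfolding J_def using I b by (auto intro!: add_mem mult_mem)
    moreover have "b \<in> J"
    proof -
      have "0 + b * 1 \<in> J" unfolding J_def using I one_mem by blast
      then show ?thesis by simp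
    qed
    ultimately have "J = B" using M.I_maximal[of J] b(2) by auto
    then have "1 \<in> J" using one_mem by (rule ssubst)
    then obtain x c where *: "1 = x + b * c" "x \<in> M" "c \<in> B" unfolding J_def by blast
    then have "1 - b * c = x" by (metis add_diff_cancel_right')
    then show "\<exists>c\<in>B. 1 - b * c \<in> M" using * by blast
  qed (use I in auto)
next
  assume "maximal_ideal_set B M"
  then interpret maximal_ideal_set B M .
  show "maximalideal M (subring_of B)"
  proof (rule maximalidealI)
    show "ideal M (subring_of B)"
      unfolding ideal_subring_of_iff[OF assms] using sub ideal_0 ideal_diff ideal_mult by blast
    show "carrier (subring_of B) \<noteq> M" using one_mem proper by auto
    fix J assume J: "ideal J (subring_of B)" "M \<subseteq> J" "J \<subseteq> carrier (subring_of B)"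
    note J' = J(1)[unfolded ideal_subring_of_iff[OF assms]]
    show "J = M \<or> J = carrier (subring_of B)"
    proof (rule disjCI)
      assume "J \<noteq> carrier (subring_of B)"
      then have n1: "1 \<notin> J"
      proof (rule contrapos_nn)
        assume "1 \<in> J"
        then have "b * 1 \<in> J" if "b \<in> B" for b using J' that by blast
        then show "J = carrier (subring_of B)" using J(3) by auto
      qed
      have "b \<in> M" if bJ: "b \<in> J" for b
      proof (rule ccontr)
        assume bM: "b \<notin> M"
        have bB: "b \<in> B" using J(3) bJ by auto
        obtain c where c: "c \<in> B" "1 - b * c \<in> M" using inv_mod[OF bB bM] by blast
        have J1: "\<And>x y. x \<in> J \<Longrightarrow> y \<in> J \<Longrightarrow> x - y \<in> J" "\<And>x s. x \<in> J \<Longrightarrow> s \<in> B \<Longrightarrow> s * x \<in> J" "0 \<in> J"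
          using J' by auto
        have "(1 - b * c) - (0 - c * b) \<in> J"
          by (rule J1(1)[OF subsetD[OF J(2) c(2)] J1(1)[OF J1(3) J1(2)[OF bJ c(1)]]])
        then show False using n1 by (simp add: mult.commute)
      qed
      then show "J = M" using J(2) by blast
    qed
  qed
qed

text \<open>To be applied with \<open>A\<close> the local ring of the closure at a point,
  \<open>B\<close> its normalization and \<open>M\<close> a point of the normalization above
  it.\<close>

locale integral_maximal = complex_point \<kappa> A e + M: maximal_ideal_set B M
  for \<kappa> :: "complex \<Rightarrow> 'a::field" and A e B M +
  assumes loc: "a \<in> A \<Longrightarrow> e a \<noteq> 0 \<Longrightarrow> inverse a \<in> A"
    and AB: "A \<subseteq> B"
    and int: "b \<in> B \<Longrightarrow> integral_over A b"
begin

text \<open>\<open>M\<close> lies over the maximal ideal of the local ring \<open>A\<close>.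
  Otherwise some \<open>a\<close> of value 0 would have an inverse \<open>y\<close> modulo
  \<open>M\<close>, and integrality of \<open>y\<close> would put a unit of \<open>A\<close> into
  \<open>M\<close>.\<close>

lemma mem_M_iff:
  assumes a: "a \<in> A"
  shows "a \<in> M \<longleftrightarrow> e a = 0"
proof
  assume "a \<in> M"
  show "e a = 0"
  proof (rule ccontr)
    assume "e a \<noteq> 0"
    then have "inverse a * a \<in> M" using loc[OF a] AB \<open>a \<in> M\<close> by (intro M.ideal_mult) auto
    moreover have "a \<noteq> 0" using \<open>e a \<noteq> 0\<close> pt_0 by auto
    ultimately show False using M.proper by simp
  qed
next
  assume ea: "e a = 0"
  show "a \<in> M"
  proof (rule ccontr)
    assume "a \<notin> M"
    then obtain y where y: "y \<in> B" "1 - a * y \<in> M" using M.inv_mod a AB by blast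
    obtain p where p: "p \<in> polys_over A" "lead_coeff p = 1" "poly p y = 0"
      using int[OF y(1)] by (auto simp: integral_over_def)
    define N where "N = degree p"
    have pw: "1 - (a * y) ^ i \<in> M" for i
    proof (induction i)
      case (Suc i)
      have "(a * y) ^ i * (1 - a * y) + (1 - (a * y) ^ i) \<in> M"
        using y a AB Suc by (intro M.ideal_add M.ideal_mult M.power_mem M.mult_mem) auto
      then show ?case by (simp add: algebra_simps)
    qed (simp add: M.ideal_0)
    \<comment> \<open>This is \<open>a^N p(y) = 0\<close> with every power of \<open>a y\<close>
      replaced by 1, hence an element of \<open>M\<close>. Since \<open>e a = 0\<close> only its top
      term survives under \<open>e\<close>, so \<open>e t = 1\<close> and \<open>t\<close> is a
      unit.\<close>
    define t where "t = (\<Sum>i\<le>N. coeff p i * a ^ (N - i))"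
    have tA: "t \<in> A" unfolding t_def using p(1) a by (intro sum_mem mult_mem power_mem) (auto intro: polys_overD)
    have "t = t - a ^ N * poly p y" using p(3) by simp
    also have "a ^ N * poly p y = (\<Sum>i\<le>N. coeff p i * a ^ (N - i) * (a * y) ^ i)"
      unfolding poly_altdef N_def[symmetric] sum_distrib_left
      by (intro sum.cong refl) (simp add: power_mult_distrib mult_ac flip: power_add)
    also have "t - \<dots> = (\<Sum>i\<le>N. (coeff p i * a ^ (N - i)) * (1 - (a * y) ^ i))"
      unfolding t_def by (simp add: sum_subtractf right_diff_distrib)
    also have "\<dots> \<in> M"
      using pw p(1) a AB by (intro M.ideal_sum M.ideal_mult M.mult_mem M.power_mem) (auto intro: polys_overD)
    finally have tM: "t \<in> M" .
    have "e t = (\<Sum>i\<le>N. e (coeff p i) * 0 ^ (N - i))"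
      unfolding t_def using p(1) a ea
      by (subst pt_sum) (auto simp: pt_mult pt_power power_mem polys_overD intro!: mult_mem)
    also have "\<dots> = (\<Sum>i\<le>N. if i = N then 1 else 0)"
      using p(2) by (intro sum.cong) (auto simp: N_def pt_1)
    finally have et: "e t = 1" by simp
    then have "inverse t * t \<in> M" using loc[OF tA] AB tM by (intro M.ideal_mult) auto
    moreover have "t \<noteq> 0" using et pt_0 by auto
    ultimately show False using M.proper by simp
  qed
qed

lemma const_mem_B: "\<kappa> c \<in> B"
  using const_mem AB by blast

lemma const_mem_M_iff: "\<kappa> c \<in> M \<longleftrightarrow> c = 0"
  using mem_M_iff[OF const_mem] by (simp add: pt_const)

text \<open>The reduction of a monic relation of \<open>b\<close> splits over \<complex>, so a
  product of factors \<open>b - \<kappa> c\<close> lies in \<open>M\<close>, and primality selects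
  one of them. This makes \<complex> the residue field.\<close>

lemma ex_residue:
  assumes b: "b \<in> B"
  shows "\<exists>!c. b - \<kappa> c \<in> M"
proof (rule ex_ex1I)
  obtain p where p: "p \<in> polys_over A" "lead_coeff p = 1" "poly p b = 0"
    using int[OF b] by (auto simp: integral_over_def)
  have "coeff (reduct p) (degree p) = 1" using p(2) by (simp add: coeff_reduct pt_1)
  moreover have "degree (reduct p) \<le> degree p" by (rule degree_map_poly_le)
  ultimately have lead: "lead_coeff (reduct p) = 1"
    using le_degree[of "reduct p" "degree p"] by (metis antisym zero_neq_one)
  then obtain R where R: "reduct p = (\<Prod>c\<in>#R. [:-c, 1:])"
    using alg_closed_imp_factorization[of "reduct p"] by (metis leading_coeff_0_iff smult_1_left zero_neq_one)
  let ?q = "map_poly \<kappa> (reduct p)"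
  have q: "coeff p i - coeff ?q i \<in> M" for i
  proof -
    have "coeff p i \<in> A" "coeff ?q i = \<kappa> (e (coeff p i))"
      using p(1) by (auto simp: polys_overD coeff_map_poly const_0 coeff_reduct)
    then show ?thesis
      by (subst mem_M_iff) (auto simp: const_mem pt_diff pt_const intro: diff_mem)
  qed
  have "poly p b - poly ?q b = (\<Sum>i\<le>degree p. (coeff p i - coeff ?q i) * b ^ i)"
  proof -
    have "poly ?q b = (\<Sum>i\<le>degree p. coeff ?q i * b ^ i)"
    proof -
      have "degree ?q \<le> degree p" 
        by (rule order_trans[OF degree_map_poly_le[of \<kappa>] degree_map_poly_le[of e]])
      then show ?thesis unfolding poly_altdef
        by (intro sum.mono_neutral_left) (auto simp: coeff_eq_0)
    qed
    then show ?thesis by (simp add: poly_altdef left_diff_distrib sum_subtractf)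
  qed
  also have "\<dots> \<in> M"
  proof (rule M.ideal_sum)
    fix i
    have "b ^ i * (coeff p i - coeff ?q i) \<in> M" by (rule M.ideal_mult[OF q M.power_mem[OF b]])
    then show "(coeff p i - coeff ?q i) * b ^ i \<in> M" by (simp add: mult.commute)
  qed
  finally have "0 - poly ?q b \<in> M" using p(3) by simp
  from M.ideal_diff[OF M.ideal_0 this] have qM: "poly ?q b \<in> M" by simp
  have split: "poly (map_poly \<kappa> (\<Prod>c\<in>#R. [:-c, 1:])) b = (\<Prod>c\<in>#R. b - \<kappa> c)" for R
  proof (induction R)
    case (add c R)
    have "map_poly \<kappa> ([:-c, 1:] * q) = [:- \<kappa> c, 1:] * map_poly \<kappa> q" for q
      by (rule poly_eqI)
        (simp add: coeff_map_poly const_0 coeff_pCons const_diff const_mult const_add const_uminus split: nat.split)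
    then show ?case using add by (simp add: left_diff_distrib)
  qed (simp add: const_1)
  have "\<exists>c\<in>#R. b - \<kappa> c \<in> M" if "(\<Prod>c\<in>#R. b - \<kappa> c) \<in> M" for R
    using that
  proof (induction R)
    case empty
    then show ?case using M.proper by simp
  next
    case (add c R)
    have B: "(\<Prod>c\<in>#R. b - \<kappa> c) \<in> B"
      by (induction R) (auto intro!: M.mem_intros b const_mem_B)
    have "b - \<kappa> c \<in> B" using b const_mem_B by (intro M.mem_intros)
    then have "b - \<kappa> c \<in> M \<or> (\<Prod>c\<in>#R. b - \<kappa> c) \<in> M" using M.prime[OF _ B] add.prems by auto
    then show ?case using add.IH by auto
  qed
  then show "\<exists>c. b - \<kappa> c \<in> M" using qM unfolding R split by blast
next
  fix c d assume "b - \<kappa> c \<in> M" "b - \<kappa> d \<in> M"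
  then have "(b - \<kappa> c) - (b - \<kappa> d) \<in> M" by (rule M.ideal_diff)
  then have "\<kappa> (d - c) \<in> M" by (simp add: const_diff)
  then show "c = d" by (simp add: const_mem_M_iff)
qed

definition residue :: "'a \<Rightarrow> complex" where
  "residue b = (THE c. b - \<kappa> c \<in> M)"

lemma residue: "b \<in> B \<Longrightarrow> b - \<kappa> (residue b) \<in> M"
  unfolding residue_def by (rule theI') (rule ex_residue)

lemma residue_eqI: "b \<in> B \<Longrightarrow> b - \<kappa> c \<in> M \<Longrightarrow> residue b = c"
  using ex_residue residue by blast

lemma residue_eq_0_iff: "b \<in> B \<Longrightarrow> residue b = 0 \<longleftrightarrow> b \<in> M"
  using residue[of b] residue_eqI[of b 0] by (auto simp: const_0)

lemma residue_base: "a \<in> A \<Longrightarrow> residue a = e a"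
proof (rule residue_eqI)
  assume a: "a \<in> A"
  then show "a \<in> B" using AB by blast
  show "a - \<kappa> (e a) \<in> M"
    using a by (subst mem_M_iff) (auto simp: const_mem pt_diff pt_const intro: diff_mem)
qed

sublocale res: complex_point \<kappa> B residue
proof unfold_locales
  show "\<kappa> c \<in> B" for c by (rule const_mem_B)
  show "residue (\<kappa> c) = c" for c by (rule residue_eqI) (auto simp: const_mem_B M.ideal_0)
  fix x y assume xy: "x \<in> B" "y \<in> B"
  have "(x - \<kappa> (residue x)) - (y - \<kappa> (residue y)) \<in> M" 
    by (rule M.ideal_diff[OF residue[OF xy(1)] residue[OF xy(2)]])
  then show "residue (x - y) = residue x - residue y"
    using xy by (intro residue_eqI M.diff_mem) (simp_all add: const_diff algebra_simps)
  have "y * (x - \<kappa> (residue x)) + \<kappa> (residue x) * (y - \<kappa> (residue y)) \<in> M"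
    using residue xy const_mem_B by (intro M.ideal_add M.ideal_mult)
  then show "residue (x * y) = residue x * residue y"
    using xy by (intro residue_eqI M.mult_mem) (simp_all add: const_mult algebra_simps)
qed

section \<open>Localization at the maximal ideal\<close>

definition local_ring :: "'a set" where
  "local_ring = {a / b | a b. a \<in> B \<and> b \<in> B - M}"

definition local_ideal :: "'a set" where
  "local_ideal = {a / b | a b. a \<in> M \<and> b \<in> B - M}"

definition germ_value :: "'a \<Rightarrow> complex" where
  "germ_value h = (THE c. h - \<kappa> c \<in> local_ideal)"

lemma denominator: "b \<in> B - M \<Longrightarrow> b \<noteq> 0 \<and> residue b \<noteq> 0"
  using M.ideal_0 residue_eq_0_iff by auto

lemma value_divide:
  assumes a: "a \<in> B" and b: "b \<in> B - M"
  shows "germ_value (a / b) = residue a / residue b"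
  unfolding germ_value_def
proof (rule the_equality)
  let ?c = "residue a / residue b"
  have nz: "b \<noteq> 0" "residue b \<noteq> 0" using denominator[OF b] by auto
  have num: "a - \<kappa> ?c * b \<in> B" using a b const_mem_B by (intro M.mem_intros) auto
  moreover have "residue (a - \<kappa> ?c * b) = 0"
    using a b const_mem_B nz by (simp add: res.pt_diff res.pt_mult M.mult_mem res.pt_const)
  ultimately have "a - \<kappa> ?c * b \<in> M" using residue_eq_0_iff by blast
  moreover have "a / b - \<kappa> ?c = (a - \<kappa> ?c * b) / b" using nz by (simp add: diff_divide_distrib)
  ultimately show "a / b - \<kappa> ?c \<in> local_ideal" unfolding local_ideal_def using b by blast
  fix c assume "a / b - \<kappa> c \<in> local_ideal"
  then obtain x y where xy: "x \<in> M" "y \<in> B - M" "a / b - \<kappa> c = x / y" by (auto simp: local_ideal_def)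
  have y: "y \<noteq> 0" "residue y \<noteq> 0" using denominator[OF xy(2)] by auto
  have "(a - \<kappa> c * b) * y = x * b" using xy(3) nz y by (simp add: field_simps)
  then have "residue ((a - \<kappa> c * b) * y) = residue (x * b)" by simp
  moreover have "residue x = 0" "x \<in> B" using xy(1) residue_eq_0_iff M.sub by auto
  ultimately have "(residue a - c * residue b) * residue y = 0"
    using a b xy(2) const_mem_B by (simp add: res.pt_diff res.pt_mult M.mult_mem M.diff_mem res.pt_const)
  then show "c = ?c" using y nz by (simp add: field_simps)
qed

lemma B_subset_local: "B \<subseteq> local_ring"
proof
  fix b assume "b \<in> B"
  then have "b / 1 \<in> local_ring" unfolding local_ring_def using M.one_mem M.proper by blast
  then show "b \<in> local_ring" by simp
qed

lemma value_base: "a \<in> B \<Longrightarrow> germ_value a = residue a"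
  using value_divide[of a 1] M.one_mem M.proper by (simp add: res.pt_1)

sublocale val: complex_point \<kappa> local_ring germ_value
proof unfold_locales
  show "1 \<in> local_ring" using B_subset_local M.one_mem by blast
  show "\<kappa> c \<in> local_ring" for c using B_subset_local const_mem_B by blast
  show "germ_value (\<kappa> c) = c" for c by (simp add: value_base const_mem_B res.pt_const)
  fix x y assume "x \<in> local_ring" "y \<in> local_ring"
  then obtain a b c d where *: "x = a / b" "a \<in> B" "b \<in> B - M" "y = c / d" "c \<in> B" "d \<in> B - M"
    by (auto simp: local_ring_def)
  have nz: "b \<noteq> 0" "residue b \<noteq> 0" "d \<noteq> 0" "residue d \<noteq> 0" using * denominator by auto
  have bd: "b * d \<in> B - M" using * by (intro M.mult_notin)
  have v: "germ_value x = residue a / residue b" "germ_value y = residue c / residue d"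
    using * by (auto intro: value_divide)
  have dB: "b \<in> B" "d \<in> B" using * by auto
  have n1: "a * d - c * b \<in> B" "a * c \<in> B" using * by (auto intro: M.mem_intros)
  have e: "x - y = (a * d - c * b) / (b * d)" "x * y = (a * c) / (b * d)"
    using nz by (auto simp: * field_simps)
  have E: "germ_value (x - y) = residue (a * d - c * b) / residue (b * d)"
    "germ_value (x * y) = residue (a * c) / residue (b * d)"
    unfolding e using n1 bd by (auto intro: value_divide)
  show "x - y \<in> local_ring" "x * y \<in> local_ring" unfolding e local_ring_def using n1 bd by blast+
  show "germ_value (x - y) = germ_value x - germ_value y" "germ_value (x * y) = germ_value x * germ_value y"
    unfolding E v using *(2,5) dB nz
    by (simp_all add: res.pt_diff res.pt_mult M.mult_mem field_simps)
qed

lemma local_inverse: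
  assumes "x \<in> local_ring" "germ_value x \<noteq> 0"
  shows "inverse x \<in> local_ring"
proof -
  obtain a b where *: "x = a / b" "a \<in> B" "b \<in> B - M" using assms by (auto simp: local_ring_def)
  then have "residue a \<noteq> 0" using assms(2) by (auto simp: value_divide)
  then have "a \<in> B - M" using * residue_eq_0_iff by auto
  then have "b / a \<in> local_ring" using * unfolding local_ring_def by blast
  then show ?thesis using * by simp
qed

text \<open>For a common denominator \<open>d\<close> of the relation, \<open>d x\<close> is
  integral over \<open>B\<close>, hence over \<open>A\<close>, hence in \<open>B\<close>; and
  \<open>d\<close> is outside \<open>M\<close>.\<close>

lemma local_integrally_closed:
  assumes K: "subring_set K" "B \<subseteq> K" "\<And>x. x \<in> K \<Longrightarrow> integral_over A x \<Longrightarrow> x \<in> B"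
    and x: "x \<in> K" "integral_over local_ring x"
  shows "x \<in> local_ring"
proof -
  interpret K: subring_set K by fact
  obtain p where p: "p \<in> polys_over local_ring" "lead_coeff p = 1" "poly p x = 0"
    using x(2) by (auto simp: integral_over_def)
  define N where "N = degree p"
  have "\<exists>a b. coeff p i = a / b \<and> a \<in> B \<and> b \<in> B - M" for i
    using polys_overD[OF p(1), of i] by (auto simp: local_ring_def)
  then obtain a b where ab: "\<And>i. coeff p i = a i / b i" "\<And>i. a i \<in> B" "\<And>i. b i \<in> B - M" by metis
  define d where "d = (\<Prod>i\<le>N. b i)"
  have d: "d \<in> B - M" unfolding d_def using ab by (intro M.prod_notin)
  have dc: "d * coeff p i \<in> B" if "i \<le> N" for i
  proof -
    have "d = b i * (\<Prod>i\<in>{..N} - {i}. b i)" unfolding d_def using that by (simp add: prod.remove)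
    then have "d * coeff p i = a i * (\<Prod>i\<in>{..N} - {i}. b i)"
      using denominator[OF ab(3)[of i]] by (simp add: ab(1) field_simps)
    then show ?thesis using ab(2)[of i] ab(3) by (auto intro!: M.mult_mem M.prod_mem)
  qed
  \<comment> \<open>The relation of \<open>x\<close> rescaled to one of \<open>d x\<close>:
    multiplying by \<open>d^N\<close> keeps it monic and leaves at least one factor \<open>d\<close>
    for each lower coefficient.\<close>
  define q where "q = (\<Sum>i\<le>N. monom (coeff p i * d ^ (N - i)) i)"
  have cq: "coeff q i = (if i \<le> N then coeff p i * d ^ (N - i) else 0)" for i
    by (simp add: q_def coeff_sum sum.delta')
  have "coeff q i \<in> B" for i
  proof (cases "i < N")
    case True
    then have "coeff q i = (d * coeff p i) * d ^ (N - i - 1)"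
      by (simp add: cq mult_ac flip: power_Suc) (metis Suc_diff_Suc)
    then show ?thesis using dc[of i] True d by (auto intro!: M.mult_mem M.power_mem)
  next
    case False
    then show ?thesis using p(2) M.one_mem M.zero_mem by (auto simp: cq N_def)
  qed
  then have qB: "q \<in> polys_over B" by (simp add: polys_over_def)
  have "coeff q N = 1" using p(2) by (simp add: cq N_def)
  moreover have "degree q \<le> N" unfolding q_def by (intro degree_sum_le) (auto intro: order_trans[OF degree_monom_le])
  ultimately have "lead_coeff q = 1" using le_degree[of q N] by (metis antisym zero_neq_one)
  moreover have "poly q (d * x) = d ^ N * poly p x"
    unfolding q_def poly_sum poly_monom poly_altdef[of p] N_def[symmetric] sum_distrib_left
    by (intro sum.cong refl) (simp add: power_mult_distrib mult_ac flip: power_add)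
  ultimately have "integral_over B (d * x)"
    unfolding integral_over_def using qB p(3) by (intro bexI[of _ q]) auto
  then have "integral_over A (d * x)" using integral_over_trans[OF subring_set_axioms int] by blast
  then have "d * x \<in> B" using d x(1) K(2) by (intro K(3) K.mult_mem) auto
  then have "(d * x) / d \<in> local_ring" unfolding local_ring_def using d by blast
  then show ?thesis using denominator[OF d] by simp
qed

end

section \<open>Principal ideals of an integrally closed subring\<close>

context subring_set
begin

definition principal :: "'a \<Rightarrow> 'a set" where "principal u = (\<lambda>s. u * s) ` A"

lemma mem_principal: "x \<in> principal u \<longleftrightarrow> (\<exists>s\<in>A. x = u * s)"
  by (auto simp: principal_def)

lemma ideal_principal: "u \<in> A \<Longrightarrow> ideal (principal u) (subring_of A)"
  unfolding ideal_subring_of_iff[OF subring_set_axioms]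
proof (intro conjI ballI)
  assume u: "u \<in> A"
  show "principal u \<subseteq> A" using u by (auto simp: mem_principal mult_mem)
  have "0 = u * 0" by simp
  then show "0 \<in> principal u" unfolding mem_principal using zero_mem by blast
  fix x assume "x \<in> principal u"
  then obtain s where s: "s \<in> A" "x = u * s" by (auto simp: mem_principal)
  show "x - y \<in> principal u" if y: "y \<in> principal u" for y
  proof -
    obtain t where "t \<in> A" "y = u * t" using y by (auto simp: mem_principal)
    then have "x - y = u * (s - t)" "s - t \<in> A" using s by (auto simp: right_diff_distrib diff_mem)
    then show ?thesis by (auto simp: mem_principal)
  qed
  show "t * x \<in> principal u" if "t \<in> A" for t
    unfolding mem_principal using s that by (intro bexI[of _ "t * s"]) (auto simp: mult_mem mult_ac)
qed

lemma genideal_principal: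
  assumes "u \<in> A" "u \<in> G" "G \<subseteq> principal u"
  shows "Idl\<^bsub>subring_of A\<^esub> G = principal u"
proof
  interpret R: cring "subring_of A" by (rule cring_subring_of) (rule subring_set_axioms)
  show "Idl\<^bsub>subring_of A\<^esub> G \<subseteq> principal u"
    by (rule R.genideal_minimal[OF ideal_principal]) fact+
  have GA: "G \<subseteq> carrier (subring_of A)" using assms by (auto simp: mem_principal mult_mem subset_iff)
  have "ideal (Idl\<^bsub>subring_of A\<^esub> G) (subring_of A)" by (rule R.genideal_ideal[OF GA])
  moreover have "u \<in> Idl\<^bsub>subring_of A\<^esub> G" using R.genideal_self[OF GA] assms(2) by blast
  ultimately have "\<forall>s\<in>A. s * u \<in> Idl\<^bsub>subring_of A\<^esub> G"
    unfolding ideal_subring_of_iff[OF subring_set_axioms] by blast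
  then show "principal u \<subseteq> Idl\<^bsub>subring_of A\<^esub> G" by (auto simp: mem_principal mult.commute)
qed

lemma ideal_prod_principal:
  assumes "u \<in> A" "v \<in> A"
  shows "ideal_prod (subring_of A) (principal u) (principal v) = principal (u * v)"
proof
  show "ideal_prod (subring_of A) (principal u) (principal v) \<subseteq> principal (u * v)"
  proof
    fix x assume "x \<in> ideal_prod (subring_of A) (principal u) (principal v)"
    then show "x \<in> principal (u * v)"
    proof induction
      case (prod i j)
      then obtain s t where "s \<in> A" "i = u * s" "t \<in> A" "j = v * t" by (auto simp: mem_principal)
      then show ?case
        unfolding mem_principal by (intro bexI[of _ "s * t"]) (auto simp: mult_mem mult_ac)
    next
      case (sum x y)
      then obtain s t where "s \<in> A" "x = u * v * s" "t \<in> A" "y = u * v * t" by (auto simp: mem_principal)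
      then show ?case
        unfolding mem_principal by (intro bexI[of _ "s + t"]) (auto simp: add_mem distrib_left)
    qed
  qed
  show "principal (u * v) \<subseteq> ideal_prod (subring_of A) (principal u) (principal v)"
  proof
    fix x assume "x \<in> principal (u * v)"
    then obtain s where s: "s \<in> A" "x = u * v * s" by (auto simp: mem_principal)
    have "u * 1 \<in> principal u" "v * s \<in> principal v" unfolding mem_principal using s one_mem by blast+
    from ideal_prod.prod[OF this, of "subring_of A"]
    show "x \<in> ideal_prod (subring_of A) (principal u) (principal v)" using s by (simp add: mult.assoc)
  qed
qed

lemma ideal_power_principal:
  assumes "u \<in> A"
  shows "ideal_power (subring_of A) (principal u) p = principal (u ^ p)"
proof (induction p)
  case 0
  then show ?case by (simp add: nat_pow_def ideals_set_def principal_def)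
next
  case (Suc p)
  have "ideal_power (subring_of A) (principal u) (Suc p) =
      ideal_prod (subring_of A) (ideal_power (subring_of A) (principal u) p) (principal u)"
    by (simp add: nat_pow_def ideals_set_def)
  then show ?case
    unfolding Suc using assms by (simp add: ideal_prod_principal power_mem mult.commute)
qed

lemma nat_pow_subring_of: "x [^]\<^bsub>subring_of A\<^esub> (k::nat) = x ^ k"
  by (induction k) (simp_all add: nat_pow_def mult.commute)

lemma finsum_subring_of:
  assumes "finite F" "\<And>i. i \<in> F \<Longrightarrow> a i \<in> A"
  shows "finsum (subring_of A) a F = sum a F"
proof -
  interpret R: cring "subring_of A" by (rule cring_subring_of) (rule subring_set_axioms)
  show ?thesis
    using assms
  proof (induction F)
    case (insert i F)
    have "finsum (subring_of A) a (insert i F) = a i \<oplus>\<^bsub>subring_of A\<^esub> finsum (subring_of A) a F"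
      using insert by (intro R.finsum_insert) auto
    then show ?case using insert by simp
  qed simp
qed

end

text \<open>With \<open>a j = u^j s j\<close>, dividing an equation of integral dependence by
  \<open>u^d\<close> gives a monic relation of \<open>x / u\<close> over \<open>S\<close>.\<close>

lemma integral_closure_principal:
  fixes S K :: "'a::field set"
  assumes S: "subring_set S" and K: "S \<subseteq> K" "\<And>x y. x \<in> K \<Longrightarrow> y \<in> K \<Longrightarrow> x / y \<in> K"
    and closed: "\<And>x. x \<in> K \<Longrightarrow> integral_over S x \<Longrightarrow> x \<in> S"
    and u: "u \<in> S" "u \<noteq> 0"
  shows "ideal_integral_closure (subring_of S) (subring_set.principal S u) = subring_set.principal S u"
proof
  interpret subring_set S by fact
  show "principal u \<subseteq> ideal_integral_closure (subring_of S) (principal u)"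
  proof
    fix x assume x: "x \<in> principal u"
    then obtain s where s: "s \<in> S" "x = u * s" by (auto simp: mem_principal)
    have xS: "x \<in> S" using s u by (simp add: mult_mem)
    \<comment> \<open>Elements of the ideal satisfy the equation of degree 1 with
      \<open>a 1 = - x\<close>.\<close>
    have fs: "finsum (subring_of S) (\<lambda>j. - x * x [^]\<^bsub>subring_of S\<^esub> (1 - j)) {1..1::nat} = - x"
      by (subst finsum_subring_of) (auto simp: nat_pow_subring_of uminus_mem xS)
    have "- x = u ^ 1 * (- s)" using s by simp
    then have "- x \<in> ideal_power (subring_of S) (principal u) 1"
      unfolding ideal_power_principal[OF u(1)] mem_principal using s uminus_mem by blast
    then show "x \<in> ideal_integral_closure (subring_of S) (principal u)"
      unfolding ideal_integral_closure_def using fs xS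
      by (intro CollectI conjI exI[of _ "1::nat"] exI[of _ "\<lambda>_. - x"]) (auto simp: nat_pow_subring_of)
  qed
  show "ideal_integral_closure (subring_of S) (principal u) \<subseteq> principal u"
  proof
    fix x assume x0: "x \<in> ideal_integral_closure (subring_of S) (principal u)"
    then have x: "x \<in> S" by (simp add: ideal_integral_closure_def)
    obtain d :: nat and a where d: "d > 0"
      and a0: "\<forall>j\<in>{1..d}. a j \<in> ideal_power (subring_of S) (principal u) j"
      and eq0: "x [^]\<^bsub>subring_of S\<^esub> d \<oplus>\<^bsub>subring_of S\<^esub> (\<Oplus>\<^bsub>subring_of S\<^esub>j\<in>{1..d}.
        a j \<otimes>\<^bsub>subring_of S\<^esub> x [^]\<^bsub>subring_of S\<^esub> (d - j)) = \<zero>\<^bsub>subring_of S\<^esub>"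
      using x0 unfolding ideal_integral_closure_def by blast
    have a: "\<And>j. j \<in> {1..d} \<Longrightarrow> a j \<in> principal (u ^ j)"
      using a0 unfolding ideal_power_principal[OF u(1)] by blast
    have eq: "x ^ d + finsum (subring_of S) (\<lambda>j. a j * x ^ (d - j)) {1..d} = 0"
      using eq0 by (simp add: nat_pow_subring_of)
    obtain s where s: "\<And>j. j \<in> {1..d} \<Longrightarrow> s j \<in> S" "\<And>j. j \<in> {1..d} \<Longrightarrow> a j = u ^ j * s j"
      using a unfolding mem_principal by metis
    have "finsum (subring_of S) (\<lambda>j. a j * x ^ (d - j)) {1..d} = (\<Sum>j\<in>{1..d}. a j * x ^ (d - j))"
      using s u x by (intro finsum_subring_of) (auto intro!: mult_mem power_mem)
    with eq have eq': "x ^ d + (\<Sum>j\<in>{1..d}. u ^ j * s j * x ^ (d - j)) = 0" using s(2) by simp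
    define y where "y = x / u"
    have xy: "x = u * y" using u by (simp add: y_def)
    have "(\<Sum>j\<in>{1..d}. u ^ j * s j * x ^ (d - j)) = u ^ d * (\<Sum>j\<in>{1..d}. s j * y ^ (d - j))"
      unfolding sum_distrib_left xy
    proof (rule sum.cong)
      fix j assume "j \<in> {1..d}"
      then have "u ^ d = u ^ j * u ^ (d - j)" by (simp flip: power_add)
      then show "u ^ j * s j * (u * y) ^ (d - j) = u ^ d * (s j * y ^ (d - j))"
        by (simp add: power_mult_distrib mult_ac)
    qed simp
    then have "u ^ d * (y ^ d + (\<Sum>j\<in>{1..d}. s j * y ^ (d - j))) = 0"
      using eq' by (simp add: xy power_mult_distrib distrib_left)
    then have y0: "y ^ d + (\<Sum>j\<in>{1..d}. s j * y ^ (d - j)) = 0" using u by simp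
    define p where "p = monom 1 d + (\<Sum>j\<in>{1..d}. monom (s j) (d - j))"
    interpret P: subring_set "polys_over S" by (rule subring_set_polys_over)
    have pS: "p \<in> polys_over S"
      unfolding p_def using s(1) by (intro P.add_mem P.sum_mem monom_mem_polys_over one_mem) auto
    have cd: "coeff p d = 1"
      unfolding p_def by (simp add: coeff_sum) (intro sum.neutral, auto)
    have "degree p \<le> d"
      unfolding p_def by (intro degree_add_le degree_sum_le degree_monom_le) (auto intro: order_trans[OF degree_monom_le])
    then have "degree p = d" using cd le_degree[of p d] by simp
    then have "integral_over S y"
      unfolding integral_over_def using pS cd y0
      by (intro bexI[of _ p]) (auto simp: p_def poly_sum poly_monom)
    moreover have "y \<in> K" unfolding y_def using x u K by blast
    ultimately have "y \<in> S" using closed by blast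
    then show "x \<in> principal u" unfolding mem_principal using xy by blast
  qed
qed

section \<open>The field of rational functions\<close>

definition emb :: "nat cpoly \<Rightarrow> ratfun" where "emb p = Fract p 1"

definition rconst :: "complex \<Rightarrow> ratfun" where "rconst c = Fract (cconst c) 1"

lemma emb_add: "emb (p + q) = emb p + emb q"
  and emb_mult: "emb (p * q) = emb p * emb q"
  and emb_diff: "emb (p - q) = emb p - emb q"
  and emb_1: "emb 1 = 1" and emb_0: "emb 0 = 0"
  and emb_eq_0_iff: "emb p = 0 \<longleftrightarrow> p = 0"
  by (simp_all add: emb_def Zero_fract_def One_fract_def eq_fract)

lemma rconst_eq: "rconst c = emb (cconst c)"
  by (simp add: rconst_def emb_def)

lemma Fract_eq: "q \<noteq> 0 \<Longrightarrow> Fract p q = emb p / emb q"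
  by (simp add: emb_def)

global_interpretation rat: complex_field rconst
  by unfold_locales
    (simp_all add: rconst_eq emb_add[symmetric] emb_mult[symmetric] emb_1[symmetric]
      cconst.const_add cconst.const_mult cconst.const_1)

lemma emb_subst: "emb (cpoly_subst cconst b p) = cpoly_subst rconst (\<lambda>v. emb (b v)) p"
  by (subst hom_subst[of emb]) (simp_all add: emb_add emb_mult emb_1 emb_0 rconst_eq[abs_def])

lemma cvar_power: "cvar v ^ k = Poly_Mapping.single (Poly_Mapping.single v k) 1"
  by (induction k) (simp_all add: cvar_def mult_single flip: single_add)

lemma monomial_value_cvar: "monomial_value cvar \<mu> = Poly_Mapping.single \<mu> 1"
proof -
  have "(\<Prod>v\<in>S. Poly_Mapping.single (Poly_Mapping.single v (Poly_Mapping.lookup \<mu> v)) (1::complex)) =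
      Poly_Mapping.single (\<Sum>v\<in>S. Poly_Mapping.single v (Poly_Mapping.lookup \<mu> v)) 1" for S
    by (induction S rule: infinite_finite_induct) (simp_all add: mult_single)
  moreover have "(\<Sum>v\<in>Poly_Mapping.keys \<mu>. Poly_Mapping.single v (Poly_Mapping.lookup \<mu> v)) = \<mu>"
    by (rule poly_mapping_eqI) (auto simp: lookup_sum lookup_single when_def sum.delta' in_keys_iff)
  ultimately show ?thesis by (simp add: monomial_value_def cvar_power)
qed

lemma subst_cvar: "cpoly_subst cconst cvar p = p"
proof -
  have "cpoly_subst cconst cvar p = (\<Sum>\<mu>\<in>Poly_Mapping.keys p. Poly_Mapping.single \<mu> (Poly_Mapping.lookup p \<mu>))"
    by (simp add: cpoly_subst_altdef monomial_value_cvar cconst_def mult_single)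
  then show ?thesis by (simp add: cpoly_sum_monomials)
qed

lemma emb_eq_subst: "emb p = cpoly_subst rconst (\<lambda>j. emb (cvar j)) p"
  using emb_subst[of cvar p] by (simp add: subst_cvar)

lemma cpoly_ring_eq: "cpoly_ring n = cpolys_in {1..n}"
  by (simp add: cpoly_ring_def cpolys_in_def)

lemma ratfun_field_eq: "ratfun_field n = fracs (emb ` cpoly_ring n)"
proof (rule Set.set_eqI)
  fix x
  have "x \<in> ratfun_field n \<longleftrightarrow> (\<exists>p q. x = Fract p q \<and> p \<in> cpoly_ring n \<and> q \<in> cpoly_ring n \<and> q \<noteq> 0)"
    unfolding ratfun_field_def by blast
  also have "\<dots> \<longleftrightarrow> (\<exists>p q. x = emb p / emb q \<and> p \<in> cpoly_ring n \<and> q \<in> cpoly_ring n \<and> emb q \<noteq> 0)"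
    using Fract_eq unfolding emb_eq_0_iff by metis
  also have "\<dots> \<longleftrightarrow> x \<in> fracs (emb ` cpoly_ring n)" unfolding fracs_def by blast
  finally show "x \<in> ratfun_field n \<longleftrightarrow> x \<in> fracs (emb ` cpoly_ring n)" .
qed

lemma subring_set_emb_cpoly_ring: "subring_set (emb ` cpoly_ring n)"
  by (rule subring_set_image)
    (simp_all add: cpoly_ring_eq subring_set_cpolys_in emb_diff emb_mult emb_1)

lemma subring_set_ratfun_field: "subring_set (ratfun_field n)"
  unfolding ratfun_field_eq by (rule subring_set_fracs[OF subring_set_emb_cpoly_ring])

lemma ratfun_field_inverse: "x \<in> ratfun_field n \<Longrightarrow> inverse x \<in> ratfun_field n"
  unfolding ratfun_field_eq by (rule inverse_mem_fracs[OF subring_set_emb_cpoly_ring])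

lemma ratfun_field_divide: "x \<in> ratfun_field n \<Longrightarrow> y \<in> ratfun_field n \<Longrightarrow> x / y \<in> ratfun_field n"
  using subring_set.mult_mem[OF subring_set_ratfun_field _ ratfun_field_inverse] by (simp add: divide_inverse)

lemma emb_mem_ratfun_field: "p \<in> cpoly_ring n \<Longrightarrow> emb p \<in> ratfun_field n"
  unfolding ratfun_field_eq using subset_fracs[OF subring_set_emb_cpoly_ring] by blast

lemma emb_mem_subring:
  assumes "subring_set S" "\<And>c. rconst c \<in> S" "\<And>j. j \<in> {1..n} \<Longrightarrow> emb (cvar j) \<in> S" "p \<in> cpoly_ring n"
  shows "emb p \<in> S"
  unfolding emb_eq_subst[of p]
  by (rule rat.subst_mem[OF assms(1) assms(4)[unfolded cpoly_ring_eq] assms(3,2)])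

lemma pt_emb:
  assumes "complex_point rconst A h" "\<And>j. j \<in> {1..n} \<Longrightarrow> emb (cvar j) \<in> A" "p \<in> cpoly_ring n"
  shows "h (emb p) = cpoly_eval (\<lambda>j. h (emb (cvar j))) p"
  unfolding emb_eq_subst[of p]
  by (rule complex_point.pt_subst[OF assms(1) assms(3)[unfolded cpoly_ring_eq] assms(2)])

section \<open>The closure of the graph\<close>

lemma bihomogeneous_mem: "bihomogeneous n m d e G \<Longrightarrow> G \<in> cpolys_in (Inl ` {0..n} \<union> Inr ` {0..m})"
  by (auto simp: bihomogeneous_def cpolys_in_def)

lemma bihomogeneous_mult:
  assumes "bihomogeneous n m d e G" "bihomogeneous n m d' e' H"
  shows "bihomogeneous n m (d + d') (e + e') (G * H)"
  unfolding bihomogeneous_def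
proof
  fix \<mu> assume "\<mu> \<in> Poly_Mapping.keys (G * H)"
  then obtain a b where ab: "a \<in> Poly_Mapping.keys G" "b \<in> Poly_Mapping.keys H" "\<mu> = a + b"
    using keys_mult[of G H] by blast
  then show "Poly_Mapping.keys \<mu> \<subseteq> Inl ` {0..n} \<union> Inr ` {0..m} \<and>
      (\<Sum>j = 0..n. Poly_Mapping.lookup \<mu> (Inl j)) = d + d' \<and>
      (\<Sum>l = 0..m. Poly_Mapping.lookup \<mu> (Inr l)) = e + e'"
    using assms keys_add[of a b] unfolding bihomogeneous_def
    by (simp add: lookup_add sum.distrib) blast
qed

lemma bihomogeneous_diff:
  assumes "bihomogeneous n m d e G" "bihomogeneous n m d e H"
  shows "bihomogeneous n m d e (G - H)"
proof -
  have "Poly_Mapping.keys (G - H) \<subseteq> Poly_Mapping.keys G \<union> Poly_Mapping.keys H"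
    by (auto simp: in_keys_iff lookup_minus)
  then show ?thesis using assms unfolding bihomogeneous_def by blast
qed

lemma bihomogeneous_const: "bihomogeneous n m 0 0 (cconst c)"
  by (auto simp: bihomogeneous_def cconst_def split: if_splits)

lemma bihomogeneous_Inl: "j \<le> n \<Longrightarrow> bihomogeneous n m 1 0 (cvar (Inl j))"
  by (auto simp: bihomogeneous_def cvar_def lookup_single when_def sum.delta split: if_splits)

lemma bihomogeneous_Inr: "l \<le> m \<Longrightarrow> bihomogeneous n m 0 1 (cvar (Inr l))"
  by (auto simp: bihomogeneous_def cvar_def lookup_single when_def sum.delta split: if_splits)

lemma monomial_value_case_sum:
  fixes n m :: nat
  assumes "Poly_Mapping.keys \<mu> \<subseteq> Inl ` {0..n} \<union> Inr ` {0..m}"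
  shows "monomial_value (case_sum z w) \<mu> =
    (\<Prod>j=0..n. z j ^ Poly_Mapping.lookup \<mu> (Inl j)) * (\<Prod>l=0..m. w l ^ Poly_Mapping.lookup \<mu> (Inr l))"
proof -
  have "monomial_value (case_sum z w) \<mu> =
      (\<Prod>v\<in>Inl ` {0..n} \<union> Inr ` {0..m}. case_sum z w v ^ Poly_Mapping.lookup \<mu> v)"
    by (rule monomial_value_superset[OF _ assms]) simp
  also have "\<dots> = (\<Prod>v\<in>Inl ` {0..n}. case_sum z w v ^ Poly_Mapping.lookup \<mu> v) *
      (\<Prod>v\<in>Inr ` {0..m}. case_sum z w v ^ Poly_Mapping.lookup \<mu> v)"
    by (rule prod.union_disjoint) auto
  finally show ?thesis by (simp add: prod.reindex)
qed

lemma eval_scale: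
  assumes "bihomogeneous n m d e G"
  shows "cpoly_eval (case_sum (\<lambda>j. a * z j) (\<lambda>l. b * w l)) G = a ^ d * b ^ e * cpoly_eval (case_sum z w) G"
proof -
  have "monomial_value (case_sum (\<lambda>j. a * z j) (\<lambda>l. b * w l)) \<mu> =
      a ^ d * b ^ e * monomial_value (case_sum z w) \<mu>" if "\<mu> \<in> Poly_Mapping.keys G" for \<mu>
  proof -
    have \<mu>: "Poly_Mapping.keys \<mu> \<subseteq> Inl ` {0..n} \<union> Inr ` {0..m}"
      "(\<Sum>j=0..n. Poly_Mapping.lookup \<mu> (Inl j)) = d" "(\<Sum>l=0..m. Poly_Mapping.lookup \<mu> (Inr l)) = e"
      using assms that by (auto simp: bihomogeneous_def)
    show ?thesis
      unfolding monomial_value_case_sum[OF \<mu>(1)]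
      by (simp add: power_mult_distrib prod.distrib \<mu>(2,3) flip: power_sum)
  qed
  then show ?thesis by (simp add: cpoly_subst_altdef sum_distrib_left mult_ac)
qed

lemma vanishes_at_iff:
  assumes "bihomogeneous n m d e G"
  shows "vanishes_at G (proj_class z, proj_class w) \<longleftrightarrow> cpoly_eval (case_sum z w) G = 0"
proof
  have "z \<in> proj_class z" "w \<in> proj_class w" by (auto simp: proj_class_def intro: exI[of _ 1])
  then show "vanishes_at G (proj_class z, proj_class w) \<Longrightarrow> cpoly_eval (case_sum z w) G = 0"
    by (auto simp: vanishes_at_def)
  show "cpoly_eval (case_sum z w) G = 0 \<Longrightarrow> vanishes_at G (proj_class z, proj_class w)"
    by (auto simp: vanishes_at_def proj_class_def eval_scale[OF assms])
qed

definition affine_vector :: "nat \<Rightarrow> (nat \<Rightarrow> complex) \<Rightarrow> nat \<Rightarrow> complex" where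
  "affine_vector N x = (\<lambda>j. if j = 0 then 1 else if j \<le> N then x j else 0)"

lemma affine_point_eq: "affine_point N x = proj_class (affine_vector N x)"
  by (simp add: affine_point_def affine_vector_def)

lemma eval_graph_restrict:
  assumes "G \<in> cpolys_in (Inl ` {0..n} \<union> Inr ` {0..m})"
  shows "cpoly_eval x (graph_restrict f G) =
    cpoly_eval (case_sum (affine_vector n x) (affine_vector m (\<lambda>k. cpoly_eval x (f k)))) G"
  unfolding graph_restrict_def cpoly_eval_subst
  by (rule cpoly_subst_cong[OF assms])
    (auto simp: graph_coord_def affine_vector_def ceval.subst_var)

lemma graph_points_subset_closure: "graph_points n m f \<subseteq> graph_closure n m f"
proof -
  have "affine_point N x \<in> proj_space N" for N x
    unfolding affine_point_eq proj_space_def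
    by (intro imageI) (auto simp: affine_vector_def intro: exI[of _ 0])
  then show ?thesis unfolding graph_closure_def by (auto simp: graph_points_def)
qed

lemma mem_coord_open: "proj_class z \<in> coord_open j \<longleftrightarrow> z j \<noteq> 0"
  by (auto simp: coord_open_def proj_class_def intro: exI[of _ 1])

lemma coord_ratio_proj_class:
  assumes "z i \<noteq> 0"
  shows "coord_ratio j i (proj_class z) = z j / z i"
  unfolding coord_ratio_def
proof (rule the_equality)
  show "\<forall>y\<in>proj_class z. y j / y i = z j / z i" by (auto simp: proj_class_def)
  have "z \<in> proj_class z" by (auto simp: proj_class_def intro: exI[of _ 1])
  then show "c = z j / z i" if "\<forall>y\<in>proj_class z. y j / y i = c" for c using that by auto
qed

lemma mem_hyperplane_infinity:
  "proj_class z \<in> proj_space N \<Longrightarrow> proj_class z \<in> hyperplane_infinity N \<longleftrightarrow> z 0 = 0"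
  by (auto simp: hyperplane_infinity_def proj_class_def intro: exI[of _ 1])

section \<open>Germs at a point of the closure of the graph\<close>

locale graph_closure_point =
  fixes n m :: nat and f :: "nat \<Rightarrow> nat cpoly" and z w :: "nat \<Rightarrow> complex"
  assumes poly_map: "\<forall>k\<in>{1..m}. f k \<in> cpoly_ring n"
    and closure_mem: "(proj_class z, proj_class w) \<in> graph_closure n m f"
begin

abbreviation "pt \<equiv> (proj_class z, proj_class w)"
abbreviation "rest \<equiv> graph_restrict f"
abbreviation "at_pt \<equiv> cpoly_eval (case_sum z w)"
abbreviation "bihom \<equiv> bihomogeneous n m"
abbreviation "\<O> \<equiv> closure_local_ring n m f pt"

lemma rest_mult: "rest (G * H) = rest G * rest H"
  and rest_diff: "rest (G - H) = rest G - rest H"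
  and rest_const: "rest (cconst c) = cconst c"
  and rest_var: "rest (cvar v) = graph_coord f v"
  by (simp_all add: graph_restrict_def cconst.subst_mult cconst.subst_diff cconst.subst_const cconst.subst_var)

text \<open>A form whose restriction is the zero polynomial vanishes at all graph points, so the
  definition of the closure applies. This keeps denominators nonzero and makes values of germs well
  defined.\<close>

lemma at_pt_0_if_rest_0:
  assumes "bihom d e G" "rest G = 0"
  shows "at_pt G = 0"
proof -
  have "vanishes_at G g" if gp: "g \<in> graph_points n m f" for g
  proof -
    obtain x where g: "g = (affine_point n x, affine_point m (\<lambda>k. cpoly_eval x (f k)))"
      using gp by (auto simp: graph_points_def)
    have "cpoly_eval x (rest G) = 0" by (simp add: assms(2))
    then show ?thesis
      unfolding g affine_point_eq vanishes_at_iff[OF assms(1)]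
      by (simp only: eval_graph_restrict[OF bihomogeneous_mem[OF assms(1)]])
  qed
  then have "vanishes_at G pt" using closure_mem assms(1) by (auto simp: graph_closure_def)
  then show ?thesis using vanishes_at_iff[OF assms(1)] by simp
qed

lemma mem_\<O>: "a \<in> \<O> \<longleftrightarrow> (\<exists>G H d e. bihom d e G \<and> bihom d e H \<and> at_pt H \<noteq> 0 \<and> a = emb (rest G) / emb (rest H))"
proof -
  have "rest H \<noteq> 0" if "bihom d e H" "at_pt H \<noteq> 0" for H d e
    using at_pt_0_if_rest_0 that by blast
  then have "bihom d e G \<and> bihom d e H \<and> \<not> vanishes_at H pt \<and> a = Fract (rest G) (rest H) \<longleftrightarrow>
      bihom d e G \<and> bihom d e H \<and> at_pt H \<noteq> 0 \<and> a = emb (rest G) / emb (rest H)" for G H d e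
    using vanishes_at_iff Fract_eq by metis
  moreover have "a \<in> \<O> \<longleftrightarrow> (\<exists>G H d e. bihom d e G \<and> bihom d e H \<and> \<not> vanishes_at H pt \<and>
      a = Fract (rest G) (rest H))"
    unfolding closure_local_ring_def by blast
  ultimately show ?thesis by simp
qed

lemma emb_rest_nonzero: "bihom d e H \<Longrightarrow> at_pt H \<noteq> 0 \<Longrightarrow> emb (rest H) \<noteq> 0"
  using at_pt_0_if_rest_0 by (auto simp: emb_eq_0_iff)

definition germ_at :: "ratfun \<Rightarrow> complex" where
  "germ_at a = (SOME c. \<exists>G H d e. bihom d e G \<and> bihom d e H \<and> at_pt H \<noteq> 0 \<and>
     a = emb (rest G) / emb (rest H) \<and> c = at_pt G / at_pt H)"

text \<open>For two representations of the same germ, \<open>G H' - G' H\<close> is bihomogeneous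
  and restricts to zero, hence vanishes at the point.\<close>

lemma germ_at_eq:
  assumes GH: "bihom d e G" "bihom d e H" "at_pt H \<noteq> 0"
  shows "germ_at (emb (rest G) / emb (rest H)) = at_pt G / at_pt H"
  unfolding germ_at_def
proof (rule some_equality)
  show "\<exists>G' H' d e. bihom d e G' \<and> bihom d e H' \<and> at_pt H' \<noteq> 0 \<and>
     emb (rest G) / emb (rest H) = emb (rest G') / emb (rest H') \<and> at_pt G / at_pt H = at_pt G' / at_pt H'"
    using GH by blast
  fix c assume "\<exists>G' H' d e. bihom d e G' \<and> bihom d e H' \<and> at_pt H' \<noteq> 0 \<and>
     emb (rest G) / emb (rest H) = emb (rest G') / emb (rest H') \<and> c = at_pt G' / at_pt H'"
  then obtain G' H' d' e' where GH': "bihom d' e' G'" "bihom d' e' H'" "at_pt H' \<noteq> 0"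
    and eq: "emb (rest G) / emb (rest H) = emb (rest G') / emb (rest H')" and c: "c = at_pt G' / at_pt H'" by blast
  have "emb (rest (G * H' - G' * H)) = 0"
    using eq emb_rest_nonzero[OF GH(2,3)] emb_rest_nonzero[OF GH'(2,3)]
    by (simp add: rest_diff rest_mult emb_diff emb_mult field_simps)
  moreover have "bihom (d + d') (e + e') (G * H' - G' * H)"
    using bihomogeneous_mult[OF GH(1) GH'(2)] bihomogeneous_mult[OF GH'(1) GH(2)]
    by (intro bihomogeneous_diff) (simp_all add: add.commute)
  ultimately have "at_pt (G * H' - G' * H) = 0" using at_pt_0_if_rest_0 by (auto simp: emb_eq_0_iff)
  then show "c = at_pt G / at_pt H"
    using GH(3) GH'(3) by (simp add: c ceval.subst_diff ceval.subst_mult field_simps)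
qed

lemma \<O>_mem:
  assumes "bihom d e G" "bihom d e H" "at_pt H \<noteq> 0"
  shows "emb (rest G) / emb (rest H) \<in> \<O>"
  unfolding mem_\<O> using assms by blast

lemma rconst_germ: "rconst c \<in> \<O>" "germ_at (rconst c) = c"
proof -
  have 1: "rest 1 = 1" "at_pt 1 = 1" by (simp_all add: graph_restrict_def)
  have c1: "cconst 1 = (1 :: (nat + nat) cpoly)" by (simp add: cconst.const_1)
  have b: "bihom 0 0 (cconst c)" "bihom 0 0 1"
    using bihomogeneous_const[of n m c] bihomogeneous_const[of n m 1] by (simp_all add: c1)
  have e: "rconst c = emb (rest (cconst c)) / emb (rest 1)" by (simp add: rest_const rconst_eq 1 emb_1)
  show "rconst c \<in> \<O>" unfolding e by (rule \<O>_mem[OF b]) (simp add: 1)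
  show "germ_at (rconst c) = c" unfolding e by (subst germ_at_eq[OF b]) (simp_all add: 1 ceval.subst_const)
qed

sublocale germ: complex_point rconst \<O> germ_at
proof unfold_locales
  show "rconst c \<in> \<O>" "germ_at (rconst c) = c" for c by (fact rconst_germ)+
  show "1 \<in> \<O>" using rconst_germ(1)[of 1] by (simp add: rat.const_1)
  fix x y assume "x \<in> \<O>" "y \<in> \<O>"
  then obtain G H d e G' H' d' e' where
    GH: "bihom d e G" "bihom d e H" "at_pt H \<noteq> 0" "x = emb (rest G) / emb (rest H)" and
    GH': "bihom d' e' G'" "bihom d' e' H'" "at_pt H' \<noteq> 0" "y = emb (rest G') / emb (rest H')"
    unfolding mem_\<O> by blast
  note nz = emb_rest_nonzero[OF GH(2,3)] emb_rest_nonzero[OF GH'(2,3)]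
  have dif: "bihom (d + d') (e + e') (G * H' - G' * H)"
    using bihomogeneous_mult[OF GH(1) GH'(2)] bihomogeneous_mult[OF GH'(1) GH(2)]
    by (intro bihomogeneous_diff) (simp_all add: add.commute)
  note pr = bihomogeneous_mult[OF GH(1) GH'(1)] bihomogeneous_mult[OF GH(2) GH'(2)]
  have e: "x - y = emb (rest (G * H' - G' * H)) / emb (rest (H * H'))"
    "x * y = emb (rest (G * G')) / emb (rest (H * H'))"
    using nz by (simp_all add: GH(4) GH'(4) rest_diff rest_mult emb_diff emb_mult field_simps)
  have HH: "at_pt (H * H') \<noteq> 0" using GH(3) GH'(3) by (simp add: ceval.subst_mult)
  show "x - y \<in> \<O>" unfolding e by (rule \<O>_mem[OF dif pr(2) HH])
  show "x * y \<in> \<O>" unfolding e by (rule \<O>_mem[OF pr HH])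
  have xy: "germ_at x = at_pt G / at_pt H" "germ_at y = at_pt G' / at_pt H'"
    unfolding GH(4) GH'(4) by (rule germ_at_eq[OF GH(1-3)], rule germ_at_eq[OF GH'(1-3)])
  show "germ_at (x - y) = germ_at x - germ_at y"
    unfolding xy unfolding e(1) germ_at_eq[OF dif pr(2) HH] using GH(3) GH'(3)
    by (simp add: ceval.subst_diff ceval.subst_mult field_simps)
  show "germ_at (x * y) = germ_at x * germ_at y"
    unfolding xy unfolding e(2) germ_at_eq[OF pr HH]
    by (simp add: ceval.subst_mult)
qed

lemma germ_inverse:
  assumes "a \<in> \<O>" "germ_at a \<noteq> 0"
  shows "inverse a \<in> \<O>"
proof -
  obtain G H d e where GH: "bihom d e G" "bihom d e H" "at_pt H \<noteq> 0" "a = emb (rest G) / emb (rest H)"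
    using assms(1) unfolding mem_\<O> by blast
  have "at_pt G \<noteq> 0" using assms(2) germ_at_eq[OF GH(1-3)] GH(4) by auto
  from \<O>_mem[OF GH(2,1) this] show ?thesis by (simp add: GH(4))
qed

lemma graph_coord_mem:
  "j \<le> n \<Longrightarrow> graph_coord f (Inl j) \<in> cpoly_ring n" "l \<le> m \<Longrightarrow> graph_coord f (Inr l) \<in> cpoly_ring n"
  using poly_map subring_set.one_mem[OF subring_set_cpolys_in]
  by (auto simp: graph_coord_def cpoly_ring_eq cvar_mem_cpolys_in)

lemma rest_mem: "bihom d e G \<Longrightarrow> rest G \<in> cpoly_ring n"
  unfolding graph_restrict_def cpoly_ring_eq
  by (rule cconst.subst_mem[OF subring_set_cpolys_in bihomogeneous_mem])
    (use graph_coord_mem cconst_mem_cpolys_in in \<open>auto simp: cpoly_ring_eq\<close>)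

lemma \<O>_subset: "\<O> \<subseteq> ratfun_field n"
  by (auto simp: mem_\<O> intro!: ratfun_field_divide emb_mem_ratfun_field rest_mem)

lemma coordinate:
  assumes b: "bihom d e (cvar v)" "bihom d e (cvar v')" and nz: "case_sum z w v \<noteq> 0"
  shows "emb (graph_coord f v') / emb (graph_coord f v) \<in> \<O>"
    "germ_at (emb (graph_coord f v') / emb (graph_coord f v)) = case_sum z w v' / case_sum z w v"
    "emb (graph_coord f v) \<noteq> 0"
proof -
  have at: "at_pt (cvar v) \<noteq> 0" using nz by (simp add: ceval.subst_var)
  show "emb (graph_coord f v') / emb (graph_coord f v) \<in> \<O>"
    using \<O>_mem[OF b(2,1) at] by (simp add: rest_var)
  show "germ_at (emb (graph_coord f v') / emb (graph_coord f v)) = case_sum z w v' / case_sum z w v"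
    using germ_at_eq[OF b(2,1) at] by (simp add: rest_var ceval.subst_var)
  show "emb (graph_coord f v) \<noteq> 0" using emb_rest_nonzero[OF b(1) at] by (simp add: rest_var)
qed

lemma coord_X:
  assumes "i \<le> n" "j \<le> n" "z i \<noteq> 0"
  shows "emb (graph_coord f (Inl j)) / emb (graph_coord f (Inl i)) \<in> \<O>"
    "germ_at (emb (graph_coord f (Inl j)) / emb (graph_coord f (Inl i))) = z j / z i"
    "emb (graph_coord f (Inl i)) \<noteq> 0"
  using coordinate[OF bihomogeneous_Inl[OF assms(1)] bihomogeneous_Inl[OF assms(2)]] assms(3) by simp_all

lemma coord_Y:
  assumes "i \<le> m" "j \<le> m" "w i \<noteq> 0"
  shows "emb (graph_coord f (Inr j)) / emb (graph_coord f (Inr i)) \<in> \<O>"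
    "germ_at (emb (graph_coord f (Inr j)) / emb (graph_coord f (Inr i))) = w j / w i"
    "emb (graph_coord f (Inr i)) \<noteq> 0"
  using coordinate[OF bihomogeneous_Inr[OF assms(1)] bihomogeneous_Inr[OF assms(2)]] assms(3) by simp_all

abbreviation "\<N> \<equiv> normalized_stalk n m f pt"

lemma \<N>_eq: "\<N> = ratfun_field n \<inter> {x. integral_over \<O> x}"
  by (auto simp: normalized_stalk_def integral_closure_in_def integral_over_def polys_over_def)

lemma subring_set_\<N>: "subring_set \<N>"
proof -
  interpret K: subring_set "ratfun_field n" by (rule subring_set_ratfun_field)
  interpret I: subring_set "{x. integral_over \<O> x}"
    by (rule subring_set_integral) (rule germ.subring_set_axioms)
  show ?thesis unfolding \<N>_eq by unfold_locales (auto intro: K.mem_intros I.mem_intros[simplified])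
qed

lemma \<O>_subset_\<N>: "\<O> \<subseteq> \<N>"
  using \<O>_subset germ.integral_over_mem by (auto simp: \<N>_eq)

lemma integral_maximal_norm:
  "(pt, M) \<in> norm_graph n m f \<Longrightarrow> integral_maximal rconst \<O> germ_at \<N> M"
proof -
  assume "(pt, M) \<in> norm_graph n m f"
  then have "maximal_ideal_set \<N> M"
    using maximalideal_subring_of_iff[OF subring_set_\<N>] by (simp add: norm_graph_def)
  then interpret M: maximal_ideal_set \<N> M .
  show ?thesis
    by unfold_locales (use germ_inverse \<O>_subset_\<N> in \<open>auto simp: \<N>_eq\<close>)
qed

end

text \<open>The product of all numerators and denominators of elements of \<open>\<Delta>\<close>
  reduces them to a single element. Quantifying over all rings \<open>S\<close> around
  \<open>W\<close> keeps the enumeration \<open>r\<close> of \<open>W\<close> out of the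
  hypotheses.\<close>

lemma (in complex_point) places_near_point:
  assumes W: "finite W" "W \<subseteq> A" and \<epsilon>: "\<epsilon> > 0" and \<Delta>: "finite \<Delta>"
    and D: "\<And>D S. D \<in> \<Delta> \<Longrightarrow> subring_set S \<Longrightarrow> W \<subseteq> S \<Longrightarrow> range \<kappa> \<subseteq> S \<Longrightarrow> D \<in> fracs S"
      "\<And>D. D \<in> \<Delta> \<Longrightarrow> D \<noteq> 0"
  obtains V \<psi> where "complex_place \<kappa> V \<psi>" "W \<subseteq> V" "\<And>w. w \<in> W \<Longrightarrow> cmod (\<psi> w - h w) < \<epsilon>"
    "\<And>D. D \<in> \<Delta> \<Longrightarrow> D \<in> V \<and> \<psi> D \<noteq> 0"
proof -
  obtain r :: "nat \<Rightarrow> 'a" and k where r: "bij_betw r {..<k} W"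
    using ex_bij_betw_nat_finite[OF W(1)] by (auto simp: atLeast0LessThan)
  have rW: "r j \<in> W" if "j < k" for j using r that by (auto simp: bij_betw_def)
  have Wr: "\<exists>j<k. w = r j" if "w \<in> W" for w using r that by (auto simp: bij_betw_def)
  have rA: "\<And>j. j < k \<Longrightarrow> r j \<in> A" using rW W(2) by blast
  define S where "S = generated \<kappa> k r"
  interpret S: subring_set S unfolding S_def by (rule subring_set_generated)
  have WS: "W \<subseteq> S" unfolding S_def using Wr gen_mem_generated by blast
  have cS: "range \<kappa> \<subseteq> S" unfolding S_def using const_mem_generated by blast
  have "\<exists>a b. a \<in> S \<and> b \<in> S \<and> b \<noteq> 0 \<and> a \<noteq> 0 \<and> D = a / b" if "D \<in> \<Delta>" for D
    using D(1)[OF that S.subring_set_axioms WS cS] D(2)[OF that] by (auto simp: fracs_def)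
  then obtain a b where ab: "\<And>D. D \<in> \<Delta> \<Longrightarrow> a D \<in> S \<and> b D \<in> S \<and> b D \<noteq> 0 \<and> a D \<noteq> 0 \<and> D = a D / b D"
    by metis
  define P where "P = (\<Prod>D\<in>\<Delta>. a D * b D)"
  have PS: "P \<in> S" unfolding P_def using ab by (intro S.prod_mem S.mult_mem) auto
  have P0: "P \<noteq> 0" unfolding P_def using ab \<Delta> by (auto simp: prod_zero_iff)
  have PF: "P \<in> fracs (generated \<kappa> k r)" using subset_fracs[OF S.subring_set_axioms] PS S_def by blast
  obtain V \<psi> where V: "complex_place \<kappa> V \<psi>" "\<And>j. j < k \<Longrightarrow> r j \<in> V"
    "\<And>j. j < k \<Longrightarrow> cmod (\<psi> (r j) - h (r j)) < \<epsilon>" "P \<in> V" "\<psi> P \<noteq> 0"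
    using place_near_point[where k = k and r = r and \<epsilon> = \<epsilon> and D = P, OF rA \<epsilon> PF P0] by blast
  interpret V: complex_place \<kappa> V \<psi> by (rule V(1))
  have SV: "S \<subseteq> V" unfolding S_def by (rule generated_subset[OF V.subring_set_axioms V(2) V.const_mem])
  show ?thesis
  proof (rule that[OF V(1)])
    show "W \<subseteq> V" using Wr V(2) by blast
    show "cmod (\<psi> w - h w) < \<epsilon>" if "w \<in> W" for w using Wr[OF that] V(3) by blast
    fix D assume D: "D \<in> \<Delta>"
    have abV: "a D \<in> V" "b D \<in> V" using ab[OF D] SV by auto
    have "\<psi> P = (\<Prod>D\<in>\<Delta>. \<psi> (a D * b D))"
      unfolding P_def using ab SV by (intro V.pt_prod V.mult_mem) auto
    then have "\<psi> (a D * b D) \<noteq> 0" using V(5) D \<Delta> by (auto simp: prod_zero_iff)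
    then have nz: "\<psi> (a D) \<noteq> 0" "\<psi> (b D) \<noteq> 0" using abV by (auto simp: V.pt_mult)
    have inv: "inverse (b D) \<in> V" using V.inverse_mem[OF abV(2) nz(2)] .
    have eq: "D = a D * inverse (b D)" using ab[OF D] by (simp add: divide_inverse)
    have "\<psi> (a D * inverse (b D)) \<noteq> 0"
      using nz V.pt_inverse[OF abV(2) inv] ab[OF D] abV inv by (simp add: V.pt_mult)
    then show "D \<in> V \<and> \<psi> D \<noteq> 0" using V.mult_mem[OF abV(1) inv] eq by metis
  qed
qed

text \<open>Used to replace an open set around a point by finitely many subbasic conditions, each on
  one rational function.\<close>

lemma generate_topology_on_finite_basis:
  assumes "generate_topology_on \<S> U" "x \<in> U"
  shows "\<exists>\<F>. finite \<F> \<and> \<F> \<subseteq> \<S> \<and> x \<in> \<Inter>\<F> \<and> \<Inter>\<F> \<subseteq> U"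
  using assms
proof induction
  case (Int a b)
  have x: "x \<in> a" "x \<in> b" using Int.prems by auto
  obtain F where F: "finite F \<and> F \<subseteq> \<S> \<and> x \<in> \<Inter>F \<and> \<Inter>F \<subseteq> a" using Int.IH(1)[OF x(1)] by (rule exE)
  obtain G where G: "finite G \<and> G \<subseteq> \<S> \<and> x \<in> \<Inter>G \<and> \<Inter>G \<subseteq> b" using Int.IH(2)[OF x(2)] by (rule exE)
  show ?case using F G by (intro exI[of _ "F \<union> G"]) auto
next
  case (UN K)
  then obtain k where "k \<in> K" "x \<in> k" by blast
  from UN.IH[OF this] obtain F where F: "finite F \<and> F \<subseteq> \<S> \<and> x \<in> \<Inter>F \<and> \<Inter>F \<subseteq> k" by (rule exE)
  show ?case using F \<open>k \<in> K\<close> by (intro exI[of _ F]) auto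
next
  case (Basis s)
  then show ?case by (intro exI[of _ "{s}"]) auto
qed simp

section \<open>Points of the normalization\<close>

locale normalization_point = graph_closure_point n m f z w
  for n m :: nat and f :: "nat \<Rightarrow> nat cpoly" and z w :: "nat \<Rightarrow> complex" +
  fixes M :: "ratfun set"
  assumes norm_mem: "(pt, M) \<in> norm_graph n m f"
begin

sublocale im: integral_maximal rconst "\<O>" germ_at "\<N>" M
  by (rule integral_maximal_norm[OF norm_mem])

abbreviation "\<L> \<equiv> norm_local_ring n m f (pt, M)"
abbreviation "\<v> \<equiv> value_at n m f (pt, M)"

lemma \<L>_eq: "\<L> = im.local_ring"
  by (simp add: norm_local_ring_def im.local_ring_def)

lemma \<v>_eq: "\<v> = im.germ_value"
  by (simp add: fun_eq_iff value_at_def im.germ_value_def norm_local_maximal_ideal_def im.local_ideal_def rconst_def)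

lemma \<v>_point: "complex_point rconst \<L> \<v>"
  unfolding \<L>_eq \<v>_eq by (rule im.val.complex_point_axioms)

lemma \<O>_subset_\<L>: "\<O> \<subseteq> \<L>"
  unfolding \<L>_eq using im.B_subset_local \<O>_subset_\<N> by blast

lemma \<v>_germ: "a \<in> \<O> \<Longrightarrow> \<v> a = germ_at a"
  unfolding \<v>_eq using im.value_base im.residue_base \<O>_subset_\<N> by auto

lemma \<L>_subset: "\<L> \<subseteq> ratfun_field n"
  unfolding \<L>_eq im.local_ring_def by (auto simp: \<N>_eq intro!: ratfun_field_divide)

lemma \<L>_inverse: "x \<in> \<L> \<Longrightarrow> \<v> x \<noteq> 0 \<Longrightarrow> inverse x \<in> \<L>"
  unfolding \<L>_eq \<v>_eq by (rule im.local_inverse)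

lemma \<L>_integrally_closed:
  assumes "x \<in> ratfun_field n" "integral_over \<L> x"
  shows "x \<in> \<L>"
  using im.local_integrally_closed[OF subring_set_ratfun_field _ _ assms(1)] assms(2)
  unfolding \<L>_eq by (auto simp: \<N>_eq)

text \<open>The chart index comes first, so \<open>coordX i 0\<close> is the local equation
  \<open>Z_0 / Z_i\<close> of \<open>D_X\<close>, written as a rational function on affine
  \<open>n\<close>-space.\<close>

definition coordX :: "nat \<Rightarrow> nat \<Rightarrow> ratfun" where
  "coordX i j = emb (graph_coord f (Inl j)) / emb (graph_coord f (Inl i))"

definition coordY :: "nat \<Rightarrow> nat \<Rightarrow> ratfun" where
  "coordY i j = emb (graph_coord f (Inr j)) / emb (graph_coord f (Inr i))"

lemma coordX:
  assumes "i \<le> n" "j \<le> n" "z i \<noteq> 0"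
  shows "coordX i j \<in> \<O>" "germ_at (coordX i j) = z j / z i"
  unfolding coordX_def by (rule coord_X[OF assms])+

lemma coordY:
  assumes "i \<le> m" "j \<le> m" "w i \<noteq> 0"
  shows "coordY i j \<in> \<O>" "germ_at (coordY i j) = w j / w i"
  unfolding coordY_def by (rule coord_Y[OF assms])+

lemma proj_XY [simp]: "proj_X (pt, M) = proj_class z" "proj_Y (pt, M) = proj_class w"
  by (simp_all add: proj_X_def proj_Y_def)

lemma proj_space_mem: "proj_class z \<in> proj_space n" "proj_class w \<in> proj_space m"
  using closure_mem by (auto simp: graph_closure_def)

lemma mem_div_X: "(pt, M) \<in> div_X n m f \<longleftrightarrow> z 0 = 0"
  using norm_mem mem_hyperplane_infinity[OF proj_space_mem(1)] by (simp add: div_X_def)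

lemma subring_set_\<L>: "subring_set \<L>"
  using complex_point.axioms(2)[OF \<v>_point] .

text \<open>The equations of two charts differ by the factor \<open>coordX k i\<close>, which is
  regular at the point, so a single chart generates the ideal.\<close>

lemma ideal_X_eq:
  assumes i: "i \<le> n" "z i \<noteq> 0"
  shows "ideal_X n m f (pt, M) = subring_set.principal \<L> (coordX i 0)"
  unfolding ideal_X_def
proof (rule subring_set.genideal_principal[OF subring_set_\<L>])
  interpret L: subring_set \<L> by (rule subring_set_\<L>)
  have eq: "Fract (graph_coord f (Inl 0)) (graph_coord f (Inl k)) = coordX k 0" if "k \<le> n" "z k \<noteq> 0" for k
    using coord_X(3)[OF that(1) le0 that(2)] by (auto simp: coordX_def Fract_eq emb_eq_0_iff)
  show "coordX i 0 \<in> \<L>" using coordX(1)[OF i(1) _ i(2)] \<O>_subset_\<L> by blast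
  show "coordX i 0 \<in> {Fract (graph_coord f (Inl 0)) (graph_coord f (Inl i)) |i. i \<le> n \<and> proj_X (pt, M) \<in> coord_open i}"
    using i eq[OF i] by (auto simp: mem_coord_open intro!: exI[of _ i])
  have "coordX k 0 \<in> L.principal (coordX i 0)" if k: "k \<le> n" "z k \<noteq> 0" for k
  proof -
    have "coordX k 0 = coordX i 0 * coordX k i"
      using coord_X(3)[OF i(1) le0 i(2)] by (simp add: coordX_def)
    moreover have "coordX k i \<in> \<L>" using coordX(1)[OF k(1) i(1) k(2)] \<O>_subset_\<L> by blast
    ultimately show ?thesis unfolding L.mem_principal by blast
  qed
  then show "{Fract (graph_coord f (Inl 0)) (graph_coord f (Inl i)) |i. i \<le> n \<and> proj_X (pt, M) \<in> coord_open i}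
      \<subseteq> L.principal (coordX i 0)"
    using eq by (auto simp: mem_coord_open)
qed

lemma ideal_Y_eq:
  assumes i: "i \<le> m" "w i \<noteq> 0"
  shows "ideal_Y n m f (pt, M) = subring_set.principal \<L> (coordY i 0)"
  unfolding ideal_Y_def
proof (rule subring_set.genideal_principal[OF subring_set_\<L>])
  interpret L: subring_set \<L> by (rule subring_set_\<L>)
  have eq: "Fract (graph_coord f (Inr 0)) (graph_coord f (Inr k)) = coordY k 0" if "k \<le> m" "w k \<noteq> 0" for k
    using coord_Y(3)[OF that(1) le0 that(2)] by (auto simp: coordY_def Fract_eq emb_eq_0_iff)
  show "coordY i 0 \<in> \<L>" using coordY(1)[OF i(1) _ i(2)] \<O>_subset_\<L> by blast
  show "coordY i 0 \<in> {Fract (graph_coord f (Inr 0)) (graph_coord f (Inr l)) |l. l \<le> m \<and> proj_Y (pt, M) \<in> coord_open l}"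
    using i eq[OF i] by (auto simp: mem_coord_open intro!: exI[of _ i])
  have "coordY k 0 \<in> L.principal (coordY i 0)" if k: "k \<le> m" "w k \<noteq> 0" for k
  proof -
    have "coordY k 0 = coordY i 0 * coordY k i"
      using coord_Y(3)[OF i(1) le0 i(2)] by (simp add: coordY_def)
    moreover have "coordY k i \<in> \<L>" using coordY(1)[OF k(1) i(1) k(2)] \<O>_subset_\<L> by blast
    ultimately show ?thesis unfolding L.mem_principal by blast
  qed
  then show "{Fract (graph_coord f (Inr 0)) (graph_coord f (Inr l)) |l. l \<le> m \<and> proj_Y (pt, M) \<in> coord_open l}
      \<subseteq> L.principal (coordY i 0)"
    using eq by (auto simp: mem_coord_open)
qed

text \<open>Both ideals are principal and the local ring is integrally closed, so the inclusion of ideals is the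
  regularity of a single rational function.\<close>

lemma eventually_ideal_power_subset_iff:
  assumes u: "u \<in> \<L>" "u \<noteq> 0" and y: "y \<in> \<L>" and q: "q > 0"
  defines "R \<equiv> local_ring_at n m f (pt, M)"
  shows "(\<forall>\<^sub>F t in sequentially. ideal_power R (subring_set.principal \<L> y) (q * t)
      \<subseteq> ideal_integral_closure R (ideal_power R (subring_set.principal \<L> u) (p * t))) \<longleftrightarrow> y ^ q / u ^ p \<in> \<L>"
proof -
  interpret L: subring_set \<L> by (rule subring_set_\<L>)
  interpret K: subring_set "ratfun_field n" by (rule subring_set_ratfun_field)
  have *: "ideal_power R (L.principal y) (q * t) \<subseteq> ideal_integral_closure R (ideal_power R (L.principal u) (p * t))
      \<longleftrightarrow> (y ^ q / u ^ p) ^ t \<in> \<L>" for t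
  proof -
    have "ideal_integral_closure R (ideal_power R (L.principal u) (p * t)) = L.principal (u ^ (p * t))"
      unfolding R_def L.ideal_power_principal[OF u(1)]
      by (rule integral_closure_principal[OF subring_set_\<L> \<L>_subset ratfun_field_divide
            \<L>_integrally_closed L.power_mem[OF u(1)]]) (use u(2) in auto)
    moreover have "ideal_power R (L.principal y) (q * t) = L.principal (y ^ (q * t))"
      unfolding R_def by (rule L.ideal_power_principal[OF y])
    moreover have "L.principal (y ^ (q * t)) \<subseteq> L.principal (u ^ (p * t)) \<longleftrightarrow> y ^ (q * t) / u ^ (p * t) \<in> \<L>"
    proof
      assume "L.principal (y ^ (q * t)) \<subseteq> L.principal (u ^ (p * t))"
      moreover have "y ^ (q * t) \<in> L.principal (y ^ (q * t))"
        unfolding L.mem_principal using L.one_mem by (intro bexI[of _ 1]) auto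
      ultimately have "y ^ (q * t) \<in> L.principal (u ^ (p * t))" by blast
      then obtain s where "s \<in> \<L>" "y ^ (q * t) = u ^ (p * t) * s" unfolding L.mem_principal by blast
      then show "y ^ (q * t) / u ^ (p * t) \<in> \<L>" using u(2) by simp
    next
      assume h: "y ^ (q * t) / u ^ (p * t) \<in> \<L>"
      show "L.principal (y ^ (q * t)) \<subseteq> L.principal (u ^ (p * t))"
      proof
        fix x assume "x \<in> L.principal (y ^ (q * t))"
        then obtain s where s: "s \<in> \<L>" "x = y ^ (q * t) * s" by (auto simp: L.mem_principal)
        then have "x = u ^ (p * t) * (y ^ (q * t) / u ^ (p * t) * s)" using u(2) by simp
        then show "x \<in> L.principal (u ^ (p * t))" unfolding L.mem_principal using L.mult_mem[OF h s(1)] by blast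
      qed
    qed
    ultimately show ?thesis by (simp add: power_divide power_mult)
  qed
  show ?thesis
    unfolding *
  proof
    assume "\<forall>\<^sub>F t in sequentially. (y ^ q / u ^ p) ^ t \<in> \<L>"
    then obtain N where N: "\<And>t. t \<ge> N \<Longrightarrow> (y ^ q / u ^ p) ^ t \<in> \<L>"
      unfolding eventually_sequentially by blast
    obtain t where t: "t > 0" "(y ^ q / u ^ p) ^ t \<in> \<L>"
      using N[OF le_SucI[OF order_refl]] zero_less_Suc by blast
    let ?h = "y ^ q / u ^ p"
    have hK: "?h \<in> ratfun_field n"
      using u y \<L>_subset by (intro ratfun_field_divide K.power_mem) auto
    \<comment> \<open>\<open>?h\<close> is a root of the monic \<open>X^t - ?h^t\<close>, so a
      single positive \<open>t\<close> suffices by integral closedness.\<close>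
    have "monom 1 t - [:?h ^ t:] \<in> polys_over \<L>"
      using t(2) by (intro subring_set.diff_mem[OF L.subring_set_polys_over] L.monom_mem_polys_over L.const_mem_polys_over L.one_mem)
    moreover have "lead_coeff (monom 1 t - [:?h ^ t:]) = 1"
    proof -
      have lt: "degree [:?h ^ t:] < degree (monom (1::ratfun) t)" using t(1) by (simp add: degree_monom_eq)
      have "degree (monom 1 t - [:?h ^ t:]) = degree (monom (1::ratfun) t)"
        unfolding diff_conv_add_uminus by (rule degree_add_eq_left) (unfold degree_minus, rule lt)
      then have "degree (monom 1 t - [:?h ^ t:]) = t" by (simp only: degree_monom_eq[OF one_neq_zero])
      then show ?thesis using t(1) by (simp add: coeff_pCons split: nat.split)
    qed
    moreover have "poly (monom 1 t - [:?h ^ t:]) ?h = 0" by (simp add: poly_monom)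
    ultimately have "integral_over \<L> ?h" unfolding integral_over_def by blast
    then show "?h \<in> \<L>" by (rule \<L>_integrally_closed[OF hK])
  next
    assume "y ^ q / u ^ p \<in> \<L>"
    then show "\<forall>\<^sub>F t in sequentially. (y ^ q / u ^ p) ^ t \<in> \<L>" by (intro always_eventually allI L.power_mem)
  qed
qed

end

lemma power_le_imp_le_powr:
  fixes a b B :: real
  assumes "b ^ q \<le> B * a ^ p" "a > 0" "b \<ge> 0" "B > 0" "q > 0"
  shows "b \<le> B powr (1 / q) * a powr (p / q)"
proof (cases "b = 0")
  case False
  then have b: "b > 0" using assms by simp
  have "b = (b ^ q) powr (1 / q)" using b assms(5) by (simp add: powr_powr flip: powr_realpow)
  also have "\<dots> \<le> (B * a ^ p) powr (1 / q)" using assms b by (intro powr_mono2) auto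
  also have "\<dots> = B powr (1 / q) * (a ^ p) powr (1 / q)" using assms by (simp add: powr_mult)
  also have "(a ^ p) powr (1 / q) = a powr (p / q)" using assms by (simp add: powr_powr flip: powr_realpow)
  finally show ?thesis .
qed (use assms in auto)

lemma normalization_pointE:
  assumes "\<forall>k\<in>{1..m}. f k \<in> cpoly_ring n" "\<eta> \<in> norm_graph n m f"
  obtains z w M where "\<eta> = ((proj_class z, proj_class w), M)" "normalization_point n m f z w M"
    "\<exists>j\<le>n. z j \<noteq> 0" "\<exists>l\<le>m. w l \<noteq> 0"
proof -
  obtain P Q M where \<eta>: "\<eta> = ((P, Q), M)" by (metis surj_pair)
  then have "(P, Q) \<in> graph_closure n m f" using assms(2) by (auto simp: norm_graph_def)
  then have "P \<in> proj_space n" "Q \<in> proj_space m" by (auto simp: graph_closure_def)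
  then obtain z w where zw: "P = proj_class z" "\<exists>j. z j \<noteq> 0" "\<forall>j>n. z j = 0"
    "Q = proj_class w" "\<exists>l. w l \<noteq> 0" "\<forall>l>m. w l = 0" by (auto simp: proj_space_def)
  have "normalization_point n m f z w M"
    by unfold_locales (use assms \<eta> zw \<open>(P, Q) \<in> _\<close> in auto)
  then show ?thesis using that \<eta> zw by (metis not_le)
qed

section \<open>The two exponents\<close>

context normalization_point
begin

text \<open>A chart has to be recognised by domains of functions: if \<open>Z_i\<close> vanished at
  \<open>\<eta>\<close> and \<open>Z_j\<close> did not, then \<open>Z_i / Z_j\<close> would have
  value 0 there, while its product with the regular function \<open>Z_j / Z_i\<close> is 1.\<close>

lemma chart_neighbourhood:
  assumes i: "i \<le> n" "z i \<noteq> 0" and l: "l \<le> m" "w l \<noteq> 0"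
  obtains U where "openin (analytic_topology n m f) U" "(pt, M) \<in> U"
    "\<And>\<eta>. \<eta> \<in> U \<Longrightarrow> proj_X \<eta> \<in> coord_open i \<and> proj_Y \<eta> \<in> coord_open l"
proof -
  define basic where "basic h = {\<eta> \<in> norm_graph n m f. h \<in> norm_local_ring n m f \<eta> \<and> value_at n m f \<eta> h \<in> UNIV}" for h
  have open_basic: "openin (analytic_topology n m f) (basic h)" for h
    unfolding analytic_topology_def basic_def by (rule topology_generated_by_Basis) blast
  define U where "U = \<Inter> (basic ` (coordX i ` {..n} \<union> coordY l ` {..m}))"
  have "openin (analytic_topology n m f) U"
    unfolding U_def using open_basic by (intro openin_Inter) auto
  moreover have "(pt, M) \<in> U"
    unfolding U_def basic_def using norm_mem coordX(1)[OF i(1) _ i(2)] coordY(1)[OF l(1) _ l(2)] \<O>_subset_\<L> by auto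
  moreover have "proj_X \<eta> \<in> coord_open i \<and> proj_Y \<eta> \<in> coord_open l" if \<eta>: "\<eta> \<in> U" for \<eta>
  proof -
    have "\<eta> \<in> norm_graph n m f" using \<eta> by (auto simp: U_def basic_def)
    then obtain z' w' M' where \<eta>': "\<eta> = ((proj_class z', proj_class w'), M')"
      and np: "normalization_point n m f z' w' M'" and ex: "\<exists>j\<le>n. z' j \<noteq> 0" "\<exists>l\<le>m. w' l \<noteq> 0"
      using normalization_pointE[OF poly_map] by metis
    interpret N: normalization_point n m f z' w' M' by (rule np)
    interpret NL: complex_point rconst "N.\<L>" "N.\<v>" by (rule N.\<v>_point)
    have mem: "coordX i j \<in> N.\<L>" "coordY l k \<in> N.\<L>" if "j \<le> n" "k \<le> m" for j k
      using \<eta> that by (auto simp: U_def basic_def \<eta>')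
    have "z' i \<noteq> 0"
    proof
      assume 0: "z' i = 0"
      obtain j where j: "j \<le> n" "z' j \<noteq> 0" using ex by blast
      have "coordX i j * N.coordX j i = 1"
        using coord_X(3)[OF i(1) le0 i(2)] N.coord_X(3)[OF j(1) le0 j(2)] by (auto simp: coordX_def N.coordX_def)
      moreover have "N.\<v> (N.coordX j i) = 0" "N.coordX j i \<in> N.\<L>"
        using N.coordX[OF j(1) i(1) j(2)] N.\<v>_germ N.\<O>_subset_\<L> 0 by auto
      ultimately have "N.\<v> 1 = 0" using NL.pt_mult[OF mem(1)[OF j(1) order_refl], of "N.coordX j i"] by simp
      then show False using NL.pt_1 by simp
    qed
    moreover have "w' l \<noteq> 0"
    proof
      assume 0: "w' l = 0"
      obtain j where j: "j \<le> m" "w' j \<noteq> 0" using ex by blast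
      have "coordY l j * N.coordY j l = 1"
        using coord_Y(3)[OF l(1) le0 l(2)] N.coord_Y(3)[OF j(1) le0 j(2)] by (auto simp: coordY_def N.coordY_def)
      moreover have "N.\<v> (N.coordY j l) = 0" "N.coordY j l \<in> N.\<L>"
        using N.coordY[OF j(1) l(1) j(2)] N.\<v>_germ N.\<O>_subset_\<L> 0 by auto
      ultimately have "N.\<v> 1 = 0" using NL.pt_mult[OF mem(2)[OF _ j(1), of 0], of "N.coordY j l"] by simp
      then show False using NL.pt_1 by simp
    qed
    ultimately show ?thesis by (simp add: \<eta>' mem_coord_open proj_X_def proj_Y_def)
  qed
  ultimately show ?thesis using that by blast
qed

definition analytic_bound :: "nat \<Rightarrow> nat \<Rightarrow> real \<Rightarrow> bool" where
  "analytic_bound i l \<theta> \<longleftrightarrow> \<theta> \<ge> 0 \<and>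
     (\<exists>C>0. \<exists>U. openin (analytic_topology n m f) U \<and> (pt, M) \<in> U \<and>
        (\<forall>\<eta>\<in>U. proj_X \<eta> \<in> coord_open i \<and> proj_Y \<eta> \<in> coord_open l) \<and>
        (\<forall>\<eta>\<in>(U \<inter> graph_in_norm n m f) - div_X n m f.
           norm (coord_ratio 0 l (proj_Y \<eta>)) \<le> C * norm (coord_ratio 0 i (proj_X \<eta>)) powr \<theta>))"

text \<open>On the neighbourhood where \<open>h\<close> stays within 1 of its value at the point,
  \<open>|h| \<le> B\<close>; taking \<open>q\<close>-th roots of \<open>|y|^q \<le> B |u|^p\<close>
  gives the bound. The case \<open>p = 0\<close> is included and yields the exponent 0.\<close>

lemma analytic_bound_if_regular:
  assumes i: "i \<le> n" "z i \<noteq> 0" and l: "l \<le> m" "w l \<noteq> 0" and q: "q > 0"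
    and h: "coordY l 0 ^ q / coordX i 0 ^ p \<in> \<L>"
  shows "analytic_bound i l (p / q)"
proof -
  let ?h = "coordY l 0 ^ q / coordX i 0 ^ p"
  obtain U0 where U0: "openin (analytic_topology n m f) U0" "(pt, M) \<in> U0"
    "\<And>\<eta>. \<eta> \<in> U0 \<Longrightarrow> proj_X \<eta> \<in> coord_open i \<and> proj_Y \<eta> \<in> coord_open l"
    using chart_neighbourhood[OF i l] by blast
  define U1 where "U1 = {\<eta> \<in> norm_graph n m f. ?h \<in> norm_local_ring n m f \<eta> \<and> value_at n m f \<eta> ?h \<in> ball (\<v> ?h) 1}"
  have U1: "openin (analytic_topology n m f) U1"
    unfolding analytic_topology_def U1_def by (rule topology_generated_by_Basis) blast
  define U where "U = U0 \<inter> U1"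
  define B where "B = cmod (\<v> ?h) + 1"
  have B: "B > 0" unfolding B_def by (simp add: add_nonneg_pos)
  have U: "openin (analytic_topology n m f) U" "(pt, M) \<in> U"
    unfolding U_def using U0 U1 norm_mem h by (auto simp: U1_def)
  have "cmod (coord_ratio 0 l (proj_Y \<eta>)) \<le> B powr (1 / q) * cmod (coord_ratio 0 i (proj_X \<eta>)) powr (p / q)"
    if \<eta>: "\<eta> \<in> (U \<inter> graph_in_norm n m f) - div_X n m f" for \<eta>
  proof -
    have "\<eta> \<in> norm_graph n m f" using \<eta> by (auto simp: graph_in_norm_def)
    then obtain z' w' M' where \<eta>': "\<eta> = ((proj_class z', proj_class w'), M')"
      and np: "normalization_point n m f z' w' M'"
      using normalization_pointE[OF poly_map] by metis
    interpret N: normalization_point n m f z' w' M' by (rule np)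
    interpret NL: complex_point rconst "N.\<L>" "N.\<v>" by (rule N.\<v>_point)
    have zw: "z' i \<noteq> 0" "w' l \<noteq> 0" "z' 0 \<noteq> 0"
      using U0(3)[of \<eta>] \<eta> N.mem_div_X by (auto simp: \<eta>' U_def mem_coord_open proj_X_def proj_Y_def)
    have hN: "?h \<in> N.\<L>" "N.\<v> ?h \<in> ball (\<v> ?h) 1" using \<eta> by (auto simp: U_def U1_def \<eta>')
    have cX: "coordX i 0 \<in> N.\<L>" "N.\<v> (coordX i 0) = z' 0 / z' i"
      using N.coordX[OF i(1) _ zw(1), of 0] N.\<v>_germ N.\<O>_subset_\<L> by (auto simp: coordX_def N.coordX_def)
    have cY: "coordY l 0 \<in> N.\<L>" "N.\<v> (coordY l 0) = w' 0 / w' l"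
      using N.coordY[OF l(1) _ zw(2), of 0] N.\<v>_germ N.\<O>_subset_\<L> by (auto simp: coordY_def N.coordY_def)
    have "coordX i 0 \<noteq> 0"
      using coord_X(3)[OF i(1) le0 i(2)] by (simp add: coordX_def graph_coord_def emb_1)
    then have "?h * coordX i 0 ^ p = coordY l 0 ^ q" by simp
    then have "N.\<v> ?h * (z' 0 / z' i) ^ p = (w' 0 / w' l) ^ q"
      using NL.pt_mult[OF hN(1) NL.power_mem[OF cX(1)], of p] by (simp add: NL.pt_power cX cY)
    then have "cmod (w' 0 / w' l) ^ q = cmod (N.\<v> ?h) * cmod (z' 0 / z' i) ^ p"
      by (metis norm_mult norm_power)
    also have "cmod (N.\<v> ?h) \<le> B"
      using hN(2) norm_triangle_ineq2[of "N.\<v> ?h" "\<v> ?h"] by (simp add: B_def dist_norm norm_minus_commute)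
    then have "cmod (N.\<v> ?h) * cmod (z' 0 / z' i) ^ p \<le> B * cmod (z' 0 / z' i) ^ p"
      by (rule mult_right_mono) simp
    finally have "cmod (w' 0 / w' l) \<le> B powr (1 / q) * cmod (z' 0 / z' i) powr (p / q)"
      using zw B q by (intro power_le_imp_le_powr) auto
    then show ?thesis by (simp add: \<eta>' proj_X_def proj_Y_def coord_ratio_proj_class zw)
  qed
  then show ?thesis
    unfolding analytic_bound_def using U U0(3) B by (intro conjI exI[of _ "B powr (1 / q)"] exI[of _ U]) (auto simp: U_def)
qed

end

text \<open>A relation of \<open>inverse h\<close> with unit constant coefficient, reversed and
  scaled, would be a monic relation of \<open>h\<close>. Hence the value 0 for
  \<open>inverse h\<close> is compatible with all relations.\<close>

lemma coeff_0_of_inverse_relation: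
  assumes "complex_point \<kappa> L v" "\<And>x. x \<in> L \<Longrightarrow> v x \<noteq> 0 \<Longrightarrow> inverse x \<in> L"
    and h: "\<not> integral_over L h" and p: "p \<in> polys_over L" "poly p (inverse h) = 0"
  shows "v (coeff p 0) = 0"
proof (rule ccontr)
  assume c: "v (coeff p 0) \<noteq> 0"
  interpret complex_point \<kappa> L v by fact
  have h0: "h \<noteq> 0" using h integral_over_mem[OF zero_mem] by auto
  have c0: "coeff p 0 \<noteq> 0" using c pt_0 by auto
  define q where "q = smult (inverse (coeff p 0)) (reflect_poly p)"
  have "reflect_poly p \<in> polys_over L"
    using p(1) zero_mem by (auto simp: polys_over_def coeff_reflect_poly)
  then have "q \<in> polys_over L"
    unfolding q_def using assms(2)[OF polys_overD[OF p(1)] c] by (intro smult_mem_polys_over)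
  moreover have "lead_coeff q = 1"
    using c0 by (simp add: q_def coeff_reflect_poly)
  moreover have "poly q h = 0"
    using p(2) poly_reflect_poly_nz[OF h0, of p] by (simp add: q_def)
  ultimately show False using h unfolding integral_over_def by blast
qed

text \<open>A place that is finite on all affine coordinates contains the local ring at the graph
  point with these values and, containing integral elements, the normalized stalk too; the elements
  of value 0 form the maximal ideal.\<close>

lemma graph_point_of_place:
  assumes f: "\<forall>k\<in>{1..m}. f k \<in> cpoly_ring n"
    and V: "complex_place rconst V \<psi>" "\<And>j. j \<in> {1..n} \<Longrightarrow> emb (cvar j) \<in> V"
  defines "x \<equiv> \<lambda>j. \<psi> (emb (cvar j))"
  obtains M where
    "normalization_point n m f (affine_vector n x) (affine_vector m (\<lambda>k. cpoly_eval x (f k))) M"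
proof -
  interpret V: complex_place rconst V \<psi> by (rule V(1))
  define z where "z = affine_vector n x"
  define w where "w = affine_vector m (\<lambda>k. cpoly_eval x (f k))"
  have "(affine_point n x, affine_point m (\<lambda>k. cpoly_eval x (f k))) \<in> graph_points n m f"
    by (auto simp: graph_points_def)
  then have gc: "(proj_class z, proj_class w) \<in> graph_closure n m f"
    using graph_points_subset_closure[of n m f] by (auto simp: affine_point_eq z_def w_def)
  interpret G: graph_closure_point n m f z w by unfold_locales (use f gc in auto)
  have emb_rest: "emb (G.rest H) \<in> V \<and> \<psi> (emb (G.rest H)) = G.at_pt H" if "G.bihom d e H" for H d e
  proof -
    note r = G.rest_mem[OF that]
    have "emb (G.rest H) \<in> V" by (rule emb_mem_subring[OF V.subring_set_axioms V.const_mem V(2) r])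
    moreover have "\<psi> (emb (G.rest H)) = cpoly_eval x (G.rest H)"
      unfolding x_def by (rule pt_emb[OF V.complex_point_axioms V(2) r])
    ultimately show ?thesis
      by (simp add: eval_graph_restrict[OF bihomogeneous_mem[OF that]] z_def w_def)
  qed
  have OV: "G.\<O> \<subseteq> V"
  proof
    fix a assume "a \<in> G.\<O>"
    then obtain A B d e where AB: "G.bihom d e A" "G.bihom d e B" "G.at_pt B \<noteq> 0" "a = emb (G.rest A) / emb (G.rest B)"
      unfolding G.mem_\<O> by blast
    have "inverse (emb (G.rest B)) \<in> V" using emb_rest[OF AB(2)] AB(3) by (intro V.inverse_mem) auto
    then show "a \<in> V" using emb_rest[OF AB(1)] by (auto simp: AB(4) divide_inverse intro: V.mult_mem)
  qed
  have NV: "G.\<N> \<subseteq> V"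
    using V.integral_mem integral_over_mono[OF OV] by (auto simp: G.\<N>_eq)
  interpret N: subring_set "G.\<N>" by (rule G.subring_set_\<N>)
  have cN: "rconst c \<in> G.\<N>" for c using G.\<O>_subset_\<N> G.germ.const_mem by blast
  define M where "M = {b \<in> G.\<N>. \<psi> b = 0}"
  have "maximal_ideal_set G.\<N> M"
  proof unfold_locales
    show "M \<subseteq> G.\<N>" by (auto simp: M_def)
    show "x - y \<in> M" if "x \<in> M" "y \<in> M" for x y
      using that NV by (auto simp: M_def V.pt_diff subset_iff intro: N.diff_mem)
    show "b * x \<in> M" if "x \<in> M" "b \<in> G.\<N>" for x b
      using that NV by (auto simp: M_def V.pt_mult subset_iff intro: N.mult_mem)
    show "0 \<in> M" "1 \<notin> M" by (auto simp: M_def V.pt_0 V.pt_1 N.zero_mem)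
    fix b assume b: "b \<in> G.\<N>" "b \<notin> M"
    then have nz: "\<psi> b \<noteq> 0" by (auto simp: M_def)
    have bV: "b \<in> V" using b NV by blast
    have "1 - b * rconst (inverse (\<psi> b)) \<in> G.\<N>" using b cN by (intro N.mem_intros)
    moreover have "\<psi> (1 - b * rconst (inverse (\<psi> b))) = 0"
      using nz bV by (simp add: V.pt_diff V.pt_mult V.pt_1 V.pt_const V.const_mem V.one_mem V.mult_mem)
    ultimately show "\<exists>c\<in>G.\<N>. 1 - b * c \<in> M" using cN by (auto simp: M_def)
  qed
  then have "maximalideal M (subring_of G.\<N>)"
    using maximalideal_subring_of_iff[OF G.subring_set_\<N>] by blast
  then have "((proj_class z, proj_class w), M) \<in> norm_graph n m f" using gc by (simp add: norm_graph_def)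
  then have "normalization_point n m f z w M" by unfold_locales
  then show ?thesis using that unfolding z_def w_def by blast
qed

section \<open>Regularity forced by the analytic inequality\<close>

context normalization_point
begin

lemma regular_if_analytic_bound:
  assumes i: "i \<in> {1..n}" "z i \<noteq> 0" and l: "l \<le> m" "w l \<noteq> 0"
    and bound: "analytic_bound i l \<theta>" and pq: "p > 0" "q > 0" "real p \<le> \<theta> * real q"
  shows "coordY l 0 ^ q / coordX i 0 ^ p \<in> \<L>"
proof (rule ccontr)
  have i': "i \<le> n" using i by simp
  interpret L: complex_point rconst \<L> \<v> by (rule \<v>_point)
  interpret K: subring_set "ratfun_field n" by (rule subring_set_ratfun_field)
  define u where "u = coordX i 0"
  define y where "y = coordY l 0"
  \<comment> \<open>\<open>Z_0\<close> and \<open>W_0\<close> restrict to 1 on the graph, so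
    \<open>u = 1 / x_i\<close> and \<open>y = 1 / g\<close> have polynomial inverses.\<close>
  define g where "g = emb (graph_coord f (Inr l))"
  have g0: "g \<noteq> 0" using coord_Y(3)[OF l(1) le0 l(2)] by (simp add: g_def)
  have xi0: "emb (cvar i) \<noteq> 0" using coord_X(3)[OF i' le0 i(2)] i by (simp add: graph_coord_def)
  have u_eq: "u = inverse (emb (cvar i))" using i by (simp add: u_def coordX_def graph_coord_def emb_1 divide_inverse)
  have y_eq: "y = inverse g" by (simp add: y_def coordY_def g_def graph_coord_def emb_1 divide_inverse)
  have u0: "u \<noteq> 0" "y \<noteq> 0" using xi0 g0 by (auto simp: u_eq y_eq)
  define h where "h = y ^ q / u ^ p"
  assume "coordY l 0 ^ q / coordX i 0 ^ p \<notin> \<L>"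
  then have hL: "h \<notin> \<L>" by (simp add: h_def u_def y_def)
  have uL: "coordX i j \<in> \<L>" if "j \<le> n" for j using coordX(1)[OF i' that i(2)] \<O>_subset_\<L> by blast
  have yL: "y \<in> \<L>" using coordY(1)[OF l(1) le0 l(2)] \<O>_subset_\<L> by (auto simp: y_def)
  have hK: "h \<in> ratfun_field n"
    unfolding h_def u_def using uL[of 0] yL \<L>_subset by (intro ratfun_field_divide K.power_mem) auto
  then have not_int: "\<not> integral_over \<L> h" using hL \<L>_integrally_closed by blast
  have "\<v> (coeff P 0) = 0" if "P \<in> polys_over \<L>" "poly P (inverse h) = 0" for P
    by (rule coeff_0_of_inverse_relation[OF \<v>_point \<L>_inverse not_int that])
  then have root: "poly (L.reduct P) 0 = 0" if "P \<in> polys_over \<L>" "poly P (inverse h) = 0" for P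
    using that by (simp add: poly_0_coeff_0 L.coeff_reduct)
  obtain \<phi> where \<phi>: "complex_point rconst (adjoin \<L> (inverse h)) \<phi>" "\<And>a. a \<in> \<L> \<Longrightarrow> \<phi> a = \<v> a" "\<phi> (inverse h) = 0"
    using L.extend_adjoin[OF root] by metis
  interpret \<phi>: complex_point rconst "adjoin \<L> (inverse h)" \<phi> by (rule \<phi>(1))
  obtain C U where C: "C > 0" "openin (analytic_topology n m f) U" "(pt, M) \<in> U"
    and U: "\<And>\<eta>. \<eta> \<in> U \<Longrightarrow> proj_X \<eta> \<in> coord_open i \<and> proj_Y \<eta> \<in> coord_open l"
    and ineq: "\<And>\<eta>. \<eta> \<in> (U \<inter> graph_in_norm n m f) - div_X n m f \<Longrightarrow>
           norm (coord_ratio 0 l (proj_Y \<eta>)) \<le> C * norm (coord_ratio 0 i (proj_X \<eta>)) powr \<theta>"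
    using bound unfolding analytic_bound_def by metis
  define basic where "basic h V = {\<eta> \<in> norm_graph n m f. h \<in> norm_local_ring n m f \<eta> \<and> value_at n m f \<eta> h \<in> V}" for h V
  have "generate_topology_on {basic h V | h V. open V} U"
    using C(2) unfolding analytic_topology_def basic_def by (rule openin_topology_generated_by)
  from generate_topology_on_finite_basis[OF this C(3)] obtain \<F> where
    \<F>: "finite \<F>" "\<F> \<subseteq> {basic h V | h V. open V}" "(pt, M) \<in> \<Inter>\<F>" "\<Inter>\<F> \<subseteq> U" by blast
  have "\<exists>h V. s = basic h V \<and> open V" if "s \<in> \<F>" for s using \<F>(2) that by blast
  then obtain hh VV where hV: "\<And>s. s \<in> \<F> \<Longrightarrow> s = basic (hh s) (VV s)" "\<And>s. s \<in> \<F> \<Longrightarrow> open (VV s)" by metis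
  have hhL: "hh s \<in> \<L>" "\<v> (hh s) \<in> VV s" if "s \<in> \<F>" for s
  proof -
    have "(pt, M) \<in> basic (hh s) (VV s)" using \<F>(3) hV(1)[OF that] that by blast
    then show "hh s \<in> \<L>" "\<v> (hh s) \<in> VV s" by (auto simp: basic_def)
  qed
  have "\<exists>e>0. ball (\<v> (hh s)) e \<subseteq> VV s" if "s \<in> \<F>" for s
    using hV(2)[OF that] hhL(2)[OF that] open_contains_ball by blast
  then obtain e where e: "\<And>s. s \<in> \<F> \<Longrightarrow> e s > 0 \<and> ball (\<v> (hh s)) (e s) \<subseteq> VV s" by metis
  have "\<exists>a b. hh s = emb a / emb b \<and> a \<in> cpoly_ring n \<and> b \<in> cpoly_ring n \<and> emb b \<noteq> 0" if "s \<in> \<F>" for s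
    using hhL(1)[OF that] \<L>_subset unfolding ratfun_field_eq fracs_def by blast
  then obtain num den where nd: "\<And>s. s \<in> \<F> \<Longrightarrow> hh s = emb (num s) / emb (den s) \<and>
      num s \<in> cpoly_ring n \<and> den s \<in> cpoly_ring n \<and> emb (den s) \<noteq> 0" by metis
  \<comment> \<open>Bounds \<open>|u|\<close> at the approximating point, where \<open>u\<close> is
    within 1 of \<open>\<phi> u\<close>.\<close>
  define a0 where "a0 = cmod (\<phi> u) + 1"
  have a0: "a0 > 0" unfolding a0_def by (simp add: add_nonneg_pos)
  \<comment> \<open>The inequality gives
    \<open>|1/h| = |u|^p / |y|^q \<ge> |u|^(p - \<theta> q) / C^q\<close>. The exponent is at most
    0, so \<open>|u| \<le> a0\<close> makes \<open>\<epsilon>0\<close> a lower bound for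
    \<open>|1/h|\<close>.\<close>
  define \<epsilon>0 where "\<epsilon>0 = a0 powr (real p - \<theta> * real q) / C ^ q"
  have \<epsilon>0: "\<epsilon>0 > 0" using a0 C(1) by (simp add: \<epsilon>0_def)
  define \<epsilon> where "\<epsilon> = Min (insert 1 (insert \<epsilon>0 (e ` \<F>)))"
  have \<epsilon>: "\<epsilon> > 0" "\<epsilon> \<le> 1" "\<epsilon> \<le> \<epsilon>0" "\<And>s. s \<in> \<F> \<Longrightarrow> \<epsilon> \<le> e s"
  proof -
    have fin: "finite (insert 1 (insert \<epsilon>0 (e ` \<F>)))" using \<F>(1) by simp
    show "\<epsilon> > 0" unfolding \<epsilon>_def using fin e \<epsilon>0 by (subst Min_gr_iff) auto
    show "\<epsilon> \<le> 1" "\<epsilon> \<le> \<epsilon>0" "\<And>s. s \<in> \<F> \<Longrightarrow> \<epsilon> \<le> e s"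
      unfolding \<epsilon>_def by (rule Min_le[OF fin], simp)+
  qed
  \<comment> \<open>Functions whose values have to be approximated: \<open>1/h\<close>, the
    coordinates of the chart (among them \<open>u\<close>) and the functions describing
    \<open>U\<close>.\<close>
  define W where "W = insert (inverse h) (coordX i ` {..n} \<union> hh ` \<F>)"
  \<comment> \<open>Functions that must not vanish: \<open>u\<close>, to reach an affine point off
    \<open>D_X\<close>, and the denominators, to evaluate the \<open>hh s\<close> there as quotients
    of polynomials.\<close>
  define \<Delta> where "\<Delta> = insert u ((\<lambda>s. emb (den s)) ` \<F>)"
  have W: "finite W" "W \<subseteq> adjoin \<L> (inverse h)"
    using \<F>(1) uL hhL(1) L.base_subset_adjoin[of "inverse h"] L.gen_mem_adjoin[of "inverse h"] by (auto simp: W_def)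
  have \<Delta>: "finite \<Delta>" "\<And>D. D \<in> \<Delta> \<Longrightarrow> D \<noteq> 0" using \<F>(1) u0 nd by (auto simp: \<Delta>_def)
  have \<Delta>K: "D \<in> ratfun_field n" if "D \<in> \<Delta>" for D
    using that nd uL[of 0] \<L>_subset by (auto simp: \<Delta>_def u_def intro: emb_mem_ratfun_field)
  \<comment> \<open>The affine coordinates are quotients of chart coordinates by \<open>u\<close>,
    so \<open>W\<close> already generates the function field.\<close>
  have KS: "ratfun_field n \<subseteq> fracs S" if S: "subring_set S" "W \<subseteq> S" "range rconst \<subseteq> S" for S
  proof -
    interpret F: subring_set "fracs S" by (rule subring_set_fracs[OF S(1)])
    note SF = subset_fracs[OF S(1)]
    have c: "rconst c \<in> fracs S" for c using SF S(3) by blast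
    have x: "emb (cvar j) \<in> fracs S" if "j \<in> {1..n}" for j
    proof -
      have "coordX i j \<in> fracs S" "coordX i 0 \<in> fracs S" using that S(2) SF by (auto simp: W_def)
      moreover have "emb (cvar j) = coordX i j * inverse (coordX i 0)"
        using that i xi0 by (simp add: coordX_def graph_coord_def emb_1 divide_inverse)
      ultimately show ?thesis using F.mult_mem inverse_mem_fracs[OF S(1)] by simp
    qed
    show ?thesis
      unfolding ratfun_field_eq
      using emb_mem_subring[OF F.subring_set_axioms c x] inverse_mem_fracs[OF S(1)]
      by (intro fracs_subset_field F.subring_set_axioms) blast+
  qed
  have DS: "D \<in> fracs S" if "D \<in> \<Delta>" "subring_set S" "W \<subseteq> S" "range rconst \<subseteq> S" for D S
    using KS[OF that(2-4)] \<Delta>K[OF that(1)] by blast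
  obtain V \<psi> where V: "complex_place rconst V \<psi>" "W \<subseteq> V" "\<And>w. w \<in> W \<Longrightarrow> cmod (\<psi> w - \<phi> w) < \<epsilon>"
    "\<And>D. D \<in> \<Delta> \<Longrightarrow> D \<in> V \<and> \<psi> D \<noteq> 0"
  proof (rule \<phi>.places_near_point[OF W \<epsilon>(1) \<Delta>(1)])
    show "D \<in> fracs S" if "D \<in> \<Delta>" "subring_set S" "W \<subseteq> S" "range rconst \<subseteq> S" for D S
      by (rule DS[OF that])
    show "D \<noteq> 0" if "D \<in> \<Delta>" for D by (rule \<Delta>(2)[OF that])
  qed blast
  interpret V: complex_place rconst V \<psi> by (rule V(1))
  have uV: "u \<in> V" "\<psi> u \<noteq> 0" using V(4)[of u] by (auto simp: \<Delta>_def)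
  have iuV: "inverse u \<in> V" by (rule V.inverse_mem[OF uV])
  have xV: "emb (cvar j) \<in> V" if "j \<in> {1..n}" for j
  proof -
    have "emb (cvar j) = coordX i j * inverse u"
      using that i xi0 by (simp add: u_def coordX_def graph_coord_def emb_1 divide_inverse)
    moreover have "coordX i j \<in> V" using V(2) that by (auto simp: W_def)
    ultimately show ?thesis using iuV by (simp add: V.mult_mem)
  qed
  define x where "x j = \<psi> (emb (cvar j))" for j
  define z' where "z' = affine_vector n x"
  define w' where "w' = affine_vector m (\<lambda>k. cpoly_eval x (f k))"
  obtain M' where np: "normalization_point n m f z' w' M'"
    using graph_point_of_place[OF poly_map V(1) xV] unfolding z'_def w'_def x_def by metis
  interpret N: normalization_point n m f z' w' M' by (rule np)
  define \<eta> where "\<eta> = (N.pt, M')"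
  have z'0: "z' 0 = 1" "w' 0 = 1" by (simp_all add: z'_def w'_def affine_vector_def)
  have xO: "emb (cvar j) \<in> N.\<O>" "N.germ_at (emb (cvar j)) = x j" if "j \<in> {1..n}" for j
  proof -
    have *: "emb (cvar j) = N.coordX 0 j" using that by (simp add: N.coordX_def graph_coord_def emb_1)
    show "emb (cvar j) \<in> N.\<O>" unfolding * using N.coordX(1)[of 0 j] that z'0 by simp
    show "N.germ_at (emb (cvar j)) = x j"
      unfolding * using N.coordX(2)[of 0 j] that z'0 by (simp add: z'_def affine_vector_def)
  qed
  have embO: "emb P \<in> N.\<O>" "N.germ_at (emb P) = cpoly_eval x P" "emb P \<in> V" "\<psi> (emb P) = cpoly_eval x P"
    if P: "P \<in> cpoly_ring n" for P
  proof -
    show "emb P \<in> N.\<O>" by (rule emb_mem_subring[OF N.germ.subring_set_axioms N.germ.const_mem xO(1) P])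
    show "emb P \<in> V" by (rule emb_mem_subring[OF V.subring_set_axioms V.const_mem xV P])
    show "\<psi> (emb P) = cpoly_eval x P"
      unfolding x_def by (rule pt_emb[OF V.complex_point_axioms xV P])
    have "N.germ_at (emb P) = cpoly_eval (\<lambda>j. N.germ_at (emb (cvar j))) P"
      by (rule pt_emb[OF N.germ.complex_point_axioms xO(1) P])
    also have "\<dots> = cpoly_eval x P"
      using P xO(2) by (intro cpoly_subst_cong[of P "{1..n}"]) (auto simp: cpoly_ring_eq)
    finally show "N.germ_at (emb P) = cpoly_eval x P" .
  qed
  \<comment> \<open>The value of \<open>hh s\<close> at \<open>\<eta>\<close> is
    \<open>\<psi> (hh s)\<close>, both being the quotient of \<open>num s\<close> and
    \<open>den s\<close> at \<open>x\<close>. As \<open>\<psi>\<close> is close to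
    \<open>\<phi>\<close>, which extends \<open>\<v>\<close>, this value lies in
    \<open>VV s\<close>.\<close>
  have "\<eta> \<in> s" if s: "s \<in> \<F>" for s
  proof -
    note nds = nd[OF s]
    have d: "cpoly_eval x (den s) \<noteq> 0"
      using V(4)[of "emb (den s)"] s embO(4)[of "den s"] nds by (auto simp: \<Delta>_def)
    have invO: "inverse (emb (den s)) \<in> N.\<O>"
      using embO(1,2)[of "den s"] nds d by (intro N.germ_inverse) auto
    have hO: "hh s \<in> N.\<O>" using nds embO(1)[of "num s"] invO by (auto simp: divide_inverse intro: N.germ.mult_mem)
    have invV: "inverse (emb (den s)) \<in> V" using embO(3,4)[of "den s"] nds d by (intro V.inverse_mem) auto
    have "N.germ_at (hh s) = cpoly_eval x (num s) / cpoly_eval x (den s)"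
      using nds embO(1,2)[of "num s"] embO(1,2)[of "den s"] invO N.germ.pt_inverse(2)[of "emb (den s)"]
      by (simp add: divide_inverse N.germ.pt_mult)
    also have "\<dots> = \<psi> (hh s)"
      using nds embO(3,4)[of "num s"] embO(3,4)[of "den s"] invV V.pt_inverse(2)[of "emb (den s)"]
      by (simp add: divide_inverse V.pt_mult)
    finally have val: "N.\<v> (hh s) = \<psi> (hh s)" using N.\<v>_germ[OF hO] by simp
    have "cmod (\<psi> (hh s) - \<phi> (hh s)) < \<epsilon>" using V(3)[of "hh s"] s by (auto simp: W_def)
    then have "\<psi> (hh s) \<in> ball (\<v> (hh s)) (e s)"
      using \<epsilon>(4)[OF s] \<phi>(2)[OF hhL(1)[OF s]] by (simp add: dist_norm norm_minus_commute)
    then have "N.\<v> (hh s) \<in> VV s" using e[OF s] val by auto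
    then have "\<eta> \<in> basic (hh s) (VV s)"
      using hO N.\<O>_subset_\<L> N.norm_mem by (auto simp: basic_def \<eta>_def)
    then show ?thesis using hV(1)[OF s] by simp
  qed
  then have \<eta>U: "\<eta> \<in> U" using \<F>(4) by blast
  have zw: "z' i \<noteq> 0" "w' l \<noteq> 0"
    using U[OF \<eta>U] by (auto simp: \<eta>_def mem_coord_open)
  have "\<eta> \<in> graph_in_norm n m f"
    using N.norm_mem unfolding graph_in_norm_def graph_points_def \<eta>_def z'_def w'_def affine_point_eq by auto
  moreover have "\<eta> \<notin> div_X n m f" using N.mem_div_X z'0 by (simp add: \<eta>_def)
  ultimately have "norm (coord_ratio 0 l (proj_Y \<eta>)) \<le> C * norm (coord_ratio 0 i (proj_X \<eta>)) powr \<theta>"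
    using ineq \<eta>U by blast
  then have le: "1 / cmod (w' l) \<le> C * (1 / cmod (z' i)) powr \<theta>"
    using zw z'0 by (simp add: \<eta>_def coord_ratio_proj_class norm_divide)
  define a where "a = cmod (\<psi> u)"
  have zi: "z' i = x i" using i by (simp add: z'_def affine_vector_def)
  have "\<psi> u = inverse (x i)"
    using V.pt_inverse(2)[OF xV[OF i(1)], folded u_eq, OF uV(1) xi0] by (simp add: x_def)
  then have a: "a = 1 / cmod (z' i)" "a > 0" using uV(2) by (simp_all add: a_def zi norm_inverse divide_inverse)
  have gpoly: "graph_coord f (Inr l) \<in> cpoly_ring n" by (rule graph_coord_mem(2)[OF l(1)])
  have "cpoly_eval x (graph_coord f (Inr l)) = w' l"
    using l(1) by (simp add: w'_def affine_vector_def graph_coord_def)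
  then have g: "g \<in> V" "\<psi> g = w' l" using embO(3,4)[OF gpoly] by (simp_all add: g_def)
  have "inverse h = u ^ p * g ^ q" by (simp add: h_def y_eq power_inverse divide_inverse)
  then have "\<psi> (inverse h) = \<psi> u ^ p * w' l ^ q"
    using uV(1) g by (simp add: V.pt_mult V.pt_power V.power_mem)
  then have abs: "cmod (\<psi> (inverse h)) = a ^ p * cmod (w' l) ^ q"
    by (simp add: norm_mult norm_power a_def)
  have "u \<in> W" by (auto simp: W_def u_def)
  then have "cmod (\<psi> u - \<phi> u) < 1" using V(3) \<epsilon>(2) by fastforce
  then have "a \<le> a0" unfolding a_def a0_def using norm_triangle_ineq2[of "\<psi> u" "\<phi> u"] by simp
  \<comment> \<open>Powers with nonpositive exponent are decreasing in the base.\<close>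
  then have "a0 powr (real p - \<theta> * real q) \<le> a powr (real p - \<theta> * real q)"
    using a(2) pq(3) by (intro powr_mono2') auto
  also have "\<dots> = a ^ p / (a powr \<theta>) ^ q"
    using a(2) by (simp add: powr_diff powr_realpow powr_powr flip: powr_realpow[of "a powr \<theta>"])
  also have "\<dots> / C ^ q = a ^ p / (C * a powr \<theta>) ^ q" by (simp add: power_mult_distrib mult.commute)
  also have "\<dots> \<le> a ^ p / (1 / cmod (w' l)) ^ q"
    using le a C(1) zw by (intro divide_left_mono power_mono mult_pos_pos) auto
  also have "\<dots> = cmod (\<psi> (inverse h))" by (simp add: abs power_divide)
  finally have "\<epsilon>0 \<le> cmod (\<psi> (inverse h))" using C(1) by (simp add: \<epsilon>0_def divide_right_mono)
  moreover have "cmod (\<psi> (inverse h) - \<phi> (inverse h)) < \<epsilon>" using V(3)[of "inverse h"] by (simp add: W_def)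
  ultimately show False using \<phi>(3) \<epsilon>(3) by simp
qed

end

text \<open>Each good pair \<open>(p, q)\<close> gives an admissible exponent \<open>p/q\<close>,
  and each admissible \<open>\<theta>\<close> makes all pairs of slope at most
  \<open>\<theta>\<close> good. Thus the supremum is that of the good slopes, by density of the
  rationals.\<close>

lemma Sup_eq_inverse_Inf_slopes:
  fixes \<Theta> :: "real \<Rightarrow> bool" and P :: "nat \<Rightarrow> nat \<Rightarrow> bool"
  assumes zero: "\<Theta> 0" and nonneg: "\<And>\<theta>. \<Theta> \<theta> \<Longrightarrow> \<theta> \<ge> 0"
    and slope: "\<And>p q. p > 0 \<Longrightarrow> q > 0 \<Longrightarrow> P p q \<Longrightarrow> \<Theta> (p / q)"
    and below: "\<And>\<theta> p q. \<Theta> \<theta> \<Longrightarrow> p > 0 \<Longrightarrow> q > 0 \<Longrightarrow> real p \<le> \<theta> * real q \<Longrightarrow> P p q"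
  shows "Sup {ereal \<theta> | \<theta>. \<Theta> \<theta>} = 1 / Inf {ereal (real q / real p) | p q. p > 0 \<and> q > 0 \<and> P p q}"
    (is "?S = 1 / ?I")
proof (rule antisym)
  let ?A = "{ereal (real q / real p) | p q. p > 0 \<and> q > 0 \<and> P p q}"
  have I0: "0 \<le> ?I" by (rule Inf_greatest) auto
  show "?S \<le> 1 / ?I"
  proof (rule Sup_least)
    fix t assume "t \<in> {ereal \<theta> | \<theta>. \<Theta> \<theta>}"
    then obtain \<theta> where t: "t = ereal \<theta>" "\<Theta> \<theta>" by blast
    show "t \<le> 1 / ?I"
    proof (cases "\<theta> = 0")
      case True
      then show ?thesis using I0 by (simp add: t divide_ereal_def ereal_inverse_nonneg_iff flip: zero_ereal_def)
    next
      case False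
      then have pos: "\<theta> > 0" using nonneg[OF t(2)] by simp
      \<comment> \<open>Rationals \<open>q/p\<close> slightly above \<open>1/\<theta>\<close>
        satisfy \<open>p < \<theta> q\<close> and hence belong to the set.\<close>
      have "?I \<le> ereal (1 / \<theta>)"
      proof (rule dense_ge)
        fix r :: ereal assume r: "ereal (1 / \<theta>) < r"
        obtain s where s: "ereal (1 / \<theta>) < ereal s" "ereal s < r" using r ereal_dense2 by metis
        then obtain v :: rat where v: "1 / \<theta> < of_rat v" "of_rat v < s" using of_rat_dense[of "1 / \<theta>" s] by auto
        then have v0: "v > 0" using pos by (metis less_trans zero_less_divide_1_iff zero_less_of_rat_iff)
        obtain c d where cd: "quotient_of v = (c, d)" by fastforce
        have d: "d > 0" "v = of_int c / of_int d" using quotient_of_denom_pos[OF cd] quotient_of_div[OF cd] by auto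
        have c: "c > 0" using v0 d by (simp add: zero_less_divide_iff)
        have eq: "(of_rat v :: real) = real (nat c) / real (nat d)" using c d by (simp add: of_rat_divide)
        have "1 / \<theta> < real (nat c) / real (nat d)" using v(1) eq by simp
        then have "real (nat d) < \<theta> * real (nat c)" using pos d(1) c by (simp add: field_simps)
        then have "P (nat d) (nat c)" using below[OF t(2), of "nat d" "nat c"] c d(1) by simp
        then have "ereal (real (nat c) / real (nat d)) \<in> ?A" using c d(1) by fastforce
        then have "?I \<le> ereal (real (nat c) / real (nat d))" by (rule Inf_lower)
        also have "\<dots> \<le> ereal s" using v(2) eq by simp
        also have "\<dots> \<le> r" using s(2) by (rule order_less_imp_le)
        finally show "?I \<le> r" .
      qed
      then have "inverse (ereal (1 / \<theta>)) \<le> inverse ?I" using I0 pos by (intro ereal_inverse_antimono) auto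
      then show ?thesis using pos by (simp add: t divide_ereal_def)
    qed
  qed
  show "1 / ?I \<le> ?S"
  proof (cases "?A = {}")
    case True
    \<comment> \<open>With no good pair the infimum is \<infinity> and its reciprocal 0, which the
      exponent 0 dominates.\<close>
    have "ereal 0 \<le> ?S" using zero by (intro Sup_upper) blast
    then show ?thesis unfolding True by (simp add: Inf_empty top_ereal_def zero_ereal_def)
  next
    case False
    have le: "ereal (real p / real q) \<le> ?S" if "p > 0" "q > 0" "P p q" for p q
      using slope[OF that] by (intro Sup_upper) blast
    obtain p q where pq: "p > 0" "q > 0" "P p q" using False by blast
    then have "0 < ereal (real p / real q)" by simp
    then have Spos: "0 < ?S" using le[OF pq] by (rule less_le_trans)
    have "inverse ?S \<le> ?I"
    proof (rule Inf_greatest)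
      fix r assume "r \<in> ?A"
      then obtain p q where pq: "r = ereal (real q / real p)" "p > 0" "q > 0" "P p q" by blast
      have "inverse ?S \<le> inverse (ereal (real p / real q))"
        using le[OF pq(2-4)] by (intro ereal_inverse_antimono) auto
      then show "inverse ?S \<le> r" using pq by simp
    qed
    then have "inverse ?I \<le> inverse (inverse ?S)" using Spos by (intro ereal_inverse_antimono) (auto simp: ereal_inverse_nonneg_iff)
    \<comment> \<open>This includes an infinite \<open>?S\<close>, whose inverse is 0: the
      convention \<open>1/0 = \<infinity>\<close>.\<close>
    also have "\<dots> = ?S" using Spos by (cases ?S) auto
    finally show ?thesis by (simp add: divide_ereal_def)
  qed
qed

theorem theorem4p9:
  fixes n m :: nat
    and f :: "nat \<Rightarrow> nat cpoly"
    and \<xi> :: npoint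
    and i l :: nat
  assumes "\<forall>k\<in>{1..m}. f k \<in> cpoly_ring n"
    and "\<xi> \<in> div_X n m f"
    and "admissible_charts n m f \<xi> i l"
  defines "R \<equiv> local_ring_at n m f \<xi>"
    and "I \<equiv> ideal_X n m f \<xi>"
    and "J \<equiv> ideal_Y n m f \<xi>"
  shows "loj_analytic n m f \<xi> i l
           = 1 / loj_families R (\<lambda>q. ideal_power R J q) (\<lambda>p. ideal_power R I p)
       \<and> loj_analytic n m f \<xi> i l = 1 / loj_ideals R J I
       \<and> loj_analytic n m f \<xi> i l
           = 1 / Inf {ereal (real q / real p) | p q :: nat. p > 0 \<and> q > 0 \<and>
               (\<forall>\<^sub>F t in sequentially.
                  ideal_power R J (q * t) \<subseteq> ideal_integral_closure R (ideal_power R I (p * t)))}"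
proof -
  have "\<xi> \<in> norm_graph n m f" using assms(2) by (simp add: div_X_def)
  then obtain z w M where \<xi>: "\<xi> = ((proj_class z, proj_class w), M)" and np: "normalization_point n m f z w M"
    using normalization_pointE[OF assms(1)] by metis
  interpret N: normalization_point n m f z w M by (rule np)
  have ch: "i \<in> {1..n}" "z i \<noteq> 0" "l \<le> m" "w l \<noteq> 0" "i \<le> n"
    using assms(3) by (auto simp: admissible_charts_def \<xi> proj_X_def proj_Y_def mem_coord_open)
  define u where "u = N.coordX i 0"
  define y where "y = N.coordY l 0"
  have u: "u \<in> N.\<L>" "u \<noteq> 0" "y \<in> N.\<L>"
    using N.coordX(1)[OF ch(5) le0 ch(2)] N.coordY(1)[OF ch(3) le0 ch(4)] N.\<O>_subset_\<L> N.coord_X(3)[OF ch(5) le0 ch(2)]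
    by (auto simp: u_def y_def N.coordX_def graph_coord_def emb_1)
  have I: "I = subring_set.principal N.\<L> u" unfolding I_def \<xi> u_def by (rule N.ideal_X_eq[OF ch(5,2)])
  have J: "J = subring_set.principal N.\<L> y" unfolding J_def \<xi> y_def by (rule N.ideal_Y_eq[OF ch(3,4)])
  have "loj_analytic n m f \<xi> i l = Sup {ereal \<theta> | \<theta>. N.analytic_bound i l \<theta>}"
    by (simp add: loj_analytic_def N.analytic_bound_def \<xi>)
  moreover have "\<dots> = 1 / Inf {ereal (real q / real p) | p q :: nat. p > 0 \<and> q > 0 \<and> y ^ q / u ^ p \<in> N.\<L>}"
  proof (rule Sup_eq_inverse_Inf_slopes)
    \<comment> \<open>Exponent 0 comes from \<open>p = 0\<close> and \<open>q = 1\<close>: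
      \<open>y\<close> itself is regular.\<close>
    show "N.analytic_bound i l 0"
      using N.analytic_bound_if_regular[OF ch(5,2,3,4), of 1 0] u(3) by (simp add: y_def)
    show "\<theta> \<ge> 0" if "N.analytic_bound i l \<theta>" for \<theta> using that by (simp add: N.analytic_bound_def)
    show "N.analytic_bound i l (p / q)" if "p > 0" "q > 0" "y ^ q / u ^ p \<in> N.\<L>" for p q
      using N.analytic_bound_if_regular[OF ch(5,2,3,4) that(2)] that(3) by (simp add: u_def y_def)
    show "y ^ q / u ^ p \<in> N.\<L>" if "N.analytic_bound i l \<theta>" "p > 0" "q > 0" "real p \<le> \<theta> * real q" for \<theta> p q
      unfolding u_def y_def by (rule N.regular_if_analytic_bound[OF ch(1-4) that])
  qed
  moreover have iff: "y ^ q / u ^ p \<in> N.\<L> \<longleftrightarrow> (\<forall>\<^sub>F t in sequentially.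
      ideal_power R J (q * t) \<subseteq> ideal_integral_closure R (ideal_power R I (p * t)))" if "q > 0" for p q
    unfolding R_def I J \<xi> by (rule N.eventually_ideal_power_subset_iff[OF u that, symmetric])
  have "{ereal (real q / real p) | p q :: nat. p > 0 \<and> q > 0 \<and> y ^ q / u ^ p \<in> N.\<L>} =
      {ereal (real q / real p) | p q :: nat. p > 0 \<and> q > 0 \<and> (\<forall>\<^sub>F t in sequentially.
         ideal_power R J (q * t) \<subseteq> ideal_integral_closure R (ideal_power R I (p * t)))}"
    by (rule Collect_cong) (use iff in blast)
  \<comment> \<open>Once the power families are inserted, the three right-hand sides are the same
    infimum.\<close>
  ultimately show ?thesis by (simp add: loj_ideals_def loj_families_def)
qed

end
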